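(* Let $n\geq 2$, let $V\subset\mathbb{R}^n$ be a nonempty open set, and let $f\in\mathcal{E}'(\mathbb{R}^n)\cap\mathcal{A}_V$ or $f\in C_\infty(\mathbb{R}^n)\cap\mathcal{A}_V$. If $N_0f|_V=0$, then $f=0$.
   Context: All functions and distributions are complex valued. $\mathcal{E}'(\mathbb{R}^n)$ is the space of compactly supported distributions, and $C_\infty(\mathbb{R}^n)$ is the set of all continuous functions on $\mathbb{R}^n$ which decay faster than any polynomial at infinity (i.e. $\sup_x(1+|x|)^k|f(x)|<\infty$ for every $k\in\mathbb{N}$). For $r\in\mathbb{R}$, $H^r(\mathbb{R}^n)=\{f\in\mathscr{S}'(\mathbb{R}^n):(1+|\cdot|^2)^{r/2}\hat f\in L^2(\mathbb{R}^n)\}$, and $H^{-\infty}(\mathbb{R}^n)=\bigcup_{r\in\mathbb{R}}H^r(\mathbb{R}^n)$. $\mathcal{P}$ is the set of all nonzero polynomials on $\mathbb{R}^n$ with complex coefficients; $P(\xi)=\sum_{|\alpha|\leq m}a_\alpha\xi^\alpha\in\mathcal{P}$ induces the constant coefficient operator $P(D)=\sum_{|\alpha|\leq m}a_\alpha D^\alpha$, $D^\alpha=D_1^{\alpha_1}\cdots D_n^{\alpha_n}$, $D_j=-i\partial_j$, acting on distributions. For a nonempty open set $V\subset\mathbb{R}^n$ the set of admissible functions is $$\mathcal{A}_V=\{f\in H^{-\infty}(\mathbb{R}^n): P(D)f|_V=0\text{ for some }P\in\mathcal{P}\},$$ where $|_V$ denotes restriction of distributions to $V$. Oriented lines are parametrized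 by $\Gamma=\{(z,\theta):\theta\in S^{n-1},\ z\in\theta^\perp\}$. The X-ray transform of scalar fields is $X_0f(z,\theta)=\int_{\mathbb{R}}f(z+s\theta)\,ds$, with adjoint $X_0^*\psi(x)=\int_{S^{n-1}}\psi(x-(x\cdot\theta)\theta,\theta)\,d\theta$. The formula for $X_0f$ is used for $f\in C_\infty(\mathbb{R}^n)$, and $X_0:\mathcal{E}'(\mathbb{R}^n)\to\mathcal{E}'(\Gamma)$ and $X_0^*:\mathcal{D}'(\Gamma)\to\mathcal{D}'(\mathbb{R}^n)$ are defined by duality: $\langle X_0f,\varphi\rangle=\langle f,X_0^*\varphi\rangle$ for $\varphi\in C^\infty(\Gamma)$, and $\langle X_0^*\psi,\eta\rangle=\langle\psi,X_0\eta\rangle$ for $\eta\in C_c^\infty(\mathbb{R}^n)$. The normal operator is $N_0=X_0^*X_0$; it satisfies $N_0f=2\,(f*|\cdot|^{1-n})$ (in the sense of distributions for $f\in\mathcal{E}'(\mathbb{R}^n)$). *)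

theory Defs
  imports "HOL-Analysis.Analysis" "HOL-Library.Poly_Mapping"
begin

type_synonym 'n cfun = "real^'n \<Rightarrow> complex"

type_synonym 'n functional = "'n cfun \<Rightarrow> complex"


section \<open>Multi-indices and derivatives\<close>

text \<open>A multi-index is an element of \<^typ>\<open>'n \<Rightarrow>\<^sub>0 nat\<close> and a polynomial, given by its coefficients, an
  element of \<^typ>\<open>('n \<Rightarrow>\<^sub>0 nat) \<Rightarrow>\<^sub>0 complex\<close>.  The index type carries no order, so an enumeration of
  the coordinates is chosen in order to write down the composition
  \<open>T\<^sub>1\<^bsup>\<alpha>\<^sub>1\<^esup> \<dots> T\<^sub>n\<^bsup>\<alpha>\<^sub>n\<^esup>\<close>; the choice is immaterial whenever the \<open>T\<^sub>j\<close> commute, as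
  they do on smooth functions and on distributions.\<close>

definition coords :: "'n::finite list" where
  "coords = (SOME js. distinct js \<and> set js = UNIV)"

definition multi_power :: "('n::finite \<Rightarrow> 'a \<Rightarrow> 'a) \<Rightarrow> ('n \<Rightarrow>\<^sub>0 nat) \<Rightarrow> 'a \<Rightarrow> 'a" where
  "multi_power T \<alpha> = foldr (\<lambda>j g. (T j ^^ Poly_Mapping.lookup \<alpha> j) \<circ> g) coords id"

definition multi_degree :: "('n::finite \<Rightarrow>\<^sub>0 nat) \<Rightarrow> nat" where
  "multi_degree \<alpha> = (\<Sum>j\<in>UNIV. Poly_Mapping.lookup \<alpha> j)"

text \<open>\<open>D\<^sub>j = - i \<partial>\<^sub>j\<close>\<close>

definition D_fun :: "'n::finite \<Rightarrow> 'n cfun \<Rightarrow> 'n cfun" where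
  "D_fun j f = (\<lambda>x. - \<i> * frechet_derivative f (at x) (axis j 1))"

definition smooth_functions :: "('n::finite) cfun set" where
  "smooth_functions = {f. \<forall>js x. foldr D_fun js f differentiable (at x)}"


section \<open>Test functions and distributions\<close>

definition fun_support :: "('n::finite) cfun \<Rightarrow> (real^'n) set" where
  "fun_support f = closure {x. f x \<noteq> 0}"

definition test_functions :: "('n::finite) cfun set" where
  "test_functions = {\<phi> \<in> smooth_functions. compact (fun_support \<phi>)}"

definition clinear_on :: "('n::finite) cfun set \<Rightarrow> 'n functional \<Rightarrow> bool" where
  "clinear_on S u \<longleftrightarrow>
     (\<forall>\<phi>\<in>S. \<forall>\<psi>\<in>S. u (\<lambda>x. \<phi> x + \<psi> x) = u \<phi> + u \<psi>) \<and>
     (\<forall>\<phi>\<in>S. \<forall>c. u (\<lambda>x. c * \<phi> x) = c * u \<phi>)"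

text \<open>A distribution is represented by a functional on all functions of which only the values on test
  functions are meaningful.\<close>

definition distributions :: "('n::finite) functional set" where
  "distributions = {u. clinear_on test_functions u \<and>
     (\<forall>K. compact K \<longrightarrow> (\<exists>C N. \<forall>\<phi>\<in>test_functions. fun_support \<phi> \<subseteq> K \<longrightarrow>
        norm (u \<phi>) \<le> C * (\<Sum>\<alpha> | multi_degree \<alpha> \<le> N. SUP x. norm (multi_power D_fun \<alpha> \<phi> x))))}"

definition vanishes_on :: "(real^'n) set \<Rightarrow> ('n::finite) functional \<Rightarrow> bool" where
  "vanishes_on V u \<longleftrightarrow> (\<forall>\<phi>\<in>test_functions. fun_support \<phi> \<subseteq> V \<longrightarrow> u \<phi> = 0)"

definition distr_support :: "('n::finite) functional \<Rightarrow> (real^'n) set" where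
  "distr_support u = - \<Union>{W. open W \<and> vanishes_on W u}"

definition compact_distributions :: "('n::finite) functional set" where
  "compact_distributions = {u \<in> distributions. compact (distr_support u)}"

text \<open>The pairing of a compactly supported distribution with a smooth function; it does not depend on
  the cutoff.\<close>

definition pairing :: "('n::finite) functional \<Rightarrow> 'n cfun \<Rightarrow> complex" where
  "pairing u \<psi> =
     (let \<rho> = (SOME \<rho>. \<rho> \<in> test_functions \<and>
                (\<exists>W. open W \<and> distr_support u \<subseteq> W \<and> (\<forall>x\<in>W. \<rho> x = 1)))
      in u (\<lambda>x. \<rho> x * \<psi> x))"

definition distr_of :: "('n::finite) cfun \<Rightarrow> 'n functional" where
  "distr_of f = (\<lambda>\<phi>. LINT x|lborel. f x * \<phi> x)"

definition D_distr :: "'n::finite \<Rightarrow> 'n functional \<Rightarrow> 'n functional" where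
  "D_distr j u = (\<lambda>\<phi>. - u (D_fun j \<phi>))"

definition poly_D :: "(('n::finite \<Rightarrow>\<^sub>0 nat) \<Rightarrow>\<^sub>0 complex) \<Rightarrow> 'n functional \<Rightarrow> 'n functional" where
  "poly_D P u = (\<lambda>\<phi>. \<Sum>\<alpha>\<in>Poly_Mapping.keys P. Poly_Mapping.lookup P \<alpha> * multi_power D_distr \<alpha> u \<phi>)"


section \<open>Tempered distributions and Sobolev spaces\<close>

definition schwartz_functions :: "('n::finite) cfun set" where
  "schwartz_functions = {\<phi> \<in> smooth_functions.
     \<forall>k \<alpha>. bdd_above (range (\<lambda>x. (1 + norm x) ^ k * norm (multi_power D_fun \<alpha> \<phi> x)))}"

definition tempered_distributions :: "('n::finite) functional set" where
  "tempered_distributions = {U. clinear_on schwartz_functions U \<and>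
     (\<exists>C k N. \<forall>\<phi>\<in>schwartz_functions.
        norm (U \<phi>) \<le> C * (\<Sum>\<alpha> | multi_degree \<alpha> \<le> N.
                          SUP x. (1 + norm x) ^ k * norm (multi_power D_fun \<alpha> \<phi> x)))}"

definition fourier :: "('n::finite) cfun \<Rightarrow> 'n cfun" where
  "fourier \<phi> = (\<lambda>\<xi>. LINT x|lborel. cis (- (x \<bullet> \<xi>)) * \<phi> x)"

definition fourier_distr :: "('n::finite) functional \<Rightarrow> 'n functional" where
  "fourier_distr U = (\<lambda>\<phi>. U (fourier \<phi>))"

definition L2_functions :: "('n::finite) cfun set" where
  "L2_functions = {g. g \<in> borel_measurable lborel \<and> integrable lborel (\<lambda>x. (norm (g x))\<^sup>2)}"

text \<open>A distribution is tempered if it is the restriction to test functions of an element \<open>U\<close> of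
  \<^const>\<open>tempered_distributions\<close>, which is then unique on Schwartz functions.\<close>

definition sobolev :: "real \<Rightarrow> ('n::finite) functional set" where
  "sobolev r = {u. \<exists>U\<in>tempered_distributions. (\<forall>\<phi>\<in>test_functions. U \<phi> = u \<phi>) \<and>
     (\<exists>g\<in>L2_functions. \<forall>\<phi>\<in>schwartz_functions.
        fourier_distr U (\<lambda>\<xi>. of_real ((1 + (norm \<xi>)\<^sup>2) powr (r/2)) * \<phi> \<xi>) = distr_of g \<phi>)}"

definition sobolev_minus_infinity :: "('n::finite) functional set" where
  "sobolev_minus_infinity = (\<Union>r. sobolev r)"

definition admissible :: "(real^'n) set \<Rightarrow> ('n::finite) functional set" where
  "admissible V = {u \<in> sobolev_minus_infinity. \<exists>P. P \<noteq> 0 \<and> vanishes_on V (poly_D P u)}"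

definition rapidly_decaying :: "('n::finite) cfun set" where
  "rapidly_decaying = {f. continuous_on UNIV f \<and>
     (\<forall>k::nat. bdd_above (range (\<lambda>x. (1 + norm x) ^ k * norm (f x))))}"


section \<open>The X-ray transform\<close>

text \<open>The surface measure of the unit sphere as a measure on the ambient space, by polar coordinates:
  \<open>\<sigma>(A) = n \<lambda>{x. 0 < |x| < 1 \<and> x/|x| \<in> A}\<close>.\<close>

definition sphere_measure :: "(real^'n::finite) measure" where
  "sphere_measure =
     scale_measure (of_nat CARD('n)) (distr (restrict_space lborel (ball 0 1)) borel sgn)"

text \<open>Functions on the manifold of oriented lines
  \<open>\<Gamma> = {(z, \<theta>). norm \<theta> = 1 \<and> z \<bullet> \<theta> = 0}\<close> are represented by functions on all pairs, of
  which only the values on \<open>\<Gamma>\<close> are meaningful: \<open>xray_adj\<close> evaluates its argument on \<open>\<Gamma>\<close> only.\<close>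

definition xray :: "('n::finite) cfun \<Rightarrow> (real^'n) \<times> (real^'n) \<Rightarrow> complex" where
  "xray f = (\<lambda>(z, \<theta>). LINT s|lborel. f (z + s *\<^sub>R \<theta>))"

definition xray_adj :: "((real^'n) \<times> (real^'n) \<Rightarrow> complex) \<Rightarrow> ('n::finite) cfun" where
  "xray_adj \<psi> = (\<lambda>x. LINT \<theta>|sphere_measure. \<psi> (x - (x \<bullet> \<theta>) *\<^sub>R \<theta>, \<theta>))"

definition xray_distr ::
    "('n::finite) functional \<Rightarrow> ((real^'n) \<times> (real^'n) \<Rightarrow> complex) \<Rightarrow> complex" where
  "xray_distr u = (\<lambda>\<phi>. pairing u (xray_adj \<phi>))"

definition xray_adj_distr ::
    "(((real^'n) \<times> (real^'n) \<Rightarrow> complex) \<Rightarrow> complex) \<Rightarrow> ('n::finite) functional" where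
  "xray_adj_distr \<Psi> = (\<lambda>\<eta>. \<Psi> (xray \<eta>))"

definition normal_fun :: "('n::finite) cfun \<Rightarrow> 'n cfun" where
  "normal_fun f = xray_adj (xray f)"

definition normal_distr :: "('n::finite) functional \<Rightarrow> 'n functional" where
  "normal_distr u = xray_adj_distr (xray_distr u)"

end

theory Submission
  imports Defs "HOL-Probability.Characteristic_Functions" "HOL-Probability.Sinc_Integral"
    "HOL-Real_Asymp.Real_Asymp" "HOL-Complex_Analysis.Cauchy_Integral_Formula"
begin

text \<open>Let \<open>P(D)f\<close> and \<open>N\<^sub>0f\<close> vanish on \<open>V\<close>.  Fix a test function \<open>\<phi>\<close> supported near a point of \<open>V\<close>, put
\<open>\<psi> = P(-D)\<phi>\<close> and consider \<open>F(x) = \<langle>f, \<psi>(\<cdot> - x)\<rangle>\<close>.  This is a bounded, continuous, integrable function, also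
when \<open>f\<close> is a distribution, and it inherits both hypotheses near \<open>x = 0\<close>: there \<open>F(x) = 0\<close> because
\<open>P(D)f|\<^sub>V = 0\<close>, and, the normal operator being convolution with \<open>2|\<cdot>|\<^bsup>1-n\<^esup>\<close>, the Riesz potential
\<open>\<integral> F(y) |y - x|\<^bsup>1-n\<^esup> dy\<close> equals half of \<open>\<langle>N\<^sub>0f, \<psi>(\<cdot> - x)\<rangle>\<close> and vanishes as well.

Unique continuation (\<open>riesz_unique_continuation\<close>) then gives \<open>F = 0\<close>.  The reason is the identity
\<open>\<Delta>|x|\<^bsup>-p\<^esup> = p(p + 2 - n)|x|\<^bsup>-p-2\<^esup>\<close>, whose constant is nonzero for \<open>p = n - 1 + 2j\<close>.  As \<open>F\<close> vanishes near the
origin, the Laplacian can be applied under the integral any number of times, so that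
\<open>\<integral> F(y) |y - x|\<^bsup>1-n\<^esup> q(|y - x|\<^bsup>-2\<^esup>) dy = 0\<close> for every polynomial \<open>q\<close> and all small \<open>x\<close>.  By the Weierstrass
approximation theorem \<open>q\<close> may be replaced by a continuous function, and a suitable choice turns the kernel into
\<open>exp(-a|y - x|\<^sup>2)\<close>.  The Gaussian transform of \<open>F\<close> is analytic in \<open>x\<close>, hence vanishes everywhere, and letting
\<open>a \<rightarrow> \<infinity>\<close> yields \<open>F = 0\<close>.

Now \<open>\<langle>f, P(-D)\<phi>(\<cdot> - x)\<rangle> = 0\<close> for all \<open>x\<close> and all \<open>\<phi>\<close> of small support.  If \<open>f\<close> is an integrable function, the
Fourier transform in \<open>x\<close> of this relation is a product of the Fourier transform of \<open>f\<close>, the polynomial \<open>P\<close> and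
the Fourier transform of \<open>\<phi>\<close>.  For any given frequency, \<open>\<phi>\<close> can be chosen such that the last
factor is nonzero there, and \<open>P\<close> vanishes on no open set, so the Fourier transform of \<open>f\<close> is zero and \<open>f = 0\<close> (\<open>constant_coefficient_injective\<close>).
If \<open>f\<close> is a compactly supported distribution, this applies to \<open>x \<mapsto> \<langle>f, \<eta>(\<cdot> - x)\<rangle>\<close> for each test function \<open>\<eta>\<close>,
because convolution is commutative, and at \<open>x = 0\<close> it gives \<open>\<langle>f, \<eta>\<rangle> = 0\<close>.

The analytic input is the formula for the normal operator, which comes from polar coordinates
(\<open>normal_fun_riesz\<close>), and the fact that a distribution may be taken under an integral over translates
(\<open>distribution_conv\<close>).\<close>

section \<open>The Laplacian of Riesz kernels\<close>

text \<open>Second differences are used in place of two differentiations under the integral sign: they need a single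
passage to the limit, and this mean value form supplies both the pointwise limit and the dominating bound.\<close>

lemma symmetric_second_difference:
  fixes f f' f'' :: "real \<Rightarrow> real"
  assumes h: "h > 0"
    and f: "\<And>t. \<bar>t\<bar> \<le> h \<Longrightarrow> (f has_real_derivative f' t) (at t)"
    and f': "\<And>t. \<bar>t\<bar> \<le> h \<Longrightarrow> (f' has_real_derivative f'' t) (at t)"
  obtains s where "0 < s" "s < h" "f h + f (-h) - 2 * f 0 = h\<^sup>2 / 2 * (f'' s + f'' (- s))"
proof -
  define D where "D = (\<lambda>k::nat. if k = 0 then (\<lambda>t. f t + f (-t)) else if k = 1 then (\<lambda>t. f' t - f' (-t))
     else (\<lambda>t. f'' t + f'' (-t)))"
  have 1: "((\<lambda>t. f t + f (-t)) has_real_derivative f' t - f' (-t)) (at t)" if "\<bar>t\<bar> \<le> h" for t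
  proof -
    have "((\<lambda>t. f (-t)) has_real_derivative f' (-t) * (-1)) (at t)"
      by (rule DERIV_chain2[where g=uminus]) (use f that in \<open>auto intro!: derivative_eq_intros\<close>)
    from DERIV_add[OF f[OF that] this] show ?thesis by simp
  qed
  have 2: "((\<lambda>t. f' t - f' (-t)) has_real_derivative f'' t + f'' (-t)) (at t)" if "\<bar>t\<bar> \<le> h" for t
  proof -
    have "((\<lambda>t. f' (-t)) has_real_derivative f'' (-t) * (-1)) (at t)"
      by (rule DERIV_chain2[where g=uminus]) (use f' that in \<open>auto intro!: derivative_eq_intros\<close>)
    from DERIV_diff[OF f'[OF that] this] show ?thesis by simp
  qed
  have "\<exists>s. 0 < s \<and> s < h \<and> D 0 h = (\<Sum>m<2. D m 0 / fact m * h ^ m) + D 2 s / fact 2 * h ^ 2"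
  proof (rule Maclaurin)
    show "\<forall>m t. m < 2 \<and> 0 \<le> t \<and> t \<le> h \<longrightarrow> DERIV (D m) t :> D (Suc m) t"
    proof (intro allI impI)
      fix m :: nat and t assume m: "m < 2 \<and> 0 \<le> t \<and> t \<le> h"
      then have "m = 0 \<or> m = 1" by auto
      then show "DERIV (D m) t :> D (Suc m) t"
        using 1[of t] 2[of t] m by (auto simp: D_def)
    qed
  qed (use h in auto)
  then obtain s where "0 < s" "s < h" "D 0 h = (\<Sum>m<2. D m 0 / fact m * h ^ m) + D 2 s / fact 2 * h ^ 2"
    by blast
  then show ?thesis
    by (intro that[of s]) (auto simp: D_def numeral_2_eq_2 field_simps)
qed

lemma powr_norm_eq: "norm (z::'a::real_inner) powr p = ((norm z)\<^sup>2) powr (p/2)"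
  by (cases "z = 0") (auto simp: powr_powr simp flip: powr_numeral)

text \<open>The second derivative at \<open>t\<close> of \<open>t \<mapsto> |z + te|\<^bsup>-p\<^esup>\<close> for a unit vector \<open>e\<close>.\<close>

definition riesz_second_deriv :: "real \<Rightarrow> 'a::euclidean_space \<Rightarrow> 'a \<Rightarrow> real \<Rightarrow> real" where
  "riesz_second_deriv p e z t = p * (p+2) * (e \<bullet> (z + t *\<^sub>R e))\<^sup>2 * norm (z + t *\<^sub>R e) powr (-p-4)
     - p * norm (z + t *\<^sub>R e) powr (-p-2)"

lemma riesz_kernel_second_difference:
  fixes z e :: "'a::euclidean_space"
  assumes e: "norm e = 1" and p: "p > 0" and h: "h > 0" and d: "d > 0" "norm z \<ge> d + h"
  obtains s where "0 < s" "s < h"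
    "norm (z + h *\<^sub>R e) powr (-p) + norm (z - h *\<^sub>R e) powr (-p) - 2 * norm z powr (-p) =
      h\<^sup>2 / 2 * (riesz_second_deriv p e z s + riesz_second_deriv p e z (-s))"
proof -
  define Q where "Q = (\<lambda>t. (norm z)\<^sup>2 + 2 * t * (e \<bullet> z) + t\<^sup>2)"
  have Q: "(norm (z + t *\<^sub>R e))\<^sup>2 = Q t" for t
    using e unfolding Q_def power2_norm_eq_inner
    by (simp add: inner_left_distrib inner_right_distrib inner_commute norm_eq_1 power2_eq_square)
  have Qpos: "Q t > 0" if "\<bar>t\<bar> \<le> h" for t
  proof -
    have "norm (z + t *\<^sub>R e) \<ge> norm z - \<bar>t\<bar>"
      using norm_triangle_ineq2[of z "- (t *\<^sub>R e)"] e by simp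
    then have "norm (z + t *\<^sub>R e) > 0" using that d by linarith
    then show ?thesis using Q[of t] by (metis zero_less_power)
  qed
  define b where "b = e \<bullet> z"
  define f where "f = (\<lambda>t. Q t powr (-p/2))"
  define f' where "f' = (\<lambda>t. - p * (b + t) * Q t powr (-p/2 - 1))"
  define f'' where "f'' = (\<lambda>t. p * (p+2) * (b + t)\<^sup>2 * Q t powr (-p/2 - 2) - p * Q t powr (-p/2 - 1))"
  have dQ: "(Q has_real_derivative 2 * (b + t)) (at t)" for t
    unfolding Q_def b_def by (auto intro!: derivative_eq_intros)
  have 1: "(f has_real_derivative f' t) (at t)" if "\<bar>t\<bar> \<le> h" for t
    unfolding f_def f'_def
    by (rule derivative_eq_intros dQ refl Qpos[OF that] | simp)+
  have 2: "(f' has_real_derivative f'' t) (at t)" if "\<bar>t\<bar> \<le> h" for t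
    unfolding f'_def f''_def
    by (rule derivative_eq_intros dQ refl Qpos[OF that] | simp add: field_simps power2_eq_square)+
  obtain s where s: "0 < s" "s < h" "f h + f (-h) - 2 * f 0 = h\<^sup>2 / 2 * (f'' s + f'' (- s))"
    using symmetric_second_difference[of h f f' f''] 1 2 h by blast
  have f: "norm (z + t *\<^sub>R e) powr (-p) = f t" for t
    by (simp add: f_def powr_norm_eq Q)
  have f2: "riesz_second_deriv p e z t = f'' t" for t
    using e by (simp add: riesz_second_deriv_def f''_def powr_norm_eq Q b_def inner_right_distrib norm_eq_1 diff_divide_distrib)
  show ?thesis
    by (rule that[of s]) (use s f[of h] f[of "-h"] f[of 0] in \<open>simp_all add: f2\<close>)
qed


lemma riesz_second_deriv_bound:
  fixes z e :: "'a::euclidean_space"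
  assumes "norm e = 1" "p > 0" "d > 0" "norm (z + t *\<^sub>R e) \<ge> d"
  shows "\<bar>riesz_second_deriv p e z t\<bar> \<le> (p * (p+2) + p) * d powr (-p-2)"
proof -
  define w where "w = z + t *\<^sub>R e"
  have w: "norm w \<ge> d" "norm w > 0" using assms by (auto simp: w_def)
  have "(e \<bullet> w)\<^sup>2 \<le> (norm w)\<^sup>2"
    using Cauchy_Schwarz_ineq2[of e w] assms(1) by (metis abs_le_square_iff abs_norm_cancel mult_1)
  then have "(e \<bullet> w)\<^sup>2 * norm w powr (-p-4) \<le> (norm w)\<^sup>2 * norm w powr (-p-4)"
    by (intro mult_right_mono) auto
  also have "\<dots> = norm w powr 2 * norm w powr (-p-4)" using w by simp
  also have "\<dots> = norm w powr (-p-2)"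
    by (subst powr_add[symmetric]) (simp add: algebra_simps)
  finally have 1: "(e \<bullet> w)\<^sup>2 * norm w powr (-p-4) \<le> norm w powr (-p-2)" .
  have 2: "norm w powr (-p-2) \<le> d powr (-p-2)"
    using w assms by (intro powr_mono2') auto
  have "\<bar>riesz_second_deriv p e z t\<bar> \<le> p * (p+2) * ((e \<bullet> w)\<^sup>2 * norm w powr (-p-4)) + p * norm w powr (-p-2)"
    unfolding riesz_second_deriv_def w_def[symmetric] using assms
    by (intro order_trans[OF abs_triangle_ineq4]) (simp add: abs_mult mult.assoc)
  also have "\<dots> \<le> p * (p+2) * d powr (-p-2) + p * d powr (-p-2)"
    using 1 2 assms by (intro add_mono mult_left_mono) auto
  finally show ?thesis by (simp add: algebra_simps)
qed

lemma integrable_mult_bounded: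
  fixes F :: "'a \<Rightarrow> complex"
  assumes "integrable M F" "g \<in> borel_measurable M" "\<And>y. y \<in> space M \<Longrightarrow> F y \<noteq> 0 \<Longrightarrow> norm (g y) \<le> B"
  shows "integrable M (\<lambda>y. F y * g y)"
proof (rule Bochner_Integration.integrable_bound[where f="\<lambda>y. F y * of_real B"])
  show "integrable M (\<lambda>y. F y * of_real B)" using assms(1) by simp
  show "AE y in M. norm (F y * g y) \<le> norm (F y * of_real B)"
  proof (intro AE_I2)
    fix y assume "y \<in> space M"
    then show "norm (F y * g y) \<le> norm (F y * of_real B)"
      using assms(3)[of y] by (cases "F y = 0") (auto simp: norm_mult intro!: mult_left_mono)
  qed
qed (use assms in auto)

lemma integrable_mult_riesz_kernel:
  fixes F :: "'a::euclidean_space \<Rightarrow> complex"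
  assumes F: "integrable lborel F" and supp: "\<And>y. norm y < r \<Longrightarrow> F y = 0"
    and p: "p > 0" and x: "norm x < r"
  shows "integrable lborel (\<lambda>y. F y * of_real (norm (y - x) powr (-p)))"
proof (rule integrable_mult_bounded[OF F, where B="(r - norm x) powr (-p)"])
  fix y assume "F y \<noteq> 0"
  then have "norm y \<ge> r" using supp[of y] by force
  then have "norm (y - x) \<ge> r - norm x" using norm_triangle_ineq2[of y x] by linarith
  then show "norm (complex_of_real (norm (y - x) powr (-p))) \<le> (r - norm x) powr (-p)"
    using x p by (simp add: norm_of_real powr_mono2')
qed auto

text \<open>The Laplacian under the integral sign.  Summed over an orthonormal basis, the second differences of
\<open>|\<cdot>|\<^bsup>-p\<^esup>\<close> converge to \<open>p(p + 2 - n)|\<cdot>|\<^bsup>-p-2\<^esup>\<close>; they are uniformly bounded on the support of \<open>F\<close>, which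
keeps a positive distance from \<open>x\<close>, while their integrals against \<open>F\<close> vanish by hypothesis.\<close>

lemma riesz_potential_laplacian:
  fixes F :: "'a::euclidean_space \<Rightarrow> complex" and p :: real
  assumes F: "integrable lborel F" and supp: "\<And>y. norm y < r \<Longrightarrow> F y = 0"
    and p: "p > 0" "p + 2 \<noteq> DIM('a)" and x: "norm x < r"
    and zero: "\<And>x. norm x < r \<Longrightarrow> (LINT y|lborel. F y * of_real (norm (y - x) powr (-p))) = 0"
  shows "(LINT y|lborel. F y * of_real (norm (y - x) powr (-p-2))) = 0"
proof -
  define d where "d = (r - norm x) / 2"
  have d: "d > 0" using x by (simp add: d_def)
  \<comment> \<open>Steps of at most \<open>d\<close>, half the distance from \<open>x\<close> to the sphere of radius \<open>r\<close>, keep the centre in the ball and the kernel bounded where \<open>F\<close> is nonzero.\<close>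
  define h where "h = (\<lambda>m. d / real (Suc m))"
  have h: "h m > 0" "h m \<le> d" for m
    using d by (auto simp: h_def field_simps)
  have h0: "h \<longlonglongrightarrow> 0" unfolding h_def by real_asymp
  define S where "S = (\<lambda>m y. \<Sum>e\<in>Basis. (norm (y - x + h m *\<^sub>R e) powr (-p) + norm (y - x - h m *\<^sub>R e) powr (-p)
      - 2 * norm (y - x) powr (-p)) / (h m)\<^sup>2)"
  define c where "c = p * (p + 2 - DIM('a))"
  have G0: "(\<Sum>e\<in>Basis. riesz_second_deriv p e z 0) = c * norm z powr (-p-2)" if "z \<noteq> 0" for z :: 'a
  proof -
    have "(\<Sum>e\<in>Basis. riesz_second_deriv p e z 0) =
        p * (p+2) * (\<Sum>e\<in>Basis. (z \<bullet> e)\<^sup>2) * norm z powr (-p-4) - DIM('a) * p * norm z powr (-p-2)"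
      by (simp add: riesz_second_deriv_def sum_subtractf sum_distrib_left sum_distrib_right inner_commute algebra_simps)
    also have "(\<Sum>e\<in>Basis. (z \<bullet> e)\<^sup>2) = norm z powr 2"
      using that by (simp add: power2_norm_eq_inner euclidean_inner[of z z]) (simp add: power2_eq_square)
    also have "p * (p+2) * norm z powr 2 * norm z powr (-p-4) = p * (p+2) * (norm z powr 2 * norm z powr (-p-4))"
      by simp
    also have "norm z powr 2 * norm z powr (-p-4) = norm z powr (-p-2)"
      by (subst powr_add[symmetric]) (simp add: algebra_simps)
    finally show ?thesis by (simp add: c_def algebra_simps)
  qed
  have far: "norm (y - x) \<ge> 2 * d" if "F y \<noteq> 0" for y
  proof -
    have "norm y \<ge> r" using supp[of y] that by force
    then show ?thesis using norm_triangle_ineq2[of y x] by (simp add: d_def)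
  qed
  have diff: "\<exists>s. 0 < s \<and> s < h m \<and> (norm (y - x + h m *\<^sub>R e) powr (-p) + norm (y - x - h m *\<^sub>R e) powr (-p)
      - 2 * norm (y - x) powr (-p)) / (h m)\<^sup>2 =
     (riesz_second_deriv p e (y - x) s + riesz_second_deriv p e (y - x) (-s)) / 2"
    if "F y \<noteq> 0" "e \<in> Basis" for y e m
  proof -
    have "norm (y - x) \<ge> d + h m" using far[OF that(1)] h(2)[of m] by linarith
    from riesz_kernel_second_difference[OF _ p(1) h(1)[of m] d this, of e] that
    obtain s where s: "0 < s" "s < h m"
      "norm (y - x + h m *\<^sub>R e) powr (-p) + norm (y - x - h m *\<^sub>R e) powr (-p) - 2 * norm (y - x) powr (-p) =
        (h m)\<^sup>2 / 2 * (riesz_second_deriv p e (y - x) s + riesz_second_deriv p e (y - x) (-s))"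
      by (metis norm_Basis)
    then show ?thesis using h(1)[of m] by (intro exI[of _ s]) auto
  qed
  have near: "norm (y - x + s *\<^sub>R e) \<ge> d" if "F y \<noteq> 0" "e \<in> Basis" "\<bar>s\<bar> \<le> d" for y e s
    using far[OF that(1)] norm_triangle_ineq2[of "y - x" "- (s *\<^sub>R e)"] that by simp
  define B where "B = DIM('a) * ((p * (p+2) + p) * d powr (-p-2))"
  have bound: "\<bar>S m y\<bar> \<le> B" if Fy: "F y \<noteq> 0" for m y
    unfolding S_def B_def
  proof (intro order_trans[OF sum_abs] sum_bounded_above)
    fix e :: 'a assume e: "e \<in> Basis"
    obtain s where s: "0 < s" "s < h m" "(norm (y - x + h m *\<^sub>R e) powr (-p) + norm (y - x - h m *\<^sub>R e) powr (-p)
      - 2 * norm (y - x) powr (-p)) / (h m)\<^sup>2 =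
     (riesz_second_deriv p e (y - x) s + riesz_second_deriv p e (y - x) (-s)) / 2"
      using diff[OF Fy e] by blast
    have "\<bar>riesz_second_deriv p e (y - x) t\<bar> \<le> (p * (p+2) + p) * d powr (-p-2)" if t: "t = s \<or> t = -s" for t
      by (rule riesz_second_deriv_bound[OF _ p(1) d near]) (use e Fy t s h[of m] in auto)
    note this[OF disjI1, OF refl] this[OF disjI2, OF refl]
    moreover have "\<bar>(u + v) / 2\<bar> \<le> B" if "\<bar>u\<bar> \<le> B" "\<bar>v\<bar> \<le> B" for u v B :: real
      using that unfolding abs_le_iff by (simp add: field_simps)
    ultimately show "\<bar>(norm (y - x + h m *\<^sub>R e) powr (-p) + norm (y - x - h m *\<^sub>R e) powr (-p)
      - 2 * norm (y - x) powr (-p)) / (h m)\<^sup>2\<bar> \<le> (p * (p+2) + p) * d powr (-p-2)"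
      unfolding s(3) by blast
  qed
  have lim: "(\<lambda>m. S m y) \<longlonglongrightarrow> c * norm (y - x) powr (-p-2)" if y: "F y \<noteq> 0" for y
  proof -
    have yx: "y - x \<noteq> 0" using far[OF y] d by auto
    show ?thesis
      unfolding S_def G0[OF yx, symmetric]
    proof (rule tendsto_sum)
      fix e :: 'a assume e: "e \<in> Basis"
      obtain s where s: "\<And>m. 0 < s m" "\<And>m. s m < h m"
        "\<And>m. (norm (y - x + h m *\<^sub>R e) powr (-p) + norm (y - x - h m *\<^sub>R e) powr (-p)
        - 2 * norm (y - x) powr (-p)) / (h m)\<^sup>2 =
       (riesz_second_deriv p e (y - x) (s m) + riesz_second_deriv p e (y - x) (- s m)) / 2"
        using diff[OF y e] by metis
      have s0: "s \<longlonglongrightarrow> 0"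
        by (rule tendsto_sandwich[OF _ _ tendsto_const h0])
          (use s in \<open>auto intro!: always_eventually less_imp_le\<close>)
      have cont: "isCont (riesz_second_deriv p e (y - x)) 0"
        unfolding riesz_second_deriv_def using yx by (auto intro!: continuous_intros)
      have "(\<lambda>m. riesz_second_deriv p e (y - x) (s m)) \<longlonglongrightarrow> riesz_second_deriv p e (y - x) 0"
        using isCont_tendsto_compose[OF cont s0] .
      moreover have "(\<lambda>m. riesz_second_deriv p e (y - x) (- s m)) \<longlonglongrightarrow> riesz_second_deriv p e (y - x) 0"
        using isCont_tendsto_compose[OF cont, of "\<lambda>m. - s m"] tendsto_minus[OF s0] by simp
      ultimately show "(\<lambda>m. (norm (y - x + h m *\<^sub>R e) powr (-p) + norm (y - x - h m *\<^sub>R e) powr (-p)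
        - 2 * norm (y - x) powr (-p)) / (h m)\<^sup>2) \<longlonglongrightarrow> riesz_second_deriv p e (y - x) 0"
        unfolding s(3) by (auto intro!: tendsto_eq_intros)
    qed
  qed
  have "(\<lambda>m. LINT y|lborel. F y * of_real (S m y)) \<longlonglongrightarrow> (LINT y|lborel. F y * of_real (c * norm (y - x) powr (-p-2)))"
  proof (rule integral_dominated_convergence[where w="\<lambda>y. norm (F y) * B"])
    show "AE y in lborel. (\<lambda>m. F y * of_real (S m y)) \<longlonglongrightarrow> F y * of_real (c * norm (y - x) powr (-p-2))"
    proof (intro AE_I2)
      fix y
      show "(\<lambda>m. F y * of_real (S m y)) \<longlonglongrightarrow> F y * of_real (c * norm (y - x) powr (-p-2))"
        using tendsto_mult[OF tendsto_const tendsto_of_real[OF lim[of y]], of "F y"] by (cases "F y = 0") simp_all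
    qed
    show "AE y in lborel. norm (F y * of_real (S m y)) \<le> norm (F y) * B" for m
    proof (intro AE_I2)
      fix y show "norm (F y * of_real (S m y)) \<le> norm (F y) * B"
        using bound[of y m] by (cases "F y = 0") (auto simp: norm_mult intro!: mult_left_mono)
    qed
    show "integrable lborel (\<lambda>y. norm (F y) * B)" using F by simp
    have [measurable]: "F \<in> borel_measurable lborel" using F by auto
    show "(\<lambda>y. F y * of_real (S m y)) \<in> borel_measurable lborel" for m
      unfolding S_def by measurable
    show "(\<lambda>y. F y * of_real (c * norm (y - x) powr (-p-2))) \<in> borel_measurable lborel"
      by measurable
  qed
  moreover have "(LINT y|lborel. F y * of_real (S m y)) = 0" for m
  proof -
    let ?k = "\<lambda>v y. F y * of_real (norm (y - v) powr (-p))"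
    have in_ball: "norm (x + s *\<^sub>R e) < r" if "e \<in> Basis" "\<bar>s\<bar> \<le> h m" for e s
      using norm_triangle_ineq[of x "s *\<^sub>R e"] that h(2)[of m] d by (simp add: d_def)
    have "F y * of_real (S m y) = (\<Sum>e\<in>Basis. (?k (x + (- h m) *\<^sub>R e) y + ?k (x + h m *\<^sub>R e) y - 2 * ?k x y) / of_real ((h m)\<^sup>2))" for y
      unfolding S_def by (simp add: sum_distrib_left algebra_simps diff_divide_distrib add_divide_distrib)
    moreover have "integrable lborel (?k v)" "integral\<^sup>L lborel (?k v) = 0" if "norm v < r" for v
      using integrable_mult_riesz_kernel[OF F supp p(1) that] zero[OF that] by auto
    ultimately show ?thesis
      using in_ball h(1)[of m] x by (simp add: Bochner_Integration.integral_sum del: scaleR_minus_left)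
  qed
  ultimately have "(LINT y|lborel. F y * of_real (c * norm (y - x) powr (-p-2))) = 0"
    by (simp add: LIMSEQ_const_iff)
  also have "(LINT y|lborel. F y * of_real (c * norm (y - x) powr (-p-2))) =
      (LINT y|lborel. of_real c * (F y * of_real (norm (y - x) powr (-p-2))))"
    by (simp add: mult_ac)
  also have "\<dots> = of_real c * (LINT y|lborel. F y * of_real (norm (y - x) powr (-p-2)))"
    by (rule integral_mult_right_zero)
  finally have "of_real c * (LINT y|lborel. F y * of_real (norm (y - x) powr (-p-2))) = 0" .
  moreover have "c \<noteq> 0" using p by (simp add: c_def)
  ultimately show ?thesis by simp
qed

section \<open>From Riesz potentials to Gaussian transforms\<close>

text \<open>Starting from \<open>p = n - 1\<close> the constants \<open>p(p + 2 - n)\<close> never vanish, since \<open>p + 2 - n = 2j + 1\<close> after \<open>j\<close>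
steps.  For the Newtonian kernel \<open>p = n - 2\<close> the argument would stop at once.\<close>

lemma riesz_potentials_vanish:
  fixes F :: "'a::euclidean_space \<Rightarrow> complex"
  assumes F: "integrable lborel F" and supp: "\<And>y. norm y < r \<Longrightarrow> F y = 0" and n: "DIM('a) \<ge> 2"
    and zero: "\<And>x. norm x < r \<Longrightarrow> (LINT y|lborel. F y * of_real (norm (y - x) powr (1 - real DIM('a)))) = 0"
    and x: "norm x < r"
  shows "(LINT y|lborel. F y * of_real (norm (y - x) powr (1 - real DIM('a) - 2 * real j))) = 0"
  using x
proof (induction j arbitrary: x)
  case 0
  then show ?case using zero by simp
next
  case (Suc j)
  let ?p = "real DIM('a) - 1 + 2 * real j"
  have *: "1 - real DIM('a) - 2 * real j = - ?p" "1 - real DIM('a) - 2 * real (Suc j) = - ?p - 2"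
    by auto
  have "(LINT y|lborel. F y * of_real (norm (y - x) powr (-?p-2))) = 0"
  proof (rule riesz_potential_laplacian[OF F supp])
    show "(LINT y|lborel. F y * of_real (norm (y - x) powr (-?p))) = 0" if "norm x < r" for x
      using Suc.IH[OF that] unfolding * .
    show "0 < ?p" using n by simp
    show "?p + 2 \<noteq> DIM('a)" by linarith
  qed (use Suc.prems in auto)
  then show ?case unfolding * .
qed

text \<open>With \<open>t = |y - x|\<^bsup>-2\<^esup>\<close>, which stays in a compact interval on the support of \<open>F\<close>, the vanishing potentials are
the moments of \<open>F(y)|y - x|\<^bsup>1-n\<^esup>\<close> with respect to \<open>t\<close>.  By the Weierstrass theorem the integral of
\<open>F(y)|y - x|\<^bsup>1-n\<^esup> Q(t)\<close> vanishes for every continuous \<open>Q\<close>; the function \<open>Q\<close> below is the one that produces a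
Gaussian.\<close>

lemma local_gaussian_transform_vanishes:
  fixes F :: "'a::euclidean_space \<Rightarrow> complex"
  assumes F: "integrable lborel F" and supp: "\<And>y. norm y < r \<Longrightarrow> F y = 0" and n: "DIM('a) \<ge> 2"
    and zero: "\<And>x. norm x < r \<Longrightarrow> (LINT y|lborel. F y * of_real (norm (y - x) powr (1 - real DIM('a)))) = 0"
    and x: "norm x < r" and a: "a > 0"
  shows "(LINT y|lborel. F y * of_real (exp (- a * (norm (y - x))\<^sup>2))) = 0"
proof -
  define q where "q = (real DIM('a) - 1) / 2"
  have q: "q > 0" using n by (simp add: q_def)
  define d where "d = r - norm x"
  have d: "d > 0" using x by (simp add: d_def)
  have far: "norm (y - x) \<ge> d" if "F y \<noteq> 0" for y
  proof -
    have "norm y \<ge> r" using supp[of y] that by force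
    then show ?thesis using norm_triangle_ineq2[of y x] by (simp add: d_def)
  qed
  \<comment> \<open>The factor \<open>t\<^bsup>-q\<^esup>\<close> cancels \<open>|y - x|\<^bsup>1-n\<^esup>\<close>; the exponential makes \<open>Q\<close> continuous at 0.\<close>
  define Q where "Q = (\<lambda>t::real. if t = 0 then 0 else t powr (-q) * exp (- a / t))"
  have Q_cont: "continuous_on {0..1/d\<^sup>2} Q"
  proof -
    have "isCont Q t" if "t > 0" for t
    proof -
      have "isCont (\<lambda>t. t powr (-q) * exp (- a / t)) t"
        using that by (intro continuous_intros) auto
      moreover have "eventually (\<lambda>s. s powr (-q) * exp (- a / s) = Q s) (nhds t)"
        using that by (intro eventually_mono[OF eventually_nhds_in_open[of "{0<..}" t]]) (auto simp: Q_def)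
      ultimately show ?thesis using isCont_cong by fast
    qed
    moreover have "(Q \<longlongrightarrow> Q 0) (at 0 within {0..1/d\<^sup>2})"
    proof -
      have "((\<lambda>t. t powr (-q) * exp (- a / t)) \<longlongrightarrow> 0) (at_right 0)"
        using q a by real_asymp
      then have "((\<lambda>t. t powr (-q) * exp (- a / t)) \<longlongrightarrow> 0) (at 0 within {0..1/d\<^sup>2})"
        using d by (simp add: at_within_Icc_at_right)
      moreover have "eventually (\<lambda>s. Q s = s powr (-q) * exp (- a / s)) (at 0 within {0..1/d\<^sup>2})"
        by (auto simp: eventually_at_filter Q_def)
      ultimately show ?thesis
        by (subst filterlim_cong[OF refl refl]) (auto simp: Q_def elim: eventually_mono)
    qed
    ultimately show ?thesis
      unfolding continuous_on by (metis atLeastAtMost_iff continuous_at_imp_continuous_at_within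
          continuous_within less_eq_real_def)
  qed
  define k where "k = (\<lambda>y. norm (y - x) powr (1 - real DIM('a)))"
  define t where "t = (\<lambda>y. 1 / (norm (y - x))\<^sup>2)"
  have [measurable]: "F \<in> borel_measurable lborel" using F by auto
  have int_Fk: "integrable lborel (\<lambda>y. F y * of_real (k y))"
    using integrable_mult_riesz_kernel[OF F supp, where p="real DIM('a) - 1" and x=x] n x by (simp add: k_def)
  have t01: "t y \<in> {0..1/d\<^sup>2}" if "F y \<noteq> 0" for y
    using far[OF that] d by (auto simp: t_def intro!: divide_left_mono power_mono mult_pos_pos)
  have kt: "k y * t y ^ j = norm (y - x) powr (1 - real DIM('a) - 2 * real j)" if "F y \<noteq> 0" for y j
  proof -
    have pos: "norm (y - x) > 0" using far[OF that] d by linarith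
    have "t y ^ j = inverse (norm (y - x) ^ (2 * j))"
      by (simp add: t_def power_mult inverse_eq_divide power_one_over)
    also have "\<dots> = inverse (norm (y - x) powr (2 * real j))"
      using powr_realpow[OF pos, of "2 * j"] by simp
    also have "\<dots> = norm (y - x) powr (- 2 * real j)"
      by (simp add: powr_minus)
    finally show ?thesis unfolding k_def by (simp flip: powr_add)
  qed
  have moment: "(LINT y|lborel. F y * of_real (k y * t y ^ j)) = 0" for j
  proof -
    have "(LINT y|lborel. F y * of_real (k y * t y ^ j)) =
       (LINT y|lborel. F y * of_real (norm (y - x) powr (1 - real DIM('a) - 2 * real j)))"
      by (intro Bochner_Integration.integral_cong refl) (metis kt mult_zero_left)
    then show ?thesis using riesz_potentials_vanish[OF F supp n zero x] by simp
  qed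
  have int_mom: "integrable lborel (\<lambda>y. F y * of_real (k y * t y ^ j))" for j
  proof -
    have "integrable lborel (\<lambda>y. (F y * of_real (k y)) * of_real (t y ^ j))"
    proof (rule integrable_mult_bounded[OF int_Fk, where B="(1/d\<^sup>2) ^ j"])
      fix y assume "F y * of_real (k y) \<noteq> 0"
      then have "t y \<in> {0..1/d\<^sup>2}" using t01 by auto
      then show "norm (complex_of_real (t y ^ j)) \<le> (1/d\<^sup>2) ^ j"
        by (auto simp: norm_power intro!: power_mono)
    qed (simp add: t_def)
    then show ?thesis by (simp add: mult_ac)
  qed
  have kQ: "k y * Q (t y) = exp (- a * (norm (y - x))\<^sup>2)" if "F y \<noteq> 0" for y
  proof -
    have pos: "norm (y - x) > 0" using far[OF that] d by linarith
    then have "t y \<noteq> 0" by (auto simp: t_def)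
    have "t y = norm (y - x) powr (-2)"
      using pos by (simp add: t_def powr_minus inverse_eq_divide)
    moreover have "(-2) * (-q) = real DIM('a) - 1" by (simp add: q_def field_simps)
    ultimately have "t y powr (-q) = norm (y - x) powr (real DIM('a) - 1)"
      by (simp only: powr_powr)
    then have "k y * t y powr (-q) = norm (y - x) powr 0"
      unfolding k_def by (simp flip: powr_add)
    then show ?thesis using \<open>t y \<noteq> 0\<close> pos by (simp add: Q_def t_def)
  qed
  define M where "M = (LINT y|lborel. norm (F y * of_real (k y)))"
  have M: "M \<ge> 0" unfolding M_def by simp
  have "norm (LINT y|lborel. F y * of_real (exp (- a * (norm (y - x))\<^sup>2))) \<le> e * M" if e: "e > 0" for e
  proof -
    obtain g where "real_polynomial_function g" and g: "\<And>s. s \<in> {0..1/d\<^sup>2} \<Longrightarrow> \<bar>Q s - g s\<bar> < e"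
      using Stone_Weierstrass_real_polynomial_function[OF _ Q_cont e] by blast
    then obtain c N where gs: "g = (\<lambda>s. \<Sum>i\<le>N. c i * s^i)"
      unfolding real_polynomial_function_iff_sum by blast
    let ?G = "\<lambda>y. F y * of_real (exp (- a * (norm (y - x))\<^sup>2))"
    let ?P = "\<lambda>y. F y * of_real (k y * g (t y))"
    have P_eq: "?P y = (\<Sum>i\<le>N. of_real (c i) * (F y * of_real (k y * t y ^ i)))" for y
      unfolding gs by (simp add: sum_distrib_left mult_ac)
    have P: "integrable lborel ?P" "integral\<^sup>L lborel ?P = 0"
      unfolding P_eq using int_mom moment by (simp_all add: Bochner_Integration.integral_sum)
    have G: "integrable lborel ?G"
      by (rule integrable_mult_bounded[OF F, where B=1]) (use a in auto)
    have "integral\<^sup>L lborel ?G = integral\<^sup>L lborel (\<lambda>y. ?G y - ?P y)"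
      using P G by simp
    also have "norm \<dots> \<le> (LINT y|lborel. e * norm (F y * of_real (k y)))"
    proof (rule Bochner_Integration.integral_norm_bound_integral)
      show "integrable lborel (\<lambda>y. e * norm (F y * of_real (k y)))" using int_Fk by auto
      fix y
      show "norm (?G y - ?P y) \<le> e * norm (F y * of_real (k y))"
      proof (cases "F y = 0")
        case False
        have "?G y - ?P y = F y * of_real (k y) * of_real (Q (t y) - g (t y))"
          using kQ[OF False] by (simp add: algebra_simps flip: of_real_mult)
        then show ?thesis
          using g[OF t01[OF False]] by (auto simp: norm_mult mult.commute[of e] abs_mult simp flip: of_real_diff
              intro!: mult_left_mono)
      qed auto
    qed (use P G in auto)
    also have "\<dots> = e * M" by (simp add: M_def)
    finally show ?thesis .
  qed
  note le = this
  have "norm (LINT y|lborel. F y * of_real (exp (- a * (norm (y - x))\<^sup>2))) \<le> 0"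
  proof (rule field_le_epsilon)
    fix e :: real assume e: "e > 0"
    have *: "e / (M + 1) * M \<le> e" using M e by (simp add: field_simps)
    then show "norm (LINT y|lborel. F y * of_real (exp (- a * (norm (y - x))\<^sup>2))) \<le> 0 + e"
      using order_trans[OF le[of "e / (M + 1)"] *] M e by simp
  qed
  then show ?thesis by simp
qed

section \<open>Gaussian transforms\<close>

text \<open>Analytic continuation along the line through \<open>x\<close>.  Since
\<open>exp(-a|y - tx|\<^sup>2) = exp(-at\<^sup>2|x|\<^sup>2) exp(-a|y|\<^sup>2) exp(2at y\<cdot>x)\<close>, the transform at \<open>tx\<close> is, up to a nonvanishing
factor, an everywhere convergent power series in \<open>t\<close>; it vanishes for small real \<open>t\<close>, hence also at \<open>t = 1\<close>.\<close>

lemma gaussian_transform_extend: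
  fixes F :: "'a::euclidean_space \<Rightarrow> complex"
  assumes F: "integrable lborel F" and r: "r > 0" and a: "a > 0"
    and zero: "\<And>x. norm x < r \<Longrightarrow> (LINT y|lborel. F y * of_real (exp (- a * (norm (y - x))\<^sup>2))) = 0"
  shows "(LINT y|lborel. F y * of_real (exp (- a * (norm (y - x))\<^sup>2))) = 0"
proof (cases "x = 0")
  case False
  have [measurable]: "F \<in> borel_measurable lborel" using F by auto
  define b where "b = (\<lambda>y. 2 * a * (y \<bullet> x))"
  have [measurable]: "b \<in> borel_measurable lborel" unfolding b_def by measurable
  define h where "h = (\<lambda>y. F y * of_real (exp (- a * (norm y)\<^sup>2)))"
  have [measurable]: "h \<in> borel_measurable lborel" unfolding h_def by measurable
  have bound: "norm (h y) * exp (s * \<bar>b y\<bar>) \<le> norm (F y) * exp (a * s\<^sup>2 * (norm x)\<^sup>2)" if "s \<ge> 0" for y s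
  proof -
    have "\<bar>b y\<bar> \<le> 2 * a * (norm y * norm x)"
      unfolding b_def using Cauchy_Schwarz_ineq2[of y x] a by (simp add: abs_mult)
    then have "s * \<bar>b y\<bar> \<le> s * (2 * a * (norm y * norm x))"
      using that by (intro mult_left_mono) auto
    \<comment> \<open>Completing the square: the Gaussian absorbs the exponential growth of \<open>exp(s|b y|)\<close>.\<close>
    moreover have "0 \<le> a * (norm y - s * norm x)\<^sup>2" using a by simp
    ultimately have "- a * (norm y)\<^sup>2 + s * \<bar>b y\<bar> \<le> a * s\<^sup>2 * (norm x)\<^sup>2"
      by (simp add: power2_eq_square algebra_simps)
    then have "exp (- a * (norm y)\<^sup>2) * exp (s * \<bar>b y\<bar>) \<le> exp (a * s\<^sup>2 * (norm x)\<^sup>2)"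
      by (simp flip: exp_add)
    then show ?thesis unfolding h_def by (simp add: norm_mult mult.assoc mult_left_mono)
  qed
  have dom: "integrable lborel (\<lambda>y. norm (h y) * exp (s * \<bar>b y\<bar>))" if "s \<ge> 0" for s
    by (rule Bochner_Integration.integrable_bound[where f="\<lambda>y. norm (F y) * exp (a * s\<^sup>2 * (norm x)\<^sup>2)"])
      (use F bound[OF that] in auto)
  define c where "c = (\<lambda>k. LINT y|lborel. h y * of_real (b y) ^ k / fact k)"
  define G where "G = (\<lambda>z. LINT y|lborel. h y * exp (z * of_real (b y)))"
  have partial_bound: "norm (\<Sum>i<m. h y * of_real (b y) ^ i / fact i * z ^ i) \<le> norm (h y) * exp (norm z * \<bar>b y\<bar>)" for m y z
  proof -
    have "norm (\<Sum>i<m. h y * of_real (b y) ^ i / fact i * z ^ i) \<le> (\<Sum>i<m. norm (h y) * ((norm z * \<bar>b y\<bar>) ^ i / fact i))"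
      by (intro sum_norm_le) (simp add: norm_mult norm_divide norm_power power_mult_distrib mult_ac)
    also have "\<dots> = norm (h y) * (\<Sum>i<m. (norm z * \<bar>b y\<bar>) ^ i / fact i)"
      by (simp add: sum_distrib_left)
    also have "(\<Sum>i<m. (norm z * \<bar>b y\<bar>) ^ i / fact i) \<le> exp (norm z * \<bar>b y\<bar>)"
      unfolding exp_def scaleR_conv_of_real
      by (intro order_trans[OF _ sum_le_suminf[of _ "{..<m}"]])
        (use summable_exp[of "norm z * \<bar>b y\<bar>"] in \<open>auto simp: field_simps\<close>)
    finally show ?thesis by (simp add: mult_left_mono)
  qed
  have int_k: "integrable lborel (\<lambda>y. h y * of_real (b y) ^ k / fact k)" for k
  proof (rule Bochner_Integration.integrable_bound[OF dom[of 1]])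
    show "AE y in lborel. norm (h y * of_real (b y) ^ k / fact k) \<le> norm (norm (h y) * exp (1 * \<bar>b y\<bar>))"
    proof (intro AE_I2)
      fix y
      have "\<bar>b y\<bar> ^ k / fact k \<le> exp \<bar>b y\<bar>"
        using sum_le_suminf[of "\<lambda>k. \<bar>b y\<bar> ^ k / fact k" "{k}"] summable_exp[of "\<bar>b y\<bar>"]
        unfolding exp_def scaleR_conv_of_real by (auto simp: field_simps)
      then show "norm (h y * of_real (b y) ^ k / fact k) \<le> norm (norm (h y) * exp (1 * \<bar>b y\<bar>))"
        by (simp add: norm_mult norm_divide norm_power mult_left_mono flip: times_divide_eq_right)
    qed
  qed auto
  have sums: "(\<lambda>k. c k * z ^ k) sums G z" for z
    unfolding sums_def
  proof -
    have "(\<lambda>m. LINT y|lborel. (\<Sum>i<m. h y * of_real (b y) ^ i / fact i * z ^ i)) \<longlonglongrightarrow> G z"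
      unfolding G_def
    proof (rule integral_dominated_convergence[where w="\<lambda>y. norm (h y) * exp (norm z * \<bar>b y\<bar>)"])
      show "AE y in lborel. (\<lambda>m. \<Sum>i<m. h y * of_real (b y) ^ i / fact i * z ^ i) \<longlonglongrightarrow> h y * exp (z * of_real (b y))"
      proof (intro AE_I2)
        fix y
        have "(\<lambda>i. h y * ((z * of_real (b y)) ^ i /\<^sub>R fact i)) sums (h y * exp (z * of_real (b y)))"
          by (intro sums_mult exp_converges)
        then have "(\<lambda>i. h y * of_real (b y) ^ i / fact i * z ^ i) sums (h y * exp (z * of_real (b y)))"
          by (simp add: scaleR_conv_of_real power_mult_distrib field_simps)
        then show "(\<lambda>m. \<Sum>i<m. h y * of_real (b y) ^ i / fact i * z ^ i) \<longlonglongrightarrow> h y * exp (z * of_real (b y))"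
          unfolding sums_def .
      qed
    qed (use dom[of "norm z"] partial_bound in auto)
    moreover have "(LINT y|lborel. (\<Sum>i<m. h y * of_real (b y) ^ i / fact i * z ^ i)) = (\<Sum>i<m. c i * z ^ i)" for m
      unfolding c_def by (subst Bochner_Integration.integral_sum, intro integrable_mult_left int_k)
        (simp only: integral_mult_left_zero)
    ultimately show "(\<lambda>m. \<Sum>i<m. c i * z ^ i) \<longlonglongrightarrow> G z" by simp
  qed
  have rel: "(LINT y|lborel. F y * of_real (exp (- a * (norm (y - t *\<^sub>R x))\<^sup>2))) = of_real (exp (- a * t\<^sup>2 * (norm x)\<^sup>2)) * G (of_real t)" for t
  proof -
    have "F y * of_real (exp (- a * (norm (y - t *\<^sub>R x))\<^sup>2)) = of_real (exp (- a * t\<^sup>2 * (norm x)\<^sup>2)) * (h y * exp (of_real t * of_real (b y)))" for y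
    proof -
      have "- a * (norm (y - t *\<^sub>R x))\<^sup>2 = - a * t\<^sup>2 * (norm x)\<^sup>2 + (- a * (norm y)\<^sup>2 + t * b y)"
        unfolding power2_norm_eq_inner b_def
        by (simp add: inner_diff_left inner_diff_right inner_commute algebra_simps power2_eq_square)
      then have "exp (- a * (norm (y - t *\<^sub>R x))\<^sup>2) =
          exp (- a * t\<^sup>2 * (norm x)\<^sup>2) * (exp (- a * (norm y)\<^sup>2) * exp (t * b y))"
        by (simp only: exp_add)
      then show ?thesis unfolding h_def by (simp add: exp_of_real flip: of_real_mult)
    qed
    then show ?thesis unfolding G_def by simp
  qed
  have G0: "G (of_real t) = 0" if "\<bar>t\<bar> < r / norm x" for t
  proof -
    have "norm (t *\<^sub>R x) < r" using that False by (simp add: field_simps)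
    from zero[OF this] show ?thesis unfolding rel by simp
  qed
  have c: "c k = 0" for k
  proof (rule ccontr)
    assume ck: "c k \<noteq> 0"
    have c0: "c 0 = 0"
      using sums_unique2[OF sums[of 0] powser_sums_zero[of c]] G0[of 0] r False by simp
    then have "k > 0" using ck by (cases k) auto
    then obtain s where s: "s > 0" "\<And>z. z \<in> cball 0 s - {0} \<Longrightarrow> G z \<noteq> 0"
      using powser_0_nonzero[where r=1 and a=c and \<xi>=0 and f=G and m=k] sums G0[of 0] r False ck by auto
    define R where "R = r / norm x"
    define t where "t = min s (R / 2)"
    have "R > 0" using r False by (simp add: R_def)
    then have "t > 0" "t \<le> s" "t < R" using s(1) by (auto simp: t_def min_def)
    then show False using s(2)[of "of_real t"] G0[of t] by (auto simp: R_def)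
  qed
  have "G 1 = 0" using sums[of 1] by (simp add: c sums_iff)
  then show ?thesis using rel[of 1] by simp
qed (use zero[of 0] r in auto)


lemma integrable_lborel_prod:
  fixes f :: "real \<Rightarrow> real"
  assumes f: "integrable lborel f" "\<And>x. f x \<ge> 0"
  shows "integrable lborel (\<lambda>x::'a::euclidean_space. \<Prod>b\<in>Basis. f (x \<bullet> b))"
proof -
  have [measurable]: "f \<in> borel_measurable borel" using f by auto
  show ?thesis
  proof (rule integrableI_nonneg)
    have "(\<integral>\<^sup>+x. ennreal (\<Prod>b\<in>Basis. f (x \<bullet> b)) \<partial>(lborel::'a measure)) =
        (\<integral>\<^sup>+x. (\<Prod>b\<in>Basis. ennreal (f (x \<bullet> b))) \<partial>(lborel::'a measure))"
      using f by (simp add: prod_ennreal)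
    also have "\<dots> = (\<Prod>b\<in>(Basis::'a set). \<integral>\<^sup>+x. ennreal (f x) \<partial>lborel)"
      by (intro nn_integral_lborel_prod) auto
    also have "\<dots> < \<infinity>"
      using f by (subst nn_integral_eq_integral) (auto simp: ennreal_power)
    finally show "(\<integral>\<^sup>+x. ennreal (\<Prod>b\<in>Basis. f (x \<bullet> b)) \<partial>(lborel::'a measure)) < \<infinity>" .
  qed (auto intro!: AE_I2 prod_nonneg f)
qed

text \<open>The exponent \<open>2n\<close> is wasteful but makes the bound a product of integrable functions of one variable.\<close>

lemma integrable_decay:
  "integrable lborel (\<lambda>x::'a::euclidean_space. 1 / (1 + norm x) ^ (2 * DIM('a)))"
proof (rule Bochner_Integration.integrable_bound)
  have "integrable lborel (\<lambda>x::real. inverse (1 + x\<^sup>2))"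
    using integrable_inverse_1_plus_square by (simp add: set_integrable_def einterval_def)
  then show "integrable lborel (\<lambda>x::'a. \<Prod>b\<in>Basis. inverse (1 + (x \<bullet> b)\<^sup>2))"
    by (rule integrable_lborel_prod) (simp add: add_nonneg_nonneg)
  show "AE x::'a in lborel. norm (1 / (1 + norm x) ^ (2 * DIM('a))) \<le> norm (\<Prod>b\<in>Basis. inverse (1 + (x \<bullet> b)\<^sup>2))"
  proof (intro AE_I2)
    fix x :: 'a
    have "1 + (x \<bullet> b)\<^sup>2 \<le> (1 + norm x)\<^sup>2" if "b \<in> Basis" for b
    proof -
      have "(x \<bullet> b)\<^sup>2 \<le> (norm x)\<^sup>2" using Basis_le_norm[OF that, of x] by (simp add: abs_le_square_iff[symmetric])
      then show ?thesis unfolding power2_sum by (simp add: add_increasing2)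
    qed
    then have "inverse ((1 + norm x)\<^sup>2) \<le> inverse (1 + (x \<bullet> b)\<^sup>2)" if "b \<in> Basis" for b
      using that by (intro le_imp_inverse_le) (auto intro: add_pos_nonneg)
    then have "(\<Prod>b\<in>(Basis::'a set). inverse ((1 + norm x)\<^sup>2)) \<le> (\<Prod>b\<in>Basis. inverse (1 + (x \<bullet> b)\<^sup>2))"
      by (intro prod_mono) auto
    then show "norm (1 / (1 + norm x) ^ (2 * DIM('a))) \<le> norm (\<Prod>b\<in>Basis. inverse (1 + (x \<bullet> b)\<^sup>2))"
      by (simp add: power_mult power_inverse inverse_eq_divide abs_prod prod_nonneg add_nonneg_nonneg power_one_over)
  qed
qed auto

lemma integrable_gaussian: "integrable lborel (\<lambda>x::'a::euclidean_space. exp (- (norm x)\<^sup>2))"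
proof -
  have "integrable lborel (\<lambda>x::real. sqrt pi * normal_density 0 (1 / sqrt 2) x)"
    by (intro integrable_mult_right integrable_normal_density) simp
  then have "integrable lborel (\<lambda>x::real. exp (- x\<^sup>2))"
    by (simp add: normal_density_def power_divide field_simps)
  then have "integrable lborel (\<lambda>x::'a. \<Prod>b\<in>Basis. exp (- (x \<bullet> b)\<^sup>2))"
    by (rule integrable_lborel_prod) simp
  also have "(\<lambda>x::'a. \<Prod>b\<in>Basis. exp (- (x \<bullet> b)\<^sup>2)) = (\<lambda>x. exp (- (norm x)\<^sup>2))"
  proof
    fix x :: 'a
    have "(norm x)\<^sup>2 = (\<Sum>b\<in>Basis. (x \<bullet> b)\<^sup>2)"
      unfolding power2_norm_eq_inner by (subst euclidean_inner) (simp add: power2_eq_square)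
    then show "(\<Prod>b\<in>Basis. exp (- (x \<bullet> b)\<^sup>2)) = exp (- (norm x)\<^sup>2)"
      by (simp add: exp_sum[symmetric] sum_negf)
  qed
  finally show ?thesis .
qed

lemma integral_gaussian_pos: "(LINT x|lborel. exp (- (norm (x::'a::euclidean_space))\<^sup>2)) > 0"
proof -
  have "(LINT x|lborel. exp (- (norm (x::'a))\<^sup>2)) \<noteq> 0"
    by (subst integral_nonneg_eq_0_iff_AE[OF integrable_gaussian]) (auto simp: eventually_False ae_filter_eq_bot_iff)
  moreover have "(LINT x|lborel. exp (- (norm (x::'a))\<^sup>2)) \<ge> 0" by simp
  ultimately show ?thesis by linarith
qed

lemma integral_lborel_affine:
  fixes f :: "'a::euclidean_space \<Rightarrow> complex"
  assumes [measurable]: "f \<in> borel_measurable borel" and c: "c \<noteq> 0"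
  shows "(LINT y|lborel. f y) = of_real (\<bar>c\<bar> ^ DIM('a)) * (LINT w|lborel. f (t + c *\<^sub>R w))"
  by (subst lborel_affine[OF c, of t])
    (simp add: integral_density integral_distr scaleR_conv_of_real)

text \<open>The rescaled Gaussian kernels form an approximate identity at \<open>x\<close>.\<close>

lemma gaussian_transform_injective:
  fixes F :: "'a::euclidean_space \<Rightarrow> complex"
  assumes F: "continuous_on UNIV F" "\<And>y. norm (F y) \<le> B"
    and zero: "\<And>a. a > 0 \<Longrightarrow> (LINT y|lborel. F y * of_real (exp (- a * (norm (y - x))\<^sup>2))) = 0"
  shows "F x = 0"
proof -
  have [measurable]: "F \<in> borel_measurable borel" using F by (intro borel_measurable_continuous_onI)
  let ?g = "\<lambda>w::'a. exp (- (norm w)\<^sup>2)"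
  define c where "c = (\<lambda>m. 1 / real (Suc m))"
  have c: "c m > 0" for m by (simp add: c_def)
  have c0: "c \<longlonglongrightarrow> 0" unfolding c_def by real_asymp
  have "(LINT w|lborel. F (x + c m *\<^sub>R w) * of_real (?g w)) = 0" for m
  proof -
    have "0 = (LINT y|lborel. F y * of_real (exp (- (1 / (c m)\<^sup>2) * (norm (y - x))\<^sup>2)))"
      using zero[of "1 / (c m)\<^sup>2"] c[of m] by simp
    also have "\<dots> = of_real (\<bar>c m\<bar> ^ DIM('a)) * (LINT w|lborel. F (x + c m *\<^sub>R w) * of_real (exp (- (1 / (c m)\<^sup>2) * (norm ((x + c m *\<^sub>R w) - x))\<^sup>2)))"
      using c[of m] by (intro integral_lborel_affine) auto
    also have "\<dots> = of_real (\<bar>c m\<bar> ^ DIM('a)) * (LINT w|lborel. F (x + c m *\<^sub>R w) * of_real (?g w))"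
      using c[of m] by (simp add: power_mult_distrib)
    finally show ?thesis using c[of m] by auto
  qed
  moreover have "(\<lambda>m. LINT w|lborel. F (x + c m *\<^sub>R w) * of_real (?g w)) \<longlonglongrightarrow> (LINT w|lborel. F x * of_real (?g w))"
  proof (rule integral_dominated_convergence[where w="\<lambda>w. B * ?g w"])
    show "integrable lborel (\<lambda>w. B * ?g w)" using integrable_gaussian[where 'a='a] by simp
    show "AE w in lborel. (\<lambda>m. F (x + c m *\<^sub>R w) * of_real (?g w)) \<longlonglongrightarrow> F x * of_real (?g w)"
    proof (intro AE_I2 tendsto_intros)
      fix w
      have "(\<lambda>m. x + c m *\<^sub>R w) \<longlonglongrightarrow> x" using c0 by (auto intro!: tendsto_eq_intros)
      moreover have "isCont F x" using F(1) by (simp add: continuous_on_eq_continuous_at)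
      ultimately show "(\<lambda>m. F (x + c m *\<^sub>R w)) \<longlonglongrightarrow> F x" by (rule isCont_tendsto_compose[rotated])
    qed
    show "AE w in lborel. norm (F (x + c m *\<^sub>R w) * of_real (?g w)) \<le> B * ?g w" for m
      using F(2) by (auto simp: norm_mult intro!: AE_I2 mult_right_mono)
  qed auto
  ultimately have "(LINT w|lborel. F x * of_real (?g w)) = 0" by (simp add: LIMSEQ_const_iff)
  then have "F x * of_real (LINT w|lborel. ?g w) = 0"
    by (simp add: integral_complex_of_real)
  then show ?thesis using integral_gaussian_pos[where 'a='a] by auto
qed

text \<open>This is the unique continuation property of \<open>(-\<Delta>)\<^bsup>-1/2\<^esup>\<close>, whose kernel is a multiple of \<open>|\<cdot>|\<^bsup>1-n\<^esup>\<close>.  It expresses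
nonlocality: if \<open>F\<close> vanishes near the origin, its potential there determines all its Gaussian transforms, and
these determine \<open>F\<close>.\<close>

theorem riesz_unique_continuation:
  fixes F :: "'a::euclidean_space \<Rightarrow> complex"
  assumes n: "DIM('a) \<ge> 2" and r: "r > 0"
    and F: "integrable lborel F" "continuous_on UNIV F" "\<And>y. norm (F y) \<le> B"
    and supp: "\<And>y. norm y < r \<Longrightarrow> F y = 0"
    and zero: "\<And>x. norm x < r \<Longrightarrow> (LINT y|lborel. F y * of_real (norm (y - x) powr (1 - real DIM('a)))) = 0"
  shows "F x = 0"
proof (rule gaussian_transform_injective[OF F(2,3)])
  fix a :: real assume a: "a > 0"
  show "(LINT y|lborel. F y * of_real (exp (- a * (norm (y - x))\<^sup>2))) = 0"
    by (rule gaussian_transform_extend[OF F(1) r a])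
      (rule local_gaussian_transform_vanishes[OF F(1) supp n zero _ a])
qed

section \<open>Polar coordinates\<close>

lemma nn_integral_reciprocal_power_tails:
  fixes c :: real
  assumes c: "c > 0" and n: "n > 0"
  shows "(\<integral>\<^sup>+t. ennreal (1 / \<bar>t\<bar> ^ Suc n) * indicator {t. c < \<bar>t\<bar>} t \<partial>lborel) = ennreal (2 / (real n * c ^ n))"
proof -
  let ?f = "\<lambda>t::real. ennreal (1 / \<bar>t\<bar> ^ Suc n)"
  have half: "(\<integral>\<^sup>+t. ?f t * indicator {c<..} t \<partial>lborel) = ennreal (1 / (real n * c ^ n))"
  proof -
    have "(\<integral>\<^sup>+t. ?f t * indicator {c<..} t \<partial>lborel) = (\<integral>\<^sup>+t. ennreal (1 / t ^ Suc n) * indicator {c..} t \<partial>lborel)"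
    proof (rule nn_integral_cong_AE)
      show "AE t in lborel. ?f t * indicator {c<..} t = ennreal (1 / t ^ Suc n) * indicator {c..} t"
        using AE_lborel_singleton[of c]
        by eventually_elim (use c in \<open>auto simp: indicator_def\<close>)
    qed
    also have "\<dots> = ennreal (0 - (- (1 / (real n * c ^ n))))"
    proof (rule nn_integral_FTC_atLeast)
      fix t assume "c \<le> t"
      then have t: "t > 0" using c by simp
      have "((\<lambda>t. - (1 / (real n * t ^ n))) has_real_derivative (real n * (real n * t ^ (n - Suc 0))) / (real n * t ^ n)\<^sup>2) (at t)"
        by (rule derivative_eq_intros refl | use t n in \<open>simp add: power2_eq_square\<close>)+
      also have "(real n * (real n * t ^ (n - Suc 0))) / (real n * t ^ n)\<^sup>2 = 1 / t ^ Suc n"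
      proof -
        have "t * t ^ (n - Suc 0) = t ^ n" using n by (metis Suc_pred power_Suc One_nat_def)
        then show ?thesis using t n by (simp add: field_simps power2_eq_square)
      qed
      finally show "((\<lambda>t. - (1 / (real n * t ^ n))) has_real_derivative 1 / t ^ Suc n) (at t)" .
      show "0 \<le> 1 / t ^ Suc n" using t by simp
    next
      show "((\<lambda>t. - (1 / (real n * t ^ n))) \<longlongrightarrow> 0) at_top"
        using n by real_asymp
    qed simp
    finally show ?thesis by simp
  qed
  have "(\<integral>\<^sup>+t. ?f t * indicator {t. c < \<bar>t\<bar>} t \<partial>lborel) =
      (\<integral>\<^sup>+t. ?f t * indicator {c<..} t + ?f t * indicator {..<-c} t \<partial>lborel)"
    by (intro nn_integral_cong) (use c in \<open>auto simp: indicator_def\<close>)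
  also have "\<dots> = (\<integral>\<^sup>+t. ?f t * indicator {c<..} t \<partial>lborel) + (\<integral>\<^sup>+t. ?f t * indicator {..<-c} t \<partial>lborel)"
    by (intro nn_integral_add) auto
  also have "(\<integral>\<^sup>+t. ?f t * indicator {..<-c} t \<partial>lborel) = (\<integral>\<^sup>+t. ?f t * indicator {c<..} t \<partial>lborel)"
    by (subst nn_integral_real_affine[where c="-1" and t=0]) (auto intro!: nn_integral_cong simp: indicator_def)
  finally show ?thesis unfolding half using c n by (subst (asm) ennreal_plus[symmetric]) auto
qed

lemma nn_integral_lborel_scale:
  fixes f :: "'a::euclidean_space \<Rightarrow> ennreal"
  assumes [measurable]: "f \<in> borel_measurable borel" and c: "c \<noteq> 0"
  shows "(\<integral>\<^sup>+y. f y \<partial>lborel) = ennreal (\<bar>c\<bar> ^ DIM('a)) * (\<integral>\<^sup>+w. f (c *\<^sub>R w) \<partial>lborel)"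
  by (subst lborel_affine[OF c, of 0])
    (simp add: nn_integral_density nn_integral_distr nn_integral_cmult)

lemma nn_integral_sphere_measure:
  fixes f :: "real^'n::finite \<Rightarrow> ennreal"
  assumes [measurable]: "f \<in> borel_measurable borel"
  shows "(\<integral>\<^sup>+\<theta>. f \<theta> \<partial>sphere_measure) = ennreal CARD('n) * (\<integral>\<^sup>+x. f (sgn x) * indicator (ball 0 1) x \<partial>lborel)"
proof -
  have m: "(sgn :: real^'n \<Rightarrow> _) \<in> borel_measurable borel"
    unfolding sgn_div_norm by measurable
  have [measurable]: "sgn \<in> restrict_space lborel (ball (0::real^'n) 1) \<rightarrow>\<^sub>M borel"
    by (rule measurable_restrict_space1) (use m in simp)
  show ?thesis
    unfolding sphere_measure_def
    by (subst nn_integral_scale_measure)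
      (auto simp: nn_integral_distr nn_integral_restrict_space ennreal_of_nat_eq_real_of_nat)
qed

lemma sets_sphere_measure [simp, measurable_cong]: "sets sphere_measure = sets borel"
  by (simp add: sphere_measure_def)

lemma space_sphere_measure [simp]: "space sphere_measure = UNIV"
  by (simp add: sphere_measure_def space_scale_measure)

lemma finite_measure_sphere_measure: "finite_measure (sphere_measure :: (real^'n::finite) measure)"
proof (rule finite_measureI)
  have "emeasure (sphere_measure :: (real^'n) measure) (space sphere_measure) = (\<integral>\<^sup>+\<theta>. 1 \<partial>(sphere_measure :: (real^'n) measure))"
    by simp
  also have "\<dots> = ennreal CARD('n) * emeasure lborel (ball (0::real^'n) 1)"
    by (subst nn_integral_sphere_measure) auto
  also have "\<dots> < \<infinity>"
    using emeasure_lborel_ball_finite[of "0::real^'n" 1] by (auto simp: ennreal_mult_less_top)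
  finally show "emeasure (sphere_measure :: (real^'n) measure) (space sphere_measure) \<noteq> \<infinity>" by auto
qed

text \<open>The surface measure is defined through the solid ball, so the left-hand side is an integral over a point \<open>x\<close> of
the ball and a parameter \<open>s\<close> along the line through \<open>x\<close>.  The substitution \<open>s = t|x|\<close>, an exchange of the
integrals, the substitution \<open>w = tx\<close> and another exchange leave the integral of \<open>|t|\<^bsup>-n-1\<^esup>\<close> over \<open>|t| > |w|\<close>,
which is \<open>2 / (n|w|\<^sup>n)\<close>.  Each \<open>w\<close> is reached from two directions, hence the factor 2.\<close>

lemma nn_integral_polar:
  fixes h :: "real^'n::finite \<Rightarrow> ennreal"
  assumes [measurable]: "h \<in> borel_measurable borel"
  shows "(\<integral>\<^sup>+\<theta>. (\<integral>\<^sup>+s. h (s *\<^sub>R \<theta>) \<partial>lborel) \<partial>sphere_measure) =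
     (\<integral>\<^sup>+w. ennreal (2 * norm w powr (1 - real CARD('n))) * h w \<partial>lborel)"
proof -
  let ?n = "CARD('n)"
  let ?I = "\<lambda>t (w::real^'n). ennreal (1 / \<bar>t\<bar> ^ Suc ?n) * indicator {t. norm w < \<bar>t\<bar>} t * (ennreal (norm w) * h w)"
  have meas: "Measurable.pred (borel \<Otimes>\<^sub>M borel) (\<lambda>(t::real, w::real^'n). norm w < \<bar>t\<bar>)"
    by measurable
  have "(\<integral>\<^sup>+\<theta>. (\<integral>\<^sup>+s. h (s *\<^sub>R \<theta>) \<partial>lborel) \<partial>sphere_measure) =
      ennreal ?n * (\<integral>\<^sup>+x. (\<integral>\<^sup>+s. h (s *\<^sub>R sgn x) \<partial>lborel) * indicator (ball 0 1) x \<partial>lborel)"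
    by (subst nn_integral_sphere_measure) auto
  also have "(\<integral>\<^sup>+x. (\<integral>\<^sup>+s. h (s *\<^sub>R sgn x) \<partial>lborel) * indicator (ball 0 1) x \<partial>lborel) =
      (\<integral>\<^sup>+x. (\<integral>\<^sup>+t. ennreal (norm x) * h (t *\<^sub>R x) * indicator (ball 0 1) x \<partial>lborel) \<partial>(lborel :: (real^'n) measure))"
  proof (rule nn_integral_cong_AE)
    show "AE x in lborel. (\<integral>\<^sup>+s. h (s *\<^sub>R sgn x) \<partial>lborel) * indicator (ball 0 1) x =
       (\<integral>\<^sup>+t. ennreal (norm x) * h (t *\<^sub>R x) * indicator (ball 0 1) (x::real^'n) \<partial>lborel)"
      using AE_lborel_singleton[of 0]
    proof eventually_elim
      case (elim x)
      have "(\<integral>\<^sup>+s. h (s *\<^sub>R sgn x) \<partial>lborel) = ennreal (norm x) * (\<integral>\<^sup>+t. h ((0 + norm x * t) *\<^sub>R sgn x) \<partial>lborel)"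
        using elim by (subst nn_integral_real_affine[where c="norm x" and t=0]) auto
      also have "\<dots> = (\<integral>\<^sup>+t. ennreal (norm x) * h (t *\<^sub>R x) \<partial>lborel)"
      proof -
        have "(0 + norm x * t) *\<^sub>R sgn x = t *\<^sub>R x" for t
          using elim by (simp add: sgn_div_norm)
        then show ?thesis by (simp add: nn_integral_cmult)
      qed
      finally show ?case
        by (simp add: nn_integral_multc)
    qed
  qed
  also have "\<dots> = (\<integral>\<^sup>+t. (\<integral>\<^sup>+x. ennreal (norm x) * h (t *\<^sub>R x) * indicator (ball 0 1) x \<partial>(lborel :: (real^'n) measure)) \<partial>lborel)"
    by (rule lborel_pair.Fubini', unfold split_beta', measurable, unfold mem_ball, measurable)
  also have "\<dots> = (\<integral>\<^sup>+t. (\<integral>\<^sup>+w. ?I t w \<partial>lborel) \<partial>lborel)"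
  proof (rule nn_integral_cong_AE)
    show "AE t in lborel. (\<integral>\<^sup>+x. ennreal (norm x) * h (t *\<^sub>R x) * indicator (ball 0 1) x \<partial>(lborel :: (real^'n) measure)) = (\<integral>\<^sup>+w. ?I t w \<partial>lborel)"
      using AE_lborel_singleton[of 0]
    proof eventually_elim
      case (elim t)
      have "(\<integral>\<^sup>+w. ?I t w \<partial>lborel) = ennreal (\<bar>t\<bar> ^ ?n) * (\<integral>\<^sup>+x. ?I t (t *\<^sub>R x) \<partial>lborel)"
        using elim by (subst nn_integral_lborel_scale[where c=t]) auto
      also have "\<dots> = (\<integral>\<^sup>+x. ennreal (\<bar>t\<bar> ^ ?n) * ?I t (t *\<^sub>R x) \<partial>lborel)"
        by (subst nn_integral_cmult) auto
      also have "\<dots> = (\<integral>\<^sup>+x. ennreal (norm x) * h (t *\<^sub>R x) * indicator (ball 0 1) x \<partial>(lborel :: (real^'n) measure))"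
      proof (intro nn_integral_cong)
        fix x :: "real^'n"
        have *: "ennreal (\<bar>t\<bar> ^ ?n) * (ennreal (1 / \<bar>t\<bar> ^ Suc ?n) * ennreal (\<bar>t\<bar> * norm x)) = ennreal (norm x)"
          using elim by (simp flip: ennreal_mult)
        have **: "indicator {ta. \<bar>t\<bar> * norm x < \<bar>ta\<bar>} t = (indicator (ball 0 1) x :: ennreal)"
          using elim by (auto simp: indicator_def)
        have "ennreal (\<bar>t\<bar> ^ ?n) * ?I t (t *\<^sub>R x) = (ennreal (\<bar>t\<bar> ^ ?n) * (ennreal (1 / \<bar>t\<bar> ^ Suc ?n) * ennreal (\<bar>t\<bar> * norm x)))
            * h (t *\<^sub>R x) * indicator (ball 0 1) x"
          by (simp add: ** mult_ac)
        then show "ennreal (\<bar>t\<bar> ^ ?n) * ?I t (t *\<^sub>R x) = ennreal (norm x) * h (t *\<^sub>R x) * indicator (ball 0 1) x"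
          unfolding * .
      qed
      finally show ?case ..
    qed
  qed
  also have "\<dots> = (\<integral>\<^sup>+w. (\<integral>\<^sup>+t. ?I t w \<partial>lborel) \<partial>lborel)"
    by (rule lborel_pair.Fubini') (use meas in \<open>simp add: split_beta'\<close>)
  also have "ennreal ?n * \<dots> = (\<integral>\<^sup>+w. ennreal ?n * (\<integral>\<^sup>+t. ?I t w \<partial>lborel) \<partial>lborel)"
    by (subst nn_integral_cmult) auto
  also have "\<dots> = (\<integral>\<^sup>+w. ennreal (2 * norm w powr (1 - real CARD('n))) * h w \<partial>lborel)"
  proof (rule nn_integral_cong_AE)
    show "AE w in lborel. ennreal ?n * (\<integral>\<^sup>+t. ?I t w \<partial>lborel) = ennreal (2 * norm w powr (1 - real CARD('n))) * h w"
      using AE_lborel_singleton[of 0]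
    proof eventually_elim
      case (elim w)
      have "(\<integral>\<^sup>+t. ?I t w \<partial>lborel) = ennreal (2 / (real ?n * norm w ^ ?n)) * (ennreal (norm w) * h w)"
        using elim nn_integral_reciprocal_power_tails[of "norm w" ?n] by (subst nn_integral_multc) auto
      moreover have "ennreal ?n * (ennreal (2 / (real ?n * norm w ^ ?n)) * ennreal (norm w)) = ennreal (2 * norm w powr (1 - real CARD('n)))"
      proof -
        have "norm w powr (1 - real CARD('n)) = norm w / norm w ^ ?n"
          using elim by (simp add: powr_diff powr_realpow)
        then show ?thesis by (simp flip: ennreal_mult)
      qed
      ultimately show ?case by (metis (no_types, lifting) mult.assoc)
    qed
  qed
  finally show ?thesis .
qed

text \<open>As an identity of measures, polar coordinates apply to complex integrands as well.\<close>

lemma distr_polar: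
  "distr (sphere_measure \<Otimes>\<^sub>M lborel) borel (\<lambda>(\<theta>, s). s *\<^sub>R \<theta>) =
     density lborel (\<lambda>w::real^'n::finite. ennreal (2 * norm w powr (1 - real CARD('n))))"
proof (rule measure_eqI)
  fix A assume "A \<in> sets (distr (sphere_measure \<Otimes>\<^sub>M lborel) borel (\<lambda>(\<theta>::real^'n, s). s *\<^sub>R \<theta>))"
  then have [measurable]: "A \<in> sets borel" by simp
  have [measurable]: "(\<lambda>(\<theta>::real^'n, s). s *\<^sub>R \<theta>) \<in> sphere_measure \<Otimes>\<^sub>M lborel \<rightarrow>\<^sub>M borel"
    by measurable
  have "emeasure (distr (sphere_measure \<Otimes>\<^sub>M lborel) borel (\<lambda>(\<theta>, s). s *\<^sub>R \<theta>)) A =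
      (\<integral>\<^sup>+p. indicator A (snd p *\<^sub>R fst p) \<partial>(sphere_measure \<Otimes>\<^sub>M lborel))"
  proof -
    have "emeasure (distr (sphere_measure \<Otimes>\<^sub>M lborel) borel (\<lambda>(\<theta>, s). s *\<^sub>R \<theta>)) A =
        (\<integral>\<^sup>+w. indicator A w \<partial>distr (sphere_measure \<Otimes>\<^sub>M lborel) borel (\<lambda>(\<theta>, s). s *\<^sub>R \<theta>))"
      by simp
    also have "\<dots> = (\<integral>\<^sup>+p. indicator A ((\<lambda>(\<theta>, s). s *\<^sub>R \<theta>) p) \<partial>(sphere_measure \<Otimes>\<^sub>M lborel))"
      by (rule nn_integral_distr) auto
    finally show ?thesis by (simp add: split_beta')
  qed
  also have "\<dots> = (\<integral>\<^sup>+\<theta>. (\<integral>\<^sup>+s. indicator A (s *\<^sub>R \<theta>) \<partial>lborel) \<partial>sphere_measure)"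
    by (subst lborel.nn_integral_fst[symmetric]) auto
  also have "\<dots> = emeasure (density lborel (\<lambda>w. ennreal (2 * norm w powr (1 - real CARD('n))))) A"
    by (subst nn_integral_polar) (auto simp: emeasure_density)
  finally show "emeasure (distr (sphere_measure \<Otimes>\<^sub>M lborel) borel (\<lambda>(\<theta>, s). s *\<^sub>R \<theta>)) A =
    emeasure (density lborel (\<lambda>w. ennreal (2 * norm w powr (1 - real CARD('n))))) A" .
qed simp

section \<open>The normal operator as a Riesz potential\<close>

lemma integrable_riesz_kernel_ball:
  "integrable lborel (\<lambda>w::real^'n::finite. indicator (ball 0 R) w * norm w powr (1 - real CARD('n)))"
proof (rule integrableI_nonneg)
  let ?k = "\<lambda>w::real^'n. norm w powr (1 - real CARD('n))"
  define h :: "real^'n \<Rightarrow> ennreal" where "h = (\<lambda>w. if norm w < R then 1 else 0)"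
  have [measurable]: "h \<in> borel_measurable borel" unfolding h_def by measurable
  have "(\<integral>\<^sup>+w. ennreal (indicator (ball 0 R) w * ?k w) \<partial>lborel) \<le> (\<integral>\<^sup>+w. ennreal (2 * ?k w) * h w \<partial>lborel)"
    by (intro nn_integral_mono) (auto simp: indicator_def h_def intro!: ennreal_leI)
  also have "\<dots> = (\<integral>\<^sup>+\<theta>. (\<integral>\<^sup>+s. h (s *\<^sub>R \<theta>) \<partial>lborel) \<partial>sphere_measure)"
    by (subst nn_integral_polar) auto
  also have "\<dots> = ennreal CARD('n) * (\<integral>\<^sup>+x. (\<integral>\<^sup>+s. h (s *\<^sub>R sgn x) \<partial>lborel) * indicator (ball 0 1) x \<partial>lborel)"
    by (subst nn_integral_sphere_measure) auto
  also have "\<dots> \<le> ennreal CARD('n) * (\<integral>\<^sup>+x. emeasure lborel {-R..R} * indicator (ball 0 1) (x::real^'n) \<partial>lborel)"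
  proof (intro mult_left_mono nn_integral_mono_AE)
    show "AE x in lborel. (\<integral>\<^sup>+s. h (s *\<^sub>R sgn x) \<partial>lborel) * indicator (ball 0 1) x
        \<le> emeasure lborel {-R..R} * indicator (ball 0 1) x"
      using AE_lborel_singleton[of 0]
    proof eventually_elim
      case (elim x)
      have "(\<integral>\<^sup>+s. h (s *\<^sub>R sgn x) \<partial>lborel) \<le> (\<integral>\<^sup>+s. indicator {-R..R} s \<partial>lborel)"
        using elim by (intro nn_integral_mono) (auto simp: indicator_def h_def norm_sgn)
      also have "\<dots> = emeasure lborel {-R..R}" by (rule nn_integral_indicator) simp
      finally show ?case by (rule mult_right_mono) simp
    qed
  qed auto
  also have "\<dots> < \<infinity>"
    using emeasure_lborel_ball_finite[of "0::real^'n" 1]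
    by (subst nn_integral_cmult_indicator) (auto simp: ennreal_mult_less_top emeasure_lborel_Icc_eq)
  finally show "(\<integral>\<^sup>+w. ennreal (indicator (ball 0 R) w * ?k w) \<partial>lborel) < \<infinity>" .
  show "(\<lambda>w. indicator (ball 0 R) w * ?k w) \<in> borel_measurable lborel"
    by (intro borel_measurable_times borel_measurable_indicator) auto
qed auto

lemma lborel_integrable_translate:
  fixes f :: "'a::euclidean_space \<Rightarrow> 'b::{banach,second_countable_topology}"
  assumes "integrable lborel f"
  shows "integrable lborel (\<lambda>y. f (t + y))"
proof -
  have "integrable (distr lborel borel ((+) t)) f" using assms by (simp add: lborel_distr_plus)
  then show ?thesis by (subst (asm) integrable_distr_eq) (use assms in auto)
qed

lemma lborel_integral_translate:
  fixes f :: "'a::euclidean_space \<Rightarrow> 'b::{banach,second_countable_topology}"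
  assumes [measurable]: "f \<in> borel_measurable borel"
  shows "(LINT y|lborel. f (t + y)) = (LINT y|lborel. f y)"
proof -
  have "(LINT y|lborel. f y) = (LINT y|distr lborel borel ((+) t). f y)" by (simp add: lborel_distr_plus)
  also have "\<dots> = (LINT y|lborel. f (t + y))" by (subst integral_distr) auto
  finally show ?thesis ..
qed

text \<open>The singularity is integrable against a bounded function, and outside the unit ball the kernel is at most 1.
The bound does not depend on \<open>x\<close>, which is what a later application of Fubini's theorem needs.\<close>

lemma riesz_potential_integrable:
  fixes F :: "real^'n::finite \<Rightarrow> complex"
  assumes F: "integrable lborel F" "\<And>y. norm (F y) \<le> B" and n: "CARD('n) \<ge> 2"
  shows "integrable lborel (\<lambda>w. F (x + w) * of_real (norm w powr (1 - real CARD('n))))"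
    and "(LINT w|lborel. norm (F (x + w)) * norm w powr (1 - real CARD('n))) \<le>
       B * (LINT w|lborel. indicator (ball 0 1) (w::real^'n) * norm w powr (1 - real CARD('n))) + (LINT w|lborel. norm (F w))"
proof -
  let ?k = "\<lambda>w::real^'n. norm w powr (1 - real CARD('n))"
  let ?dom = "\<lambda>w. B * (indicator (ball 0 1) w * ?k w) + norm (F (x + w))"
  have [measurable]: "F \<in> borel_measurable borel" using F by auto
  have B: "B \<ge> 0" using order_trans[OF norm_ge_zero F(2)] .
  have iF: "integrable lborel (\<lambda>w. norm (F (x + w)))"
    using lborel_integrable_translate[OF F(1)] by (rule integrable_norm)
  have dom: "integrable lborel ?dom"
    using integrable_riesz_kernel_ball iF by (intro Bochner_Integration.integrable_add integrable_mult_right) auto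
  have le: "norm (F (x + w)) * ?k w \<le> ?dom w" for w
  proof (cases "norm w < 1")
    case True
    then show ?thesis using F(2)[of "x + w"] by (auto intro!: add_increasing2 mult_right_mono)
  next
    case False
    then have "?k w \<le> 1" using n powr_mono2'[of "1 - real CARD('n)" 1 "norm w"] by auto
    then show ?thesis using False by (auto intro: mult_left_le)
  qed
  show "integrable lborel (\<lambda>w. F (x + w) * of_real (?k w))"
  proof (rule Bochner_Integration.integrable_bound[OF dom])
    show "AE w in lborel. norm (F (x + w) * of_real (?k w)) \<le> norm (?dom w)"
    proof (intro AE_I2)
      fix w
      have "norm (F (x + w) * of_real (?k w)) = norm (F (x + w)) * ?k w" by (simp add: norm_mult)
      also note le[of w]
      also have "?dom w \<le> norm (?dom w)" by simp
      finally show "norm (F (x + w) * of_real (?k w)) \<le> norm (?dom w)" .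
    qed
  qed measurable
  from integrable_norm[OF this] have "integrable lborel (\<lambda>w. norm (F (x + w)) * ?k w)"
    by (simp add: norm_mult)
  then have "(LINT w|lborel. norm (F (x + w)) * ?k w) \<le> integral\<^sup>L lborel ?dom"
    using dom le by (intro integral_mono) auto
  also have "\<dots> = B * (LINT w|lborel. indicator (ball 0 1) w * ?k w) + (LINT w|lborel. norm (F (x + w)))"
    using integrable_riesz_kernel_ball[of 1] iF by (subst Bochner_Integration.integral_add) auto
  also have "(LINT w|lborel. norm (F (x + w))) = (LINT w|lborel. norm (F w))"
    by (rule lborel_integral_translate) auto
  finally show "(LINT w|lborel. norm (F (x + w)) * ?k w) \<le>
       B * (LINT w|lborel. indicator (ball 0 1) w * ?k w) + (LINT w|lborel. norm (F w))" .
qed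

text \<open>The integral over the line through \<open>x - (x\<cdot>\<theta>)\<theta>\<close> in direction \<open>\<theta>\<close> can be based at \<open>x\<close> by translation
invariance in \<open>s\<close>; polar coordinates centred at \<open>x\<close> do the rest.\<close>

lemma normal_fun_riesz:
  fixes F :: "real^'n::finite \<Rightarrow> complex"
  assumes F: "integrable lborel F" "\<And>y. norm (F y) \<le> B" and n: "CARD('n) \<ge> 2"
  shows "normal_fun F x = 2 * (LINT w|lborel. F (x + w) * of_real (norm w powr (1 - real CARD('n))))"
proof -
  let ?k = "\<lambda>w::real^'n. norm w powr (1 - real CARD('n))"
  interpret S: finite_measure "sphere_measure :: (real^'n) measure" by (rule finite_measure_sphere_measure)
  interpret P: pair_sigma_finite "sphere_measure :: (real^'n) measure" "lborel :: real measure" ..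
  have [measurable]: "F \<in> borel_measurable borel" using F by auto
  let ?T = "\<lambda>(\<theta>::real^'n, s). s *\<^sub>R \<theta>"
  have [measurable]: "?T \<in> sphere_measure \<Otimes>\<^sub>M lborel \<rightarrow>\<^sub>M borel" by measurable
  have "integrable lborel (\<lambda>w. (2 * ?k w) *\<^sub>R F (x + w))"
    using integrable_mult_right[OF riesz_potential_integrable(1)[OF F n, of x], of 2] by (simp add: scaleR_conv_of_real mult_ac)
  then have "integrable (density lborel (\<lambda>w. ennreal (2 * ?k w))) (\<lambda>w. F (x + w))"
    by (subst integrable_density) auto
  then have int: "integrable (sphere_measure \<Otimes>\<^sub>M lborel) (\<lambda>p. F (x + ?T p))"
    unfolding distr_polar[symmetric] by (subst (asm) integrable_distr_eq) auto
  have "normal_fun F x = (LINT \<theta>|sphere_measure. LINT s|lborel. F (x - (x \<bullet> \<theta>) *\<^sub>R \<theta> + s *\<^sub>R \<theta>))"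
    by (simp add: normal_fun_def xray_adj_def xray_def)
  also have "\<dots> = (LINT \<theta>|sphere_measure. LINT s|lborel. F (x + ?T (\<theta>, s)))"
  proof (rule Bochner_Integration.integral_cong[OF refl])
    fix \<theta>
    have "(LINT s|lborel. F (x + ?T (\<theta>, s))) = (LINT s|lborel. F (x + ?T (\<theta>, - (x \<bullet> \<theta>) + s)))"
      by (rule lborel_integral_translate[symmetric]) simp
    then show "(LINT s|lborel. F (x - (x \<bullet> \<theta>) *\<^sub>R \<theta> + s *\<^sub>R \<theta>)) = (LINT s|lborel. F (x + ?T (\<theta>, s)))"
      by (simp add: scaleR_add_left algebra_simps)
  qed
  also have "\<dots> = (LINT p|(sphere_measure \<Otimes>\<^sub>M lborel). F (x + ?T p))"
    using P.integral_fst'[OF int] by simp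
  also have "\<dots> = (LINT w|density lborel (\<lambda>w. ennreal (2 * ?k w)). F (x + w))"
    unfolding distr_polar[symmetric] by (subst integral_distr) auto
  also have "\<dots> = (LINT w|lborel. (2 * ?k w) *\<^sub>R F (x + w))"
    by (subst integral_density) auto
  also have "\<dots> = (LINT w|lborel. 2 * (F (x + w) * of_real (?k w)))"
    by (simp add: scaleR_conv_of_real mult_ac)
  finally show ?thesis by simp
qed

section \<open>Injectivity of the Fourier transform\<close>

definition gauss_measure :: "(real^'n::finite) measure" where
  "gauss_measure = distr (Pi\<^sub>M UNIV (\<lambda>_. std_normal_distribution)) borel (\<lambda>f. \<chi> i. f i)"

lemma gauss_measure_measurable:
  "(\<lambda>f. \<chi> i. f i) \<in> Pi\<^sub>M UNIV (\<lambda>_::'n::finite. std_normal_distribution) \<rightarrow>\<^sub>M (borel :: (real^'n) measure)"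
proof (rule borel_measurable_euclidean_space[THEN iffD2], intro ballI)
  fix b :: "real^'n" assume "b \<in> Basis"
  then obtain j where b: "b = axis j 1" by (auto simp: Basis_vec_def)
  have "(\<lambda>f::'n\<Rightarrow>real. f j) \<in> Pi\<^sub>M UNIV (\<lambda>_::'n. std_normal_distribution) \<rightarrow>\<^sub>M std_normal_distribution"
    by (rule measurable_component_singleton) simp
  then show "(\<lambda>f. (\<chi> i. f i) \<bullet> b) \<in> borel_measurable (Pi\<^sub>M UNIV (\<lambda>_::'n. std_normal_distribution))"
    by (simp add: b inner_axis measurable_cong_sets[OF refl, of std_normal_distribution borel])
qed

lemma prob_space_gauss_measure: "prob_space (gauss_measure :: (real^'n::finite) measure)"
proof -
  interpret N: prob_space std_normal_distribution by (rule prob_space_normal_density) simp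
  interpret product_prob_space "\<lambda>_::'n. std_normal_distribution" UNIV ..
  show ?thesis unfolding gauss_measure_def by (rule P.prob_space_distr[OF gauss_measure_measurable])
qed

lemma char_gauss_measure:
  "(LINT \<xi>|gauss_measure. cis (x \<bullet> \<xi>)) = of_real (exp (- (norm (x::real^'n::finite))\<^sup>2 / 2))"
proof -
  interpret N: prob_space std_normal_distribution by (rule prob_space_normal_density) simp
  interpret product_sigma_finite "\<lambda>_::'n. std_normal_distribution" ..
  have "(LINT \<xi>|gauss_measure. cis (x \<bullet> \<xi>)) = (LINT f|Pi\<^sub>M UNIV (\<lambda>_. std_normal_distribution). cis (x \<bullet> (\<chi> i. f i)))"
    unfolding gauss_measure_def by (rule integral_distr[OF gauss_measure_measurable]) (simp add: cis_conv_exp)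
  also have "\<dots> = (LINT f|Pi\<^sub>M UNIV (\<lambda>_::'n. std_normal_distribution). (\<Prod>i\<in>UNIV. iexp (x $ i * f i)))"
    by (simp add: cis_conv_exp inner_vec_def exp_sum[symmetric] sum_distrib_left)
  also have "\<dots> = (\<Prod>i\<in>UNIV. LINT s|std_normal_distribution. iexp (x $ i * s))"
    by (rule product_integral_prod) (auto intro!: N.integrable_const_bound[where B=1])
  also have "\<dots> = (\<Prod>i\<in>UNIV. char std_normal_distribution (x $ i))"
    by (simp add: char_def)
  also have "\<dots> = (\<Prod>i\<in>UNIV. of_real (exp (- (x $ i)\<^sup>2 / 2)))"
    by (simp add: char_std_normal_distribution)
  also have "\<dots> = of_real (exp (- (\<Sum>i\<in>UNIV. (x $ i)\<^sup>2) / 2))"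
    by (simp add: exp_sum[symmetric] sum_negf sum_divide_distrib flip: of_real_prod)
  also have "(\<Sum>i\<in>UNIV. (x $ i)\<^sup>2) = (norm x)\<^sup>2"
    unfolding power2_norm_eq_inner by (simp add: inner_vec_def power2_eq_square)
  finally show ?thesis .
qed

text \<open>A Gaussian is the Fourier transform of a probability measure, so by Fubini's theorem the Gaussian transform of
\<open>F\<close> is an average of values of the Fourier transform of \<open>F\<close>.\<close>

lemma fourier_injective:
  fixes F :: "real^'n::finite \<Rightarrow> complex"
  assumes F: "integrable lborel F" "continuous_on UNIV F" "\<And>y. norm (F y) \<le> B"
    and zero: "\<And>\<xi>. (LINT y|lborel. F y * cis (y \<bullet> \<xi>)) = 0"
  shows "F x = 0"
proof (rule gaussian_transform_injective[OF F(2,3)])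
  fix a :: real assume a: "a > 0"
  have [measurable]: "F \<in> borel_measurable borel" using F by auto
  \<comment> \<open>This scaling turns \<open>exp(-|\<cdot>|\<^sup>2/2)\<close> into \<open>exp(-a|\<cdot>|\<^sup>2)\<close>.\<close>
  define c where "c = sqrt (2 * a)"
  interpret G: prob_space "gauss_measure :: (real^'n) measure" by (rule prob_space_gauss_measure)
  have sets_G[measurable_cong]: "sets (gauss_measure :: (real^'n) measure) = sets borel"
    by (simp add: gauss_measure_def)
  interpret P: pair_sigma_finite "lborel :: (real^'n) measure" "gauss_measure :: (real^'n) measure" ..
  let ?e = "\<lambda>y \<xi>. cis ((c *\<^sub>R (y - x)) \<bullet> \<xi>)"
  have [measurable]: "cis \<in> borel_measurable borel" by (intro borel_measurable_continuous_onI continuous_intros)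
  have int: "integrable (lborel \<Otimes>\<^sub>M gauss_measure) (\<lambda>(y, \<xi>). F y * ?e y \<xi>)"
  proof (rule Bochner_Integration.integrable_bound)
    show "integrable (lborel \<Otimes>\<^sub>M (gauss_measure :: (real^'n) measure)) (\<lambda>p. F (fst p))"
      by (rule P.Fubini_integrable) (use F(1) in \<open>auto simp: G.prob_space\<close>)
  qed (auto simp: norm_mult split_beta')
  have "(LINT y|lborel. F y * of_real (exp (- a * (norm (y - x))\<^sup>2))) = (LINT y|lborel. (LINT \<xi>|gauss_measure. F y * ?e y \<xi>))"
  proof (intro Bochner_Integration.integral_cong refl)
    fix y
    have "of_real (exp (- a * (norm (y - x))\<^sup>2)) = (LINT \<xi>|gauss_measure. ?e y \<xi>)"
      using a by (simp only: char_gauss_measure) (simp add: c_def power_mult_distrib)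
    then show "F y * of_real (exp (- a * (norm (y - x))\<^sup>2)) = (LINT \<xi>|gauss_measure. F y * ?e y \<xi>)"
      by simp
  qed
  also have "\<dots> = (LINT \<xi>|gauss_measure. (LINT y|lborel. F y * ?e y \<xi>))"
    using P.Fubini_integral[OF int] by simp
  also have "\<dots> = (LINT \<xi>|gauss_measure. (LINT y|lborel. F y * cis (y \<bullet> (c *\<^sub>R \<xi>))) * cis (- (x \<bullet> (c *\<^sub>R \<xi>))))"
    by (subst integral_mult_left_zero[symmetric]) (simp add: cis_mult inner_diff_left algebra_simps)
  also have "\<dots> = 0" by (simp only: zero) simp
  finally show "(LINT y|lborel. F y * of_real (exp (- a * (norm (y - x))\<^sup>2))) = 0" .
qed

section \<open>Smooth functions and test functions\<close>

lemma D_fun_eq: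
  assumes "(f has_derivative f') (at x)"
  shows "D_fun j f x = - \<i> * f' (axis j 1)"
  using frechet_derivative_at[OF assms] by (simp add: D_fun_def)

lemma smooth_functions_iff: "f \<in> smooth_functions \<longleftrightarrow> (\<forall>js x. foldr D_fun js f differentiable (at x))"
  by (simp add: smooth_functions_def)

lemma smooth_functions_differentiable:
  assumes "f \<in> smooth_functions" shows "f differentiable (at x)"
  using assms[unfolded smooth_functions_iff, rule_format, of "[]"] by simp

lemma smooth_functions_D_fun:
  assumes "f \<in> smooth_functions" shows "D_fun j f \<in> smooth_functions"
  unfolding smooth_functions_iff
proof (intro allI)
  fix js x
  show "foldr D_fun js (D_fun j f) differentiable (at x)"
    using assms[unfolded smooth_functions_iff, rule_format, of "js @ [j]"] by simp
qed

lemma smooth_functions_foldr_D_fun: "f \<in> smooth_functions \<Longrightarrow> foldr D_fun js f \<in> smooth_functions"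
  by (induction js) (auto intro: smooth_functions_D_fun)

text \<open>Smoothness of the functions constructed below is shown without computing higher derivatives: it suffices to
exhibit a class of differentiable functions that is stable under all \<open>D\<^sub>j\<close>.\<close>

lemma smooth_functions_coinduct:
  assumes "f \<in> S"
    and diff: "\<And>g x. g \<in> S \<Longrightarrow> g differentiable (at x)"
    and D: "\<And>g j. g \<in> S \<Longrightarrow> D_fun j g \<in> S"
  shows "f \<in> smooth_functions"
proof -
  have "foldr D_fun js f \<in> S" for js
    by (induction js) (simp_all add: assms)
  then show ?thesis using diff by (simp add: smooth_functions_iff)
qed

lemma smooth_has_derivative:
  "f \<in> smooth_functions \<Longrightarrow> (f has_derivative frechet_derivative f (at x)) (at x)"
  using smooth_functions_differentiable frechet_derivative_works by blast

lemma smooth_continuous: "f \<in> smooth_functions \<Longrightarrow> continuous_on UNIV f"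
  by (meson continuous_at_imp_continuous_on differentiable_imp_continuous_within smooth_functions_differentiable)

lemma D_fun_add:
  assumes "f differentiable (at x)" "g differentiable (at x)"
  shows "D_fun j (\<lambda>x. f x + g x) x = D_fun j f x + D_fun j g x"
  using assms[unfolded frechet_derivative_works]
  by (subst D_fun_eq[OF has_derivative_add]) (auto simp: D_fun_def algebra_simps)

lemma D_fun_mult:
  assumes "f differentiable (at x)" "g differentiable (at x)"
  shows "D_fun j (\<lambda>x. f x * g x) x = f x * D_fun j g x + D_fun j f x * g x"
  using assms[unfolded frechet_derivative_works]
  by (subst D_fun_eq[OF has_derivative_mult]) (auto simp: D_fun_def algebra_simps)

lemma D_fun_const: "D_fun j (\<lambda>x. c) = (\<lambda>x. 0)"
  by (simp add: D_fun_def)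

lemma smooth_const: "(\<lambda>x. c) \<in> smooth_functions"
  by (rule smooth_functions_coinduct[of _ "range (\<lambda>c x. c)"]) (auto simp: D_fun_const)

lemma smooth_add:
  assumes "f \<in> smooth_functions" "g \<in> smooth_functions"
  shows "(\<lambda>x. f x + g x) \<in> smooth_functions"
proof (rule smooth_functions_coinduct[of _ "{\<lambda>x. f x + g x |f g. f \<in> smooth_functions \<and> g \<in> smooth_functions}"])
  fix h j assume "h \<in> {\<lambda>x. f x + g x |f g. f \<in> smooth_functions \<and> g \<in> (smooth_functions :: 'a cfun set)}"
  then obtain f g where h: "h = (\<lambda>x. f x + g x)" "f \<in> smooth_functions" "g \<in> smooth_functions" by blast
  have "D_fun j h = (\<lambda>x. D_fun j f x + D_fun j g x)"
    unfolding h(1) using h(2,3) by (auto simp: fun_eq_iff D_fun_add smooth_functions_differentiable)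
  then show "D_fun j h \<in> {\<lambda>x. f x + g x |f g. f \<in> smooth_functions \<and> g \<in> smooth_functions}"
    using h smooth_functions_D_fun by blast
qed (use assms in \<open>auto intro!: differentiable_add intro: smooth_functions_differentiable\<close>)

text \<open>Unlike the single products, their finite sums are stable under all \<open>D\<^sub>j\<close>, by the Leibniz rule.\<close>

inductive_set smooth_products :: "('n::finite) cfun set" where
  prod: "f \<in> smooth_functions \<Longrightarrow> g \<in> smooth_functions \<Longrightarrow> (\<lambda>x. f x * g x) \<in> smooth_products"
| sum: "f \<in> smooth_products \<Longrightarrow> g \<in> smooth_products \<Longrightarrow> (\<lambda>x. f x + g x) \<in> smooth_products"

lemma smooth_products_differentiable: "h \<in> smooth_products \<Longrightarrow> h differentiable (at x)"
  by (induction rule: smooth_products.induct) (auto intro!: differentiable_add differentiable_mult intro: smooth_functions_differentiable)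

lemma smooth_mult:
  assumes "f \<in> smooth_functions" "g \<in> smooth_functions"
  shows "(\<lambda>x. f x * g x) \<in> smooth_functions"
proof (rule smooth_functions_coinduct[of _ smooth_products])
  fix h :: "'a cfun" and j assume "h \<in> smooth_products"
  then show "D_fun j h \<in> smooth_products"
  proof induction
    case (prod f g)
    have "D_fun j (\<lambda>x. f x * g x) = (\<lambda>x. (f x * D_fun j g x) + (D_fun j f x * g x))"
      using prod by (auto simp: fun_eq_iff D_fun_mult smooth_functions_differentiable)
    then show ?case using prod by (auto intro!: smooth_products.intros smooth_functions_D_fun)
  next
    case (sum f g)
    have "D_fun j (\<lambda>x. f x + g x) = (\<lambda>x. D_fun j f x + D_fun j g x)"
      using sum by (auto simp: fun_eq_iff D_fun_add smooth_products_differentiable)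
    then show ?case using sum by (auto intro!: smooth_products.intros)
  qed
qed (use assms in \<open>auto intro: smooth_products.intros smooth_products_differentiable\<close>)

lemma D_fun_cmult:
  assumes "f \<in> smooth_functions"
  shows "D_fun j (\<lambda>x. c * f x) = (\<lambda>x. c * D_fun j f x)"
  using D_fun_mult[of "\<lambda>x. c" _ f] assms by (auto simp: fun_eq_iff smooth_functions_differentiable D_fun_const)

lemma smooth_cmult: "f \<in> smooth_functions \<Longrightarrow> (\<lambda>x. c * f x) \<in> smooth_functions"
  by (rule smooth_mult[OF smooth_const])

lemma smooth_diff:
  assumes "f \<in> smooth_functions" "g \<in> smooth_functions"
  shows "(\<lambda>x. f x - g x) \<in> smooth_functions"
  using smooth_add[OF assms(1) smooth_cmult[OF assms(2), of "-1"]] by simp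

lemma foldr_D_fun_add:
  assumes "f \<in> smooth_functions" "g \<in> smooth_functions"
  shows "foldr D_fun js (\<lambda>x. f x + g x) = (\<lambda>x. foldr D_fun js f x + foldr D_fun js g x)"
proof (induction js)
  case (Cons j js)
  then show ?case
    using assms by (auto simp: D_fun_add smooth_functions_differentiable smooth_functions_foldr_D_fun)
qed simp

lemma foldr_D_fun_cmult:
  assumes "f \<in> smooth_functions"
  shows "foldr D_fun js (\<lambda>x. c * f x) = (\<lambda>x. c * foldr D_fun js f x)"
  by (induction js) (use assms in \<open>auto simp: D_fun_cmult smooth_functions_foldr_D_fun\<close>)

lemma foldr_D_fun_diff:
  assumes "f \<in> smooth_functions" "g \<in> smooth_functions"
  shows "foldr D_fun js (\<lambda>x. f x - g x) = (\<lambda>x. foldr D_fun js f x - foldr D_fun js g x)"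
  using foldr_D_fun_add[OF assms(1) smooth_cmult[OF assms(2), of "-1"], of js] foldr_D_fun_cmult[OF assms(2), of js "-1"]
  by simp

lemma has_derivative_translate:
  assumes "f \<in> smooth_functions"
  shows "((\<lambda>z. f (z - x)) has_derivative frechet_derivative f (at (z - x))) (at z)"
  by (rule has_derivative_compose[OF _ smooth_has_derivative[OF assms], of "\<lambda>z. z - x"])
     (auto intro!: derivative_eq_intros)

lemma D_fun_translate:
  assumes "f \<in> smooth_functions"
  shows "D_fun j (\<lambda>z. f (z - x)) = (\<lambda>z. D_fun j f (z - x))"
  by (rule ext, subst D_fun_eq[OF has_derivative_translate[OF assms]]) (simp add: D_fun_def)

lemma smooth_translate:
  assumes "f \<in> smooth_functions" shows "(\<lambda>z. f (z - x)) \<in> smooth_functions"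
  by (rule smooth_functions_coinduct[of _ "(\<lambda>f z. f (z - x)) ` smooth_functions"])
    (use assms in \<open>auto simp: D_fun_translate smooth_functions_D_fun differentiable_def intro: has_derivative_translate\<close>)

lemma foldr_D_fun_translate:
  assumes "f \<in> smooth_functions"
  shows "foldr D_fun js (\<lambda>z. f (z - x)) = (\<lambda>z. foldr D_fun js f (z - x))"
  by (induction js) (use assms in \<open>auto simp: D_fun_translate smooth_functions_foldr_D_fun\<close>)

lemma fun_support_subset: "closed K \<Longrightarrow> (\<And>x. x \<notin> K \<Longrightarrow> f x = 0) \<Longrightarrow> fun_support f \<subseteq> K"
  unfolding fun_support_def by (rule closure_minimal) auto

lemma not_in_fun_support: "x \<notin> fun_support f \<Longrightarrow> f x = 0"
  unfolding fun_support_def using closure_subset[of "{x. f x \<noteq> 0}"] by auto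

lemma closed_fun_support: "closed (fun_support f)"
  by (simp add: fun_support_def)

lemma D_fun_support: "fun_support (D_fun j f) \<subseteq> fun_support f"
proof (rule fun_support_subset[OF closed_fun_support])
  fix x assume x: "x \<notin> fun_support f"
  have "(f has_derivative (\<lambda>_. 0)) (at x)"
  proof (rule has_derivative_transform_within_open[of "\<lambda>_. 0" _ _ _ "- fun_support f"])
    show "open (- fun_support f)" using closed_fun_support by auto
  qed (use x not_in_fun_support in \<open>auto simp: not_in_fun_support\<close>)
  then show "D_fun j f x = 0" by (subst D_fun_eq) auto
qed

lemma foldr_D_fun_support: "fun_support (foldr D_fun js f) \<subseteq> fun_support f"
proof (induction js)
  case (Cons j js)
  then show ?case using D_fun_support[of j "foldr D_fun js f"] by simp
qed simp

lemma test_functionsI: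
  assumes "f \<in> smooth_functions" "compact K" "\<And>x. x \<notin> K \<Longrightarrow> f x = 0"
  shows "f \<in> test_functions"
proof -
  have "fun_support f \<subseteq> K"
    using assms by (intro fun_support_subset compact_imp_closed) auto
  then have "compact (fun_support f)"
    using compact_Int_closed[OF assms(2) closed_fun_support[of f]] by (simp add: inf.absorb2)
  then show ?thesis using assms(1) by (simp add: test_functions_def)
qed

lemma test_smooth: "f \<in> test_functions \<Longrightarrow> f \<in> smooth_functions"
  by (simp add: test_functions_def)

lemma test_compact: "f \<in> test_functions \<Longrightarrow> compact (fun_support f)"
  by (simp add: test_functions_def)

lemma test_mult:
  "f \<in> test_functions \<Longrightarrow> g \<in> smooth_functions \<Longrightarrow> (\<lambda>x. f x * g x) \<in> test_functions"
  by (rule test_functionsI[of _ "fun_support f"]) (auto simp: test_smooth test_compact smooth_mult not_in_fun_support)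

lemma test_cmult: "f \<in> test_functions \<Longrightarrow> (\<lambda>x. c * f x) \<in> test_functions"
  by (rule test_functionsI[of _ "fun_support f"]) (auto simp: test_smooth test_compact smooth_cmult not_in_fun_support)

lemma test_add: "f \<in> test_functions \<Longrightarrow> g \<in> test_functions \<Longrightarrow> (\<lambda>x. f x + g x) \<in> test_functions"
  by (rule test_functionsI[of _ "fun_support f \<union> fun_support g"])
    (auto simp: test_smooth test_compact smooth_add not_in_fun_support intro: compact_Un)

lemma test_zero: "(\<lambda>x. 0) \<in> test_functions"
  by (rule test_functionsI[of _ "{}"]) (auto simp: smooth_const)

lemma test_sum: "finite A \<Longrightarrow> (\<And>a. a \<in> A \<Longrightarrow> f a \<in> test_functions) \<Longrightarrow> (\<lambda>x. \<Sum>a\<in>A. f a x) \<in> test_functions"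
  by (induction A rule: finite_induct) (auto intro: test_zero test_add)

lemma test_foldr_D_fun:
  assumes "f \<in> test_functions" shows "foldr D_fun js f \<in> test_functions"
proof (rule test_functionsI[of _ "fun_support f"])
  fix x assume "x \<notin> fun_support f"
  then have "x \<notin> fun_support (foldr D_fun js f)" using foldr_D_fun_support[of js f] by blast
  then show "foldr D_fun js f x = 0" by (rule not_in_fun_support)
qed (use assms in \<open>simp_all add: test_smooth test_compact smooth_functions_foldr_D_fun\<close>)

lemma fun_support_translate:
  "fun_support (\<lambda>z. f (z - x)) = (+) x ` fun_support f"
proof -
  have "{z. f (z - x) \<noteq> 0} = (+) x ` {z. f z \<noteq> 0}"
  proof (intro equalityI subsetI)
    fix z assume "z \<in> {z. f (z - x) \<noteq> 0}"
    then show "z \<in> (+) x ` {z. f z \<noteq> 0}" by (intro image_eqI[of _ _ "z - x"]) simp_all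
  qed auto
  then show ?thesis by (simp add: fun_support_def closure_translation)
qed

lemma test_translate: "f \<in> test_functions \<Longrightarrow> (\<lambda>z. f (z - x)) \<in> test_functions"
  by (simp add: test_functions_def smooth_translate fun_support_translate compact_translation)

lemma test_bounded:
  assumes "f \<in> test_functions"
  obtains B where "B > 0" "\<And>x. norm (f x) \<le> B"
proof -
  have "compact (f ` fun_support f)"
    by (rule compact_continuous_image[OF continuous_on_subset[OF smooth_continuous[OF test_smooth[OF assms]]]
          test_compact[OF assms]]) simp
  from compact_imp_bounded[OF this] obtain B where "B > 0" "\<forall>y\<in>f ` fun_support f. norm y \<le> B"
    unfolding bounded_pos by blast
  moreover have "norm (f x) \<le> B" for x
    using calculation not_in_fun_support[of x f] by (cases "x \<in> fun_support f") auto
  ultimately show ?thesis using that by blast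
qed

lemma test_support_ball:
  assumes "f \<in> test_functions"
  obtains R where "R > 0" "\<And>x. norm x \<ge> R \<Longrightarrow> f x = 0"
proof -
  obtain R where "R > 0" "fun_support f \<subseteq> ball 0 R"
    using compact_imp_bounded[OF test_compact[OF assms]] bounded_subset_ballD by blast
  moreover have "f x = 0" if "norm x \<ge> R" for x
    using calculation that by (intro not_in_fun_support) auto
  ultimately show ?thesis using that by blast
qed

lemma test_integrable:
  assumes "f \<in> test_functions"
  shows "integrable lborel f"
proof -
  obtain B where B: "\<And>x. norm (f x) \<le> B" using test_bounded[OF assms] by metis
  have [measurable]: "f \<in> borel_measurable borel"
    using smooth_continuous[OF test_smooth[OF assms]] by (rule borel_measurable_continuous_onI)
  show ?thesis
  proof (rule Bochner_Integration.integrable_bound)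
    show "integrable lborel (\<lambda>x. B * indicator (fun_support f) x)"
      using emeasure_compact_finite[OF test_compact[OF assms]] test_compact[OF assms]
      by (intro integrable_mult_right integrable_real_indicator) (auto simp: compact_imp_closed)
    show "AE x in lborel. norm (f x) \<le> norm (B * indicator (fun_support f) x)"
    proof (intro AE_I2)
      fix x
      show "norm (f x) \<le> norm (B * indicator (fun_support f) x)"
        using B[of x] not_in_fun_support[of x f] by (cases "x \<in> fun_support f") auto
    qed
  qed auto
qed

section \<open>Bump functions\<close>

text \<open>The functions \<open>exp(-1/t) t\<^bsup>-k\<^esup>\<close>, extended by zero.  The powers are included because differentiation then stays
in the family.\<close>

definition flat :: "nat \<Rightarrow> real \<Rightarrow> real" where
  "flat k t = (if t > 0 then exp (- inverse t) * inverse t ^ k else 0)"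

lemma flat_has_derivative: "(flat k has_real_derivative flat (k + 2) t - real k * flat (k + 1) t) (at t)"
proof (cases "t = 0")
  case True
  have "((\<lambda>h. flat k h / h) \<longlongrightarrow> 0) (at_right 0)"
  proof -
    have "((\<lambda>x::real. x ^ (k + 1) / exp x) \<longlongrightarrow> 0) at_top" by (rule tendsto_power_div_exp_0)
    from filterlim_compose[OF this filterlim_inverse_at_top_right]
    have "((\<lambda>h::real. inverse h ^ (k + 1) / exp (inverse h)) \<longlongrightarrow> 0) (at_right 0)" .
    then show ?thesis
    proof (rule Lim_transform_eventually)
      show "\<forall>\<^sub>F h in at_right 0. inverse h ^ (k + 1) / exp (inverse h) = flat k h / h"
        unfolding eventually_at_right_field
        by (intro exI[of _ 1]) (auto simp: flat_def exp_minus field_simps)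
    qed
  qed
  moreover have "((\<lambda>h. flat k h / h) \<longlongrightarrow> 0) (at_left 0)"
  proof (rule Lim_transform_eventually[OF tendsto_const])
    show "\<forall>\<^sub>F h in at_left 0. 0 = flat k h / h"
      unfolding eventually_at_left_field by (intro exI[of _ "-1"]) (auto simp: flat_def)
  qed
  ultimately have "((\<lambda>h. flat k h / h) \<longlongrightarrow> 0) (at 0)" by (simp add: filterlim_split_at)
  then show ?thesis using True by (simp add: DERIV_def flat_def)
next
  case False
  show ?thesis
  proof (cases "t > 0")
    case True
    have inv: "(inverse has_real_derivative - (inverse t)\<^sup>2) (at t)"
      using DERIV_inverse[of t] True by (simp add: numeral_2_eq_2)
    have pow: "((\<lambda>t. inverse t ^ k) has_real_derivative real k * inverse t ^ (k - Suc 0) * - (inverse t)\<^sup>2) (at t)"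
      using DERIV_power[OF inv, of k] by (simp add: mult_ac)
    have "((\<lambda>t. exp (- inverse t)) has_real_derivative exp (- inverse t) * (inverse t)\<^sup>2) (at t)"
      using DERIV_fun_exp[OF DERIV_minus[OF inv]] by simp
    from DERIV_mult[OF this pow]
    have "((\<lambda>t. exp (- inverse t) * inverse t ^ k) has_real_derivative
        exp (- inverse t) * inverse t ^ (k + 2) - real k * (exp (- inverse t) * inverse t ^ (k + 1))) (at t)"
      by (rule DERIV_cong) (cases k, simp_all add: algebra_simps power2_eq_square)
    then have "(flat k has_real_derivative exp (- inverse t) * inverse t ^ (k + 2) - real k * (exp (- inverse t) * inverse t ^ (k + 1))) (at t)"
      by (rule has_field_derivative_transform_within_open[of _ _ _ "{0<..}"]) (use True in \<open>auto simp: flat_def\<close>)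
    then show ?thesis using True by (simp add: flat_def)
  next
    case F: False
    have "((\<lambda>_. 0) has_real_derivative 0) (at t)" by simp
    then have "(flat k has_real_derivative 0) (at t)"
      by (rule has_field_derivative_transform_within_open[of _ _ _ "{..<0}"]) (use F False in \<open>auto simp: flat_def\<close>)
    then show ?thesis using F by (simp add: flat_def)
  qed
qed

text \<open>This algebra contains the bump functions and is stable under all \<open>D\<^sub>j\<close>: the coordinates are included because
they appear as factors when \<open>flat k (d - |x|\<^sup>2)\<close> is differentiated.\<close>

inductive_set bump_algebra :: "real \<Rightarrow> ('n::finite) cfun set" for d where
  const: "(\<lambda>x. c) \<in> bump_algebra d"
| coord: "(\<lambda>x. of_real (x $ i)) \<in> bump_algebra d"
| flat: "(\<lambda>x. of_real (flat k (d - x \<bullet> x))) \<in> bump_algebra d"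
| add: "f \<in> bump_algebra d \<Longrightarrow> g \<in> bump_algebra d \<Longrightarrow> (\<lambda>x. f x + g x) \<in> bump_algebra d"
| mult: "f \<in> bump_algebra d \<Longrightarrow> g \<in> bump_algebra d \<Longrightarrow> (\<lambda>x. f x * g x) \<in> bump_algebra d"

lemma flat_radial_has_derivative:
  "((\<lambda>x::real^'n::finite. complex_of_real (flat k (d - x \<bullet> x))) has_derivative
     (\<lambda>v. of_real ((flat (k + 2) (d - x \<bullet> x) - real k * flat (k + 1) (d - x \<bullet> x)) * (- 2 * (x \<bullet> v))))) (at x)"
proof -
  have "((\<lambda>x::real^'n. d - x \<bullet> x) has_derivative (\<lambda>v. - 2 * (x \<bullet> v))) (at x)"
    by (auto intro!: derivative_eq_intros simp: inner_commute)
  from has_derivative_compose[OF this flat_has_derivative[unfolded has_field_derivative_def]]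
  show ?thesis by (intro has_derivative_of_real) (simp add: mult.commute)
qed

lemma coord_has_derivative:
  "((\<lambda>x::real^'n::finite. complex_of_real (x $ i)) has_derivative (\<lambda>v. of_real (v $ i))) (at x)"
  by (intro has_derivative_of_real bounded_linear.has_derivative[OF bounded_linear_vec_nth] has_derivative_ident)

lemma bump_algebra_differentiable: "f \<in> bump_algebra d \<Longrightarrow> f differentiable (at x)"
proof (induction rule: bump_algebra.induct)
  case (coord i) show ?case using coord_has_derivative by (auto simp: differentiable_def)
next
  case (flat k) show ?case using flat_radial_has_derivative by (auto simp: differentiable_def)
qed (auto intro: differentiable_add differentiable_mult)

lemma bump_algebra_smooth:
  assumes "f \<in> bump_algebra d" shows "f \<in> smooth_functions"
proof (rule smooth_functions_coinduct[OF assms])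
  fix g :: "'a cfun" and j assume "g \<in> bump_algebra d"
  then show "D_fun j g \<in> bump_algebra d"
  proof induction
    case (const c) then show ?case by (simp add: D_fun_const bump_algebra.const)
  next
    case (coord i)
    have "D_fun j (\<lambda>x. of_real (x $ i)) = (\<lambda>x. - \<i> * of_real (axis j 1 $ i))"
      by (rule ext, subst D_fun_eq[OF coord_has_derivative]) simp
    then show ?case by (simp only: bump_algebra.const)
  next
    case (flat k)
    have "D_fun j (\<lambda>x. of_real (flat k (d - x \<bullet> x))) =
      (\<lambda>x. (2 * \<i>) * (of_real (x $ j) * (of_real (flat (k + 2) (d - x \<bullet> x)) + of_real (- real k) * of_real (flat (k + 1) (d - x \<bullet> x)))))"
      by (rule ext, subst D_fun_eq[OF flat_radial_has_derivative]) (simp add: inner_axis algebra_simps)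
    then show ?case by (simp only:) (intro bump_algebra.intros)
  next
    case (add f g)
    have "D_fun j (\<lambda>x. f x + g x) = (\<lambda>x. D_fun j f x + D_fun j g x)"
      using add by (intro ext D_fun_add) (auto intro: bump_algebra_differentiable)
    then show ?case using add by (auto intro: bump_algebra.add)
  next
    case (mult f g)
    have "D_fun j (\<lambda>x. f x * g x) = (\<lambda>x. f x * D_fun j g x + D_fun j f x * g x)"
      using mult by (intro ext D_fun_mult) (auto intro: bump_algebra_differentiable)
    then show ?case using mult by (auto intro!: bump_algebra.add bump_algebra.mult)
  qed
qed (rule bump_algebra_differentiable)

definition bump :: "real \<Rightarrow> real^'n::finite \<Rightarrow> real" where
  "bump d x = flat 0 (d\<^sup>2 - x \<bullet> x)"

lemma bump_nonneg: "bump d x \<ge> 0"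
  by (simp add: bump_def flat_def)

lemma bump_pos_iff: "d > 0 \<Longrightarrow> bump d x > 0 \<longleftrightarrow> norm x < d"
  unfolding bump_def flat_def power2_norm_eq_inner[symmetric]
  by (auto simp: abs_square_less_1 power2_less_imp_less intro: power_strict_mono)

lemma bump_eq_0: "d > 0 \<Longrightarrow> norm x \<ge> d \<Longrightarrow> bump d x = 0"
  using bump_pos_iff[of d x] bump_nonneg[of d x] by linarith

lemma bump_test: "d > 0 \<Longrightarrow> (\<lambda>x. complex_of_real (bump d x)) \<in> test_functions"
  by (rule test_functionsI[of _ "cball 0 d"])
    (auto simp: bump_def bump_algebra_smooth[OF bump_algebra.flat] not_le intro: bump_eq_0[unfolded bump_def])

lemma integrable_bump: "d > 0 \<Longrightarrow> integrable lborel (bump d)"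
  using integrable_Re[OF test_integrable[OF bump_test]] by simp

lemma integral_bump_weighted_pos:
  fixes g :: "real^'n::finite \<Rightarrow> real"
  assumes d: "d > 0" and g: "continuous_on UNIV g" "\<And>x. norm x < d \<Longrightarrow> g x > 0"
    and int: "integrable lborel (\<lambda>x. bump d x * g x)"
  shows "(LINT x|lborel. bump d x * g x) > 0"
proof -
  have nn: "bump d x * g x \<ge> 0" for x
    using bump_nonneg[of d x] bump_eq_0[OF d, of x] g(2)[of x] by (cases "norm x < d") (auto simp: not_less)
  have "(LINT x|lborel. bump d x * g x) \<noteq> 0"
  proof
    assume "(LINT x|lborel. bump d x * g x) = 0"
    then have "AE x in lborel. bump d x * g x = 0"
      using integral_nonneg_eq_0_iff_AE[OF int] nn by auto
    then have "AE x in lborel. x \<notin> ball (0::real^'n) d"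
    proof (rule eventually_mono)
      fix x :: "real^'n" assume 0: "bump d x * g x = 0"
      show "x \<notin> ball 0 d"
      proof
        assume "x \<in> ball 0 d"
        then have "bump d x > 0" "g x > 0" using bump_pos_iff[OF d, of x] g(2)[of x] by auto
        then show False using 0 by simp
      qed
    qed
    then have "emeasure lborel (ball (0::real^'n) d) = 0"
      by (subst (asm) AE_iff_measurable[of "ball 0 d"]) auto
    then have "ball (0::real^'n) d = {}"
      using open_not_negligible[of "ball (0::real^'n) d"] by (auto simp: negligible_iff_emeasure0 emeasure_completion)
    then show False using d by auto
  qed
  moreover have "(LINT x|lborel. bump d x * g x) \<ge> 0" using nn by (intro integral_nonneg_AE) auto
  ultimately show ?thesis by linarith
qed

lemma integral_bump_pos: "d > 0 \<Longrightarrow> (LINT x|lborel. bump d (x::real^'n::finite)) > 0"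
  using integral_bump_weighted_pos[of d "\<lambda>_. 1"] integrable_bump[of d] by simp

section \<open>Convolution with a test function\<close>

lemma frechet_derivative_D_fun:
  assumes "f \<in> smooth_functions"
  shows "frechet_derivative f (at x) v = \<i> * (\<Sum>j\<in>UNIV. of_real (v $ j) * D_fun j f x)"
proof -
  have lin: "linear (frechet_derivative f (at x))"
    using smooth_has_derivative[OF assms] has_derivative_linear by blast
  have "frechet_derivative f (at x) v = frechet_derivative f (at x) (\<Sum>j\<in>UNIV. (v $ j) *\<^sub>R axis j 1)"
    using basis_expansion[of v] by (simp add: scalar_mult_eq_scaleR)
  also have "\<dots> = (\<Sum>j\<in>UNIV. (v $ j) *\<^sub>R frechet_derivative f (at x) (axis j 1))"
    by (simp add: linear_sum[OF lin] linear_cmul[OF lin])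
  also have "\<dots> = (\<Sum>j\<in>UNIV. of_real (v $ j) * (\<i> * D_fun j f x))"
    by (simp add: D_fun_def scaleR_conv_of_real)
  finally show ?thesis by (simp add: sum_distrib_left mult_ac)
qed

lemma D_fun_test: "f \<in> test_functions \<Longrightarrow> D_fun j f \<in> test_functions"
  using test_foldr_D_fun[of f "[j]"] by simp

lemma test_lipschitz:
  assumes "f \<in> test_functions"
  obtains L where "L \<ge> 0" "\<And>x y. norm (f x - f y) \<le> L * norm (x - y)"
proof -
  have "\<exists>B>0. \<forall>x. norm (D_fun j f x) \<le> B" for j
    using test_bounded[OF test_foldr_D_fun[OF assms, of "[j]"]] by auto
  then obtain B where B: "\<And>j. B j > 0" "\<And>j x. norm (D_fun j f x) \<le> B j" by metis
  let ?L = "\<Sum>j\<in>UNIV. B j"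
  have "norm (f x - f y) \<le> ?L * norm (x - y)" for x y
  proof (rule differentiable_bound[of UNIV f "\<lambda>x. frechet_derivative f (at x)"])
    fix z
    show "onorm (frechet_derivative f (at z)) \<le> ?L"
    proof (rule onorm_le)
      fix v
      have "norm (frechet_derivative f (at z) v) \<le> (\<Sum>j\<in>UNIV. \<bar>v $ j\<bar> * norm (D_fun j f z))"
        unfolding frechet_derivative_D_fun[OF test_smooth[OF assms]]
        using norm_sum[of "\<lambda>j. of_real (v $ j) * D_fun j f z" UNIV] by (simp add: norm_mult)
      also have "\<dots> \<le> (\<Sum>j\<in>UNIV. norm v * B j)"
        using B by (intro sum_mono mult_mono component_le_norm_cart) auto
      finally show "norm (frechet_derivative f (at z) v) \<le> ?L * norm v"
        by (simp add: sum_distrib_left mult.commute)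
    qed
  qed (auto intro: smooth_has_derivative[OF test_smooth[OF assms]])
  moreover have "?L \<ge> 0" using B(1) by (intro sum_nonneg) (auto intro: less_imp_le)
  ultimately show ?thesis by (rule that[rotated])
qed

text \<open>A quadratic remainder that is uniform in the base point permits differentiation under an integral without any
further limiting argument.\<close>

lemma test_taylor:
  assumes "f \<in> test_functions"
  obtains C where "C \<ge> 0" "\<And>x v. norm (f (x + v) - f x - frechet_derivative f (at x) v) \<le> C * (norm v)\<^sup>2"
proof -
  have "\<exists>L\<ge>0. \<forall>x y. norm (D_fun j f x - D_fun j f y) \<le> L * norm (x - y)" for j
    by (rule test_lipschitz[OF D_fun_test[OF assms], of j]) blast
  then obtain L where L: "\<And>j. L j \<ge> 0" "\<And>j x y. norm (D_fun j f x - D_fun j f y) \<le> L j * norm (x - y)" by metis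
  let ?C = "\<Sum>j\<in>UNIV. L j"
  let ?d = "\<lambda>x. frechet_derivative f (at x)"
  have C: "?C \<ge> 0" using L(1) by (intro sum_nonneg) auto
  have "norm (f (x + v) - f x - ?d x v) \<le> ?C * (norm v)\<^sup>2" for x v
  proof -
    have lin: "bounded_linear (?d x)"
      using smooth_has_derivative[OF test_smooth[OF assms]] has_derivative_bounded_linear by blast
    have "norm ((f (x + v) - ?d x (x + v)) - (f x - ?d x x)) \<le> (?C * norm v) * norm (x + v - x)"
    proof (rule differentiable_bound[of "cball x (norm v)" "\<lambda>y. f y - ?d x y" "\<lambda>y w. ?d y w - ?d x w"])
      fix y assume y: "y \<in> cball x (norm v)"
      show "((\<lambda>y. f y - ?d x y) has_derivative (\<lambda>w. ?d y w - ?d x w)) (at y within cball x (norm v))"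
        by (intro has_derivative_diff has_derivative_at_withinI[OF smooth_has_derivative[OF test_smooth[OF assms]]]
            bounded_linear_imp_has_derivative[OF lin])
      show "onorm (\<lambda>w. ?d y w - ?d x w) \<le> ?C * norm v"
      proof (rule onorm_le)
        fix w
        have "norm (?d y w - ?d x w) = norm (\<Sum>j\<in>UNIV. of_real (w $ j) * (D_fun j f y - D_fun j f x))"
          unfolding frechet_derivative_D_fun[OF test_smooth[OF assms]]
          by (simp add: right_diff_distrib[symmetric] norm_mult sum_subtractf[symmetric] del: right_diff_distrib')
        also have "\<dots> \<le> (\<Sum>j\<in>UNIV. \<bar>w $ j\<bar> * norm (D_fun j f y - D_fun j f x))"
          by (intro order_trans[OF norm_sum]) (simp add: norm_mult)
        also have "\<dots> \<le> (\<Sum>j\<in>UNIV. norm w * (L j * norm v))"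
        proof (intro sum_mono mult_mono component_le_norm_cart)
          fix j
          have "norm (y - x) \<le> norm v" using y by (simp add: dist_norm norm_minus_commute)
          then show "norm (D_fun j f y - D_fun j f x) \<le> L j * norm v"
            using L(2)[of j y x] L(1)[of j] by (meson mult_left_mono order_trans)
        qed auto
        finally show "norm (?d y w - ?d x w) \<le> ?C * norm v * norm w"
          by (simp add: sum_distrib_left sum_distrib_right mult_ac)
      qed
    qed (auto simp: dist_norm)
    moreover have "?d x (x + v) = ?d x x + ?d x v" using lin by (simp add: bounded_linear.linear linear_add)
    ultimately show ?thesis by (simp add: power2_eq_square algebra_simps)
  qed
  then show ?thesis using that C by blast
qed

definition conv :: "('n::finite) cfun \<Rightarrow> 'n cfun \<Rightarrow> 'n cfun" where
  "conv w f z = (LINT y|lborel. w y * f (z - y))"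

lemma test_measurable: "f \<in> test_functions \<Longrightarrow> f \<in> borel_measurable borel"
  by (intro borel_measurable_continuous_onI smooth_continuous test_smooth)

lemma conv_integrable:
  assumes "integrable lborel w" "f \<in> test_functions"
  shows "integrable lborel (\<lambda>y. w y * f (z - y))"
proof -
  obtain B where "\<And>x. norm (f x) \<le> B" using test_bounded[OF assms(2)] by metis
  then show ?thesis
    using test_measurable[OF assms(2)] by (intro integrable_mult_bounded[OF assms(1), where B=B]) auto
qed

text \<open>The uniform Taylor estimate for \<open>f\<close> is integrated against \<open>w\<close>.\<close>

lemma conv_has_derivative:
  assumes w: "integrable lborel w" and f: "f \<in> test_functions"
  shows "(conv w f has_derivative (\<lambda>v. \<i> * (\<Sum>j\<in>UNIV. of_real (v $ j) * conv w (D_fun j f) z))) (at z)"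
proof -
  obtain C where C: "C \<ge> 0" "\<And>x v. norm (f (x + v) - f x - frechet_derivative f (at x) v) \<le> C * (norm v)\<^sup>2"
    using test_taylor[OF f] by blast
  define K where "K = (LINT y|lborel. norm (w y)) * C"
  let ?G = "\<lambda>v. \<i> * (\<Sum>j\<in>UNIV. of_real (v $ j) * conv w (D_fun j f) z)"
  have D: "D_fun j f \<in> test_functions" for j using test_foldr_D_fun[OF f, of "[j]"] by simp
  note ints = conv_integrable[OF w f] conv_integrable[OF w D]
  have fd: "w y * frechet_derivative f (at (z - y)) v = \<i> * (\<Sum>j\<in>UNIV. of_real (v $ j) * (w y * D_fun j f (z - y)))" for y v
    by (simp add: frechet_derivative_D_fun[OF test_smooth[OF f]] sum_distrib_left mult_ac)
  have int_fd: "integrable lborel (\<lambda>y. w y * frechet_derivative f (at (z - y)) v)" for v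
    unfolding fd using ints by (intro integrable_mult_right Bochner_Integration.integrable_sum) auto
  have G: "?G v = (LINT y|lborel. w y * frechet_derivative f (at (z - y)) v)" for v
    unfolding fd conv_def using ints by (simp add: Bochner_Integration.integral_sum)
  have est: "norm (conv w f (z + v) - conv w f z - ?G v) \<le> K * (norm v)\<^sup>2" for v
  proof -
    have "conv w f (z + v) - conv w f z - ?G v =
        (LINT y|lborel. w y * (f (z - y + v) - f (z - y) - frechet_derivative f (at (z - y)) v))"
    proof -
      have "conv w f (z + v) - conv w f z - ?G v = (LINT y|lborel. w y * f (z + v - y) - w y * f (z - y) - w y * frechet_derivative f (at (z - y)) v)"
        unfolding G unfolding conv_def using ints int_fd by simp
      then show ?thesis by (simp add: algebra_simps)
    qed
    also have "norm \<dots> \<le> (LINT y|lborel. norm (w y) * (C * (norm v)\<^sup>2))"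
    proof (rule Bochner_Integration.integral_norm_bound_integral)
      have "integrable lborel (\<lambda>y. w y * f (z + v - y) - w y * f (z - y) - w y * frechet_derivative f (at (z - y)) v)"
        using ints int_fd by simp
      then show "integrable lborel (\<lambda>y. w y * (f (z - y + v) - f (z - y) - frechet_derivative f (at (z - y)) v))"
        by (simp add: algebra_simps)
    qed (use w C(2) in \<open>auto simp: norm_mult intro!: mult_left_mono\<close>)
    finally show ?thesis by (simp add: K_def)
  qed
  have "bounded_linear ?G"
    by (intro bounded_linear_const_mult bounded_linear_sum bounded_linear_mult_const bounded_linear_compose[OF bounded_linear_of_real]
        bounded_linear_vec_nth)
  moreover have "((\<lambda>y. norm (conv w f y - conv w f z - ?G (y - z)) / norm (y - z)) \<longlongrightarrow> 0) (at z)"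
  proof (rule tendsto_sandwich[of "\<lambda>_. 0" _ _ "\<lambda>y. K * norm (y - z)"])
    show "\<forall>\<^sub>F y in at z. norm (conv w f y - conv w f z - ?G (y - z)) / norm (y - z) \<le> K * norm (y - z)"
      using est[of "y - z" for y] by (auto simp: eventually_at_filter divide_simps power2_eq_square mult_ac)
    show "((\<lambda>y. K * norm (y - z)) \<longlongrightarrow> 0) (at z)"
      by (auto intro!: tendsto_eq_intros)
  qed auto
  ultimately show ?thesis by (simp add: has_derivative_iff_norm)
qed

lemma D_fun_conv:
  assumes "integrable lborel w" "f \<in> test_functions"
  shows "D_fun j (conv w f) = conv w (D_fun j f)"
proof
  fix z
  have "(\<Sum>i\<in>UNIV. of_real (axis j 1 $ i) * conv w (D_fun i f) z) = (\<Sum>i\<in>UNIV. if i = j then conv w (D_fun i f) z else 0)"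
    by (intro sum.cong) (auto simp: axis_def)
  then show "D_fun j (conv w f) z = conv w (D_fun j f) z"
    by (subst D_fun_eq[OF conv_has_derivative[OF assms]]) simp
qed

lemma conv_smooth:
  assumes w: "integrable lborel w" and f: "f \<in> test_functions"
  shows "conv w f \<in> smooth_functions"
proof (rule smooth_functions_coinduct[of _ "conv w ` test_functions"])
  fix g x assume "g \<in> conv w ` test_functions"
  then show "g differentiable (at x)"
    using conv_has_derivative[OF w] by (auto simp: differentiable_def)
next
  fix g j assume "g \<in> conv w ` test_functions"
  then show "D_fun j g \<in> conv w ` test_functions"
    by (auto simp: D_fun_conv[OF w] intro!: imageI D_fun_test)
qed (use f in auto)

lemma foldr_D_fun_conv:
  assumes w: "integrable lborel w" and f: "f \<in> test_functions"
  shows "foldr D_fun js (conv w f) = conv w (foldr D_fun js f)"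
  by (induction js) (simp_all add: D_fun_conv[OF w test_foldr_D_fun[OF f]])

text \<open>The indicator of an intermediate ball, smoothed by a normalized bump of radius half the gap.\<close>

lemma cutoff_ball:
  fixes c :: "real^'n::finite"
  assumes "0 < r" "r < R"
  obtains \<rho> where "\<rho> \<in> test_functions" "\<And>z. norm (z - c) \<le> r \<Longrightarrow> \<rho> z = 1" "\<And>z. norm (z - c) \<ge> R \<Longrightarrow> \<rho> z = 0"
proof -
  define d where "d = (R - r) / 2"
  have d: "d > 0" using assms by (simp add: d_def)
  define I where "I = (LINT x|lborel. bump d (x::real^'n))"
  have I: "I > 0" unfolding I_def by (rule integral_bump_pos[OF d])
  have [measurable]: "bump d \<in> borel_measurable (borel :: (real^'n) measure)"
    using borel_measurable_integrable[OF integrable_bump[OF d]] by simp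
  define w where "w = (\<lambda>y. complex_of_real (indicator (ball c (r + d)) y / I))"
  have w: "integrable lborel w"
    unfolding w_def using emeasure_lborel_ball_finite[of c "r + d"]
    by (intro integrable_of_real integrable_divide integrable_real_indicator) auto
  let ?\<rho> = "conv w (\<lambda>x. of_real (bump d x))"
  have zero: "?\<rho> z = 0" if z: "norm (z - c) \<ge> R" for z
  proof -
    have "w y * of_real (bump d (z - y)) = 0" for y
    proof (cases "y \<in> ball c (r + d)")
      case True
      then have "norm (y - c) < r + d" by (simp add: dist_norm norm_minus_commute)
      then have "norm (z - y) \<ge> d" using z norm_triangle_ineq[of "z - y" "y - c"] by (simp add: d_def field_simps)
      then show ?thesis using bump_eq_0[OF d, of "z - y"] by simp
    qed (simp add: w_def)
    then show ?thesis unfolding conv_def by (simp only:) simp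
  qed
  have one: "?\<rho> z = 1" if z: "norm (z - c) \<le> r" for z
  proof -
    have "w y * of_real (bump d (z - y)) = of_real (bump d (z - y) / I)" for y
    proof (cases "y \<in> ball c (r + d)")
      case False
      then have "norm (y - c) \<ge> r + d" by (simp add: dist_norm norm_minus_commute)
      then have "norm (z - y) \<ge> d" using z norm_triangle_ineq[of "y - z" "z - c"] by (simp add: norm_minus_commute)
      then show ?thesis using bump_eq_0[OF d, of "z - y"] by simp
    qed (simp add: w_def)
    then have "?\<rho> z = (LINT y|lborel. of_real (bump d (z - y) / I))" by (simp add: conv_def)
    also have "\<dots> = (LINT y|lborel. of_real (bump d (z + (-1) *\<^sub>R y) / I))" by simp
    also have "\<dots> = (LINT y|lborel. of_real (bump d (y::real^'n) / I))"
      by (subst (2) integral_lborel_affine[where c="-1" and t=z])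
        simp_all
    also have "\<dots> = of_real (I / I)" unfolding integral_complex_of_real by (simp add: I_def)
    finally show ?thesis using I by simp
  qed
  show ?thesis
    by (rule that[of ?\<rho>])
      (use zero one conv_smooth[OF w bump_test[OF d]] in \<open>auto intro!: test_functionsI[of _ "cball c R"] simp: dist_norm norm_minus_commute not_le\<close>)
qed

section \<open>Multi-indices as words\<close>

text \<open>The derivative with multi-index \<open>\<alpha>\<close> is the composition along the list that contains each coordinate \<open>j\<close>
exactly \<open>\<alpha>\<^sub>j\<close> times.  Lists allow induction on single derivatives.\<close>

definition word :: "('n::finite \<Rightarrow>\<^sub>0 nat) \<Rightarrow> 'n list" where
  "word \<alpha> = concat (map (\<lambda>j. replicate (Poly_Mapping.lookup \<alpha> j) j) coords)"

lemma coords: "distinct (coords :: 'n::finite list)" "set (coords :: 'n list) = UNIV"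
proof -
  have "\<exists>js::'n list. distinct js \<and> set js = UNIV"
    using finite_distinct_list[of "UNIV :: 'n set"] by auto
  from someI_ex[OF this] show "distinct (coords :: 'n::finite list)" "set (coords :: 'n list) = UNIV"
    unfolding coords_def by auto
qed

lemma multi_power_word: "multi_power T \<alpha> a = foldr T (word \<alpha>) a"
proof -
  have "foldr (\<lambda>j g. (T j ^^ Poly_Mapping.lookup \<alpha> j) \<circ> g) js id a =
      foldr T (concat (map (\<lambda>j. replicate (Poly_Mapping.lookup \<alpha> j) j) js)) a" for js
    by (induction js) simp_all
  then show ?thesis by (simp add: multi_power_def word_def)
qed

lemma sum_list_coords: "(\<Sum>j\<leftarrow>coords. f j) = (\<Sum>j\<in>UNIV. f (j::'n::finite))"
  by (simp add: sum_list_distinct_conv_sum_set coords)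

lemma length_word: "length (word \<alpha>) = multi_degree \<alpha>"
  by (simp add: word_def length_concat comp_def sum_list_coords multi_degree_def)

section \<open>Distributions and convolutions\<close>

lemma distributions_add:
  "u \<in> distributions \<Longrightarrow> f \<in> test_functions \<Longrightarrow> g \<in> test_functions \<Longrightarrow> u (\<lambda>x. f x + g x) = u f + u g"
  by (simp add: distributions_def clinear_on_def)

lemma distributions_cmult:
  "u \<in> distributions \<Longrightarrow> f \<in> test_functions \<Longrightarrow> u (\<lambda>x. c * f x) = c * u f"
  by (simp add: distributions_def clinear_on_def)

lemma distributions_zero: "u \<in> distributions \<Longrightarrow> u (\<lambda>x. 0) = 0"
  using distributions_cmult[OF _ test_zero, of u 0] by simp

lemma test_diff: "f \<in> test_functions \<Longrightarrow> g \<in> test_functions \<Longrightarrow> (\<lambda>x. f x - g x) \<in> test_functions"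
  using test_add[OF _ test_cmult[of g "-1"], of f] by simp

lemma distributions_diff:
  assumes "u \<in> distributions" "f \<in> test_functions" "g \<in> test_functions"
  shows "u (\<lambda>x. f x - g x) = u f - u g"
  using distributions_add[OF assms(1,2) test_cmult[OF assms(3), of "-1"]] distributions_cmult[OF assms(1,3), of "-1"]
  by simp

text \<open>The seminorm estimate in a form that avoids suprema: \<open>M\<close> bounds all derivatives of order at most \<open>N\<close>.\<close>

lemma distributions_bound:
  fixes u :: "('n::finite) functional"
  assumes u: "u \<in> distributions" and K: "compact K"
  obtains C N where "C \<ge> 0"
    "\<And>\<phi> M. \<phi> \<in> test_functions \<Longrightarrow> fun_support \<phi> \<subseteq> K \<Longrightarrow>
      (\<And>ks x. length ks \<le> N \<Longrightarrow> norm (foldr D_fun ks \<phi> x) \<le> M) \<Longrightarrow> norm (u \<phi>) \<le> C * M"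
proof -
  have "\<forall>K. compact K \<longrightarrow> (\<exists>C N. \<forall>\<phi>\<in>test_functions. fun_support \<phi> \<subseteq> K \<longrightarrow>
        norm (u \<phi>) \<le> C * (\<Sum>\<alpha> | multi_degree \<alpha> \<le> N. SUP x. norm (multi_power D_fun \<alpha> \<phi> x)))"
    using u unfolding distributions_def by simp
  from this[THEN spec, of K, THEN mp, OF K] obtain C N where *: "\<forall>\<phi>\<in>test_functions. fun_support \<phi> \<subseteq> K \<longrightarrow>
        norm (u \<phi>) \<le> C * (\<Sum>\<alpha> | multi_degree \<alpha> \<le> N. SUP x. norm (multi_power D_fun \<alpha> \<phi> x))"
    by (elim exE)
  note CN = *[THEN bspec, THEN mp]
  let ?A = "{\<alpha> :: 'n \<Rightarrow>\<^sub>0 nat. multi_degree \<alpha> \<le> N}"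
  have "norm (u \<phi>) \<le> (\<bar>C\<bar> * card ?A) * M"
    if \<phi>: "\<phi> \<in> test_functions" "fun_support \<phi> \<subseteq> K" and M: "\<And>ks x. length ks \<le> N \<Longrightarrow> norm (foldr D_fun ks \<phi> x) \<le> M" for \<phi> M
  proof -
    let ?s = "\<lambda>\<alpha>. SUP x. norm (multi_power D_fun \<alpha> \<phi> x)"
    have le: "norm (multi_power D_fun \<alpha> \<phi> x) \<le> M" if "\<alpha> \<in> ?A" for \<alpha> x
      unfolding multi_power_word using that by (intro M) (simp add: length_word)
    have "?s \<alpha> \<le> M" if "\<alpha> \<in> ?A" for \<alpha>
      using le[OF that] by (intro cSUP_least) auto
    then have up: "sum ?s ?A \<le> card ?A * M" by (rule sum_bounded_above)
    have "0 \<le> ?s \<alpha>" if "\<alpha> \<in> ?A" for \<alpha>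
    proof -
      have "bdd_above (range (\<lambda>x. norm (multi_power D_fun \<alpha> \<phi> x)))"
        using le[OF that] by (intro bdd_aboveI[of _ M]) auto
      from cSUP_upper[OF UNIV_I this, of 0] show ?thesis by (meson norm_ge_zero order_trans)
    qed
    then have nn: "sum ?s ?A \<ge> 0" by (intro sum_nonneg) auto
    have "norm (u \<phi>) \<le> C * sum ?s ?A" by (rule CN[OF \<phi>])
    also have "\<dots> \<le> \<bar>C\<bar> * sum ?s ?A" using nn by (intro mult_right_mono) auto
    also have "\<dots> \<le> \<bar>C\<bar> * (card ?A * M)" using up by (intro mult_left_mono) auto
    finally show ?thesis by (simp add: mult.assoc)
  qed
  then show ?thesis by (intro that[of "\<bar>C\<bar> * card ?A" N]) auto
qed

text \<open>Multiplication by \<open>\<rho>\<close> is continuous for the seminorms.  Peeling off the innermost derivative keeps the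
induction hypothesis applicable both to \<open>\<rho>\<close> and to its derivative.\<close>

lemma leibniz_bound:
  fixes \<rho> :: "('n::finite) cfun"
  assumes "\<rho> \<in> test_functions"
  shows "\<exists>C\<ge>0. \<forall>g\<in>smooth_functions. \<forall>M. (\<forall>ks x. length ks \<le> length js \<longrightarrow> norm (foldr D_fun ks g x) \<le> M) \<longrightarrow>
      (\<forall>x. norm (foldr D_fun js (\<lambda>z. \<rho> z * g z) x) \<le> C * M)"
  using assms
proof (induction js arbitrary: \<rho> rule: rev_induct)
  case Nil
  obtain B where B: "B > 0" "\<And>x. norm (\<rho> x) \<le> B" using test_bounded[OF Nil] by blast
  have "norm (\<rho> x * g x) \<le> B * M" if "\<forall>ks x. length ks \<le> 0 \<longrightarrow> norm (foldr D_fun ks g x) \<le> M" for g M x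
    unfolding norm_mult using that[rule_format, of "[]" x] B by (intro mult_mono) (auto intro: less_imp_le)
  then show ?case using B(1) by (intro exI[of _ B]) auto
next
  case (snoc j js)
  obtain C1 where C1: "C1 \<ge> 0" "\<And>g M x. g \<in> smooth_functions \<Longrightarrow> (\<And>ks x. length ks \<le> length js \<Longrightarrow> norm (foldr D_fun ks g x) \<le> M) \<Longrightarrow>
      norm (foldr D_fun js (\<lambda>z. \<rho> z * g z) x) \<le> C1 * M"
    using snoc.IH[OF snoc.prems] by blast
  obtain C2 where C2: "C2 \<ge> 0" "\<And>g M x. g \<in> smooth_functions \<Longrightarrow> (\<And>ks x. length ks \<le> length js \<Longrightarrow> norm (foldr D_fun ks g x) \<le> M) \<Longrightarrow>
      norm (foldr D_fun js (\<lambda>z. D_fun j \<rho> z * g z) x) \<le> C2 * M"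
    using snoc.IH[OF D_fun_test[OF snoc.prems, of j]] by blast
  have "norm (foldr D_fun (js @ [j]) (\<lambda>z. \<rho> z * g z) x) \<le> (C1 + C2) * M"
    if g: "g \<in> smooth_functions" and M: "\<And>ks x. length ks \<le> length (js @ [j]) \<Longrightarrow> norm (foldr D_fun ks g x) \<le> M" for g M x
  proof -
    have \<rho>: "\<rho> \<in> smooth_functions" "D_fun j \<rho> \<in> smooth_functions"
      using snoc.prems test_smooth smooth_functions_D_fun by auto
    have "D_fun j (\<lambda>z. \<rho> z * g z) = (\<lambda>z. \<rho> z * D_fun j g z + D_fun j \<rho> z * g z)"
      using g \<rho> by (intro ext D_fun_mult) (auto intro: smooth_functions_differentiable)
    then have "foldr D_fun (js @ [j]) (\<lambda>z. \<rho> z * g z) x =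
        foldr D_fun js (\<lambda>z. \<rho> z * D_fun j g z) x + foldr D_fun js (\<lambda>z. D_fun j \<rho> z * g z) x"
      using g \<rho> by (simp add: foldr_D_fun_add smooth_mult smooth_functions_D_fun)
    also have "norm \<dots> \<le> C1 * M + C2 * M"
    proof (intro order_trans[OF norm_triangle_ineq] add_mono)
      show "norm (foldr D_fun js (\<lambda>z. \<rho> z * D_fun j g z) x) \<le> C1 * M"
      proof (rule C1(2)[OF smooth_functions_D_fun[OF g]])
        fix ks :: "'n list" and x assume "length ks \<le> length js"
        then show "norm (foldr D_fun ks (D_fun j g) x) \<le> M" using M[of "ks @ [j]" x] by simp
      qed
      show "norm (foldr D_fun js (\<lambda>z. D_fun j \<rho> z * g z) x) \<le> C2 * M"
        by (rule C2(2)[OF g]) (rule M, simp)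
    qed
    finally show ?thesis by (simp add: distrib_right)
  qed
  then show ?case using C1(1) C2(1) by (intro exI[of _ "C1 + C2"]) auto
qed

lemma finite_words: "finite {js :: 'n::finite list. length js \<le> N}"
  using finite_lists_length_le[of "UNIV :: 'n set" N] by simp

lemma distributions_localized_bound:
  fixes u :: "('n::finite) functional"
  assumes u: "u \<in> distributions" and \<rho>: "\<rho> \<in> test_functions"
  obtains C N where "C \<ge> 0"
    "\<And>g M. g \<in> smooth_functions \<Longrightarrow> (\<And>ks x. length ks \<le> N \<Longrightarrow> norm (foldr D_fun ks g x) \<le> M) \<Longrightarrow>
      norm (u (\<lambda>z. \<rho> z * g z)) \<le> C * M"
proof -
  obtain C0 N where C0: "C0 \<ge> 0" "\<And>\<phi> M. \<phi> \<in> test_functions \<Longrightarrow> fun_support \<phi> \<subseteq> fun_support \<rho> \<Longrightarrow>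
      (\<And>ks x. length ks \<le> N \<Longrightarrow> norm (foldr D_fun ks \<phi> x) \<le> M) \<Longrightarrow> norm (u \<phi>) \<le> C0 * M"
    by (fact distributions_bound[OF u test_compact[OF \<rho>]])
  obtain C1 where C1: "\<And>js. C1 js \<ge> 0" "\<And>js g M x. g \<in> smooth_functions \<Longrightarrow> (\<And>ks x. length ks \<le> length js \<Longrightarrow> norm (foldr D_fun ks g x) \<le> M) \<Longrightarrow>
      norm (foldr D_fun js (\<lambda>z. \<rho> z * g z) x) \<le> C1 js * M"
    using leibniz_bound[OF \<rho>] by metis
  define C where "C = (\<Sum>js | length js \<le> N. C1 js)"
  have C: "C1 js \<le> C" if "length js \<le> N" for js
    unfolding C_def using that C1(1) by (intro member_le_sum finite_words) auto
  have C_nn: "C \<ge> 0" unfolding C_def using C1(1) by (intro sum_nonneg) auto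
  have "norm (u (\<lambda>z. \<rho> z * g z)) \<le> (C0 * C) * M"
    if g: "g \<in> smooth_functions" and M: "\<And>ks x. length ks \<le> N \<Longrightarrow> norm (foldr D_fun ks g x) \<le> M" for g M
    unfolding mult.assoc
  proof (rule C0(2)[OF test_mult[OF \<rho> g]])
    show "fun_support (\<lambda>x. \<rho> x * g x) \<subseteq> fun_support \<rho>"
      by (intro fun_support_subset closed_fun_support) (simp add: not_in_fun_support)
    fix ks :: "'n list" and x assume ks: "length ks \<le> N"
    have M0: "M \<ge> 0" using M[of "[]" x] by (auto intro: order_trans[OF norm_ge_zero])
    have "norm (foldr D_fun ks (\<lambda>z. \<rho> z * g z) x) \<le> C1 ks * M"
      by (rule C1(2)[OF g]) (use M ks in auto)
    also have "\<dots> \<le> C * M" using C[OF ks] M0 by (rule mult_right_mono)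
    finally show "norm (foldr D_fun ks (\<lambda>z. \<rho> z * g z) x) \<le> C * M" .
  qed
  then show ?thesis using C0(1) C_nn by (intro that[of "C0 * C" N]) auto
qed

lemma test_uniform_lipschitz:
  assumes "f \<in> test_functions"
  obtains L where "L \<ge> 0" "\<And>ks x y. length ks \<le> N \<Longrightarrow> norm (foldr D_fun ks f x - foldr D_fun ks f y) \<le> L * norm (x - y)"
proof -
  have "\<exists>L\<ge>0. \<forall>x y. norm (foldr D_fun ks f x - foldr D_fun ks f y) \<le> L * norm (x - y)" for ks
    by (rule test_lipschitz[OF test_foldr_D_fun[OF assms], of ks]) blast
  then obtain L where L: "\<And>ks. L ks \<ge> 0" "\<And>ks x y. norm (foldr D_fun ks f x - foldr D_fun ks f y) \<le> L ks * norm (x - y)"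
    by metis
  define L' where "L' = (\<Sum>js | length js \<le> N. L js)"
  have "norm (foldr D_fun ks f x - foldr D_fun ks f y) \<le> L' * norm (x - y)" if "length ks \<le> N" for ks x y
  proof -
    have "L ks \<le> L'" unfolding L'_def using that L(1) by (intro member_le_sum finite_words) auto
    then show ?thesis using L(2)[of ks x y] mult_right_mono[of "L ks" L' "norm (x - y)"] by simp
  qed
  moreover have "L' \<ge> 0" unfolding L'_def using L(1) by (intro sum_nonneg) auto
  ultimately show ?thesis using that by blast
qed

text \<open>The translates of \<open>\<eta>\<close> depend on the translation vector in a Lipschitz way, in every seminorm.  Hence the pairing
is Lipschitz, and a convolution with \<open>w\<close> concentrated within \<open>\<delta>\<close> of \<open>t\<close> acts like the translate by \<open>t\<close> up to
an error of order \<open>\<delta>\<close>.\<close>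

lemma distribution_translates_lipschitz:
  fixes u :: "('n::finite) functional"
  assumes u: "u \<in> distributions" and \<rho>: "\<rho> \<in> test_functions" and \<eta>: "\<eta> \<in> test_functions"
  obtains A where "A \<ge> 0"
    "\<And>x y. norm (u (\<lambda>z. \<rho> z * \<eta> (z - x)) - u (\<lambda>z. \<rho> z * \<eta> (z - y))) \<le> A * norm (x - y)"
    "\<And>w t \<delta>. integrable lborel w \<Longrightarrow> (\<And>y. norm (y - t) > \<delta> \<Longrightarrow> w y = 0) \<Longrightarrow> \<delta> \<ge> 0 \<Longrightarrow>
      norm (u (\<lambda>z. \<rho> z * conv w \<eta> z) - integral\<^sup>L lborel w * u (\<lambda>z. \<rho> z * \<eta> (z - t)))
        \<le> A * \<delta> * (LINT y|lborel. norm (w y))"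
proof -
  obtain C N where C: "C \<ge> 0"
    "\<And>g M. g \<in> smooth_functions \<Longrightarrow> (\<And>ks x. length ks \<le> N \<Longrightarrow> norm (foldr D_fun ks g x) \<le> M) \<Longrightarrow>
      norm (u (\<lambda>z. \<rho> z * g z)) \<le> C * M"
    by (fact distributions_localized_bound[OF u \<rho>])
  obtain L where L: "L \<ge> 0" "\<And>ks x y. length ks \<le> N \<Longrightarrow> norm (foldr D_fun ks \<eta> x - foldr D_fun ks \<eta> y) \<le> L * norm (x - y)"
    by (fact test_uniform_lipschitz[OF \<eta>])
  have \<eta>s: "\<eta> \<in> smooth_functions" using \<eta> by (rule test_smooth)
  note T = smooth_translate[OF \<eta>s]
  have "norm (u (\<lambda>z. \<rho> z * \<eta> (z - x)) - u (\<lambda>z. \<rho> z * \<eta> (z - y))) \<le> (C * L) * norm (x - y)" for x y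
  proof -
    have "u (\<lambda>z. \<rho> z * \<eta> (z - x)) - u (\<lambda>z. \<rho> z * \<eta> (z - y)) = u (\<lambda>z. \<rho> z * (\<eta> (z - x) - \<eta> (z - y)))"
      by (subst distributions_diff[OF u test_mult[OF \<rho> T] test_mult[OF \<rho> T], symmetric]) (simp add: right_diff_distrib)
    also have "norm \<dots> \<le> C * (L * norm (x - y))"
    proof (rule C(2)[OF smooth_diff[OF T T]])
      fix ks :: "'n list" and z assume "length ks \<le> N"
      then show "norm (foldr D_fun ks (\<lambda>z. \<eta> (z - x) - \<eta> (z - y)) z) \<le> L * norm (x - y)"
        using L(2)[of ks "z - x" "z - y"]
        by (simp add: foldr_D_fun_diff[OF T T] foldr_D_fun_translate[OF \<eta>s] norm_minus_commute)
    qed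
    finally show ?thesis by (simp add: mult.assoc)
  qed
  moreover have "norm (u (\<lambda>z. \<rho> z * conv w \<eta> z) - integral\<^sup>L lborel w * u (\<lambda>z. \<rho> z * \<eta> (z - t)))
        \<le> (C * L) * \<delta> * (LINT y|lborel. norm (w y))"
    if w: "integrable lborel w" and supp: "\<And>y. norm (y - t) > \<delta> \<Longrightarrow> w y = 0" and \<delta>: "\<delta> \<ge> 0" for w t \<delta>
  proof -
    let ?I = "integral\<^sup>L lborel w"
    let ?g = "\<lambda>z. conv w \<eta> z - ?I * \<eta> (z - t)"
    note sm = conv_smooth[OF w \<eta>] smooth_cmult[OF T]
    have "u (\<lambda>z. \<rho> z * conv w \<eta> z) - ?I * u (\<lambda>z. \<rho> z * \<eta> (z - t)) = u (\<lambda>z. \<rho> z * ?g z)"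
      using distributions_diff[OF u test_mult[OF \<rho> sm(1)] test_cmult[OF test_mult[OF \<rho> T]], of ?I t]
        distributions_cmult[OF u test_mult[OF \<rho> T], of ?I t]
      by (simp add: right_diff_distrib mult_ac)
    also have "norm \<dots> \<le> C * (L * \<delta> * (LINT y|lborel. norm (w y)))"
    proof (rule C(2)[OF smooth_diff[OF sm(1) sm(2)]])
      fix ks :: "'n list" and z assume ks: "length ks \<le> N"
      let ?h = "foldr D_fun ks \<eta>"
      have int: "integrable lborel (\<lambda>y. w y * ?h (z - y))"
        by (rule conv_integrable[OF w test_foldr_D_fun[OF \<eta>]])
      have "foldr D_fun ks ?g z = conv w ?h z - ?I * ?h (z - t)"
        by (simp add: foldr_D_fun_diff[OF sm(1) sm(2)] foldr_D_fun_cmult[OF T] foldr_D_fun_translate[OF \<eta>s]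
            foldr_D_fun_conv[OF w \<eta>])
      also have "\<dots> = (LINT y|lborel. w y * ?h (z - y) - w y * ?h (z - t))"
        unfolding conv_def using int w by simp
      also have "norm \<dots> \<le> (LINT y|lborel. norm (w y) * (L * \<delta>))"
      proof (rule Bochner_Integration.integral_norm_bound_integral)
        fix y
        show "norm (w y * ?h (z - y) - w y * ?h (z - t)) \<le> norm (w y) * (L * \<delta>)"
        proof (cases "w y = 0")
          case False
          then have "norm (y - t) \<le> \<delta>" using supp[of y] by force
          then have "L * norm (y - t) \<le> L * \<delta>" using L(1) by (rule mult_left_mono)
          then have "norm (?h (z - y) - ?h (z - t)) \<le> L * \<delta>"
            using L(2)[OF ks, of "z - y" "z - t"] by (simp add: norm_minus_commute)
          then show ?thesis
            by (simp add: norm_mult mult_left_mono flip: right_diff_distrib)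
        qed simp
      qed (use int w in auto)
      finally show "norm (foldr D_fun ks ?g z) \<le> L * \<delta> * (LINT y|lborel. norm (w y))"
        by (simp add: mult_ac)
    qed
    finally show ?thesis by (simp add: mult_ac)
  qed
  ultimately show ?thesis using C(1) L(1) by (intro that[of "C * L"]) auto
qed

text \<open>A distribution may be taken under the integral.  The difference \<open>\<Delta>\<close> of the two sides is additive in \<open>w\<close>, and
by the previous lemma it is at most \<open>2A\<delta>\<close> times the \<open>L\<^sup>1\<close> norm of \<open>w\<close> when \<open>w\<close> is concentrated in a ball of radius
\<open>\<delta>\<close>.  Cutting \<open>w\<close> into pieces supported in small balls keeps this estimate, since the norms add up.\<close>

lemma distribution_conv:
  fixes u :: "('n::finite) functional"
  assumes u: "u \<in> distributions" and \<rho>: "\<rho> \<in> test_functions" and \<eta>: "\<eta> \<in> test_functions"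
    and w: "integrable lborel w" and supp: "\<And>y. norm y > R \<Longrightarrow> w y = 0"
  shows "u (\<lambda>z. \<rho> z * conv w \<eta> z) = (LINT y|lborel. w y * u (\<lambda>z. \<rho> z * \<eta> (z - y)))"
proof -
  let ?v = "\<lambda>y. u (\<lambda>z. \<rho> z * \<eta> (z - y))"
  obtain A where A: "A \<ge> 0" "\<And>x y. norm (?v x - ?v y) \<le> A * norm (x - y)"
    "\<And>w t \<delta>. integrable lborel w \<Longrightarrow> (\<And>y. norm (y - t) > \<delta> \<Longrightarrow> w y = 0) \<Longrightarrow> \<delta> \<ge> 0 \<Longrightarrow>
      norm (u (\<lambda>z. \<rho> z * conv w \<eta> z) - integral\<^sup>L lborel w * ?v t) \<le> A * \<delta> * (LINT y|lborel. norm (w y))"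
    by (fact distribution_translates_lipschitz[OF u \<rho> \<eta>])
  have v_meas: "?v \<in> borel_measurable borel"
  proof (rule borel_measurable_continuous_onI)
    have "A-lipschitz_on UNIV ?v" using A by (intro lipschitz_onI) (auto simp: dist_norm)
    then show "continuous_on UNIV ?v" by (rule lipschitz_on_continuous_on)
  qed
  define \<Delta> where "\<Delta> = (\<lambda>w. u (\<lambda>z. \<rho> z * conv w \<eta> z) - (LINT y|lborel. w y * ?v y))"
  have int_v: "integrable lborel (\<lambda>y. w y * ?v y)"
    if w: "integrable lborel w" and supp: "\<And>y. norm (y - t) > \<delta> \<Longrightarrow> w y = 0" for w t \<delta>
  proof (rule integrable_mult_bounded[OF w, where B="norm (?v t) + A * \<delta>"])
    fix y assume "w y \<noteq> 0"
    then have "norm (y - t) \<le> \<delta>" using supp[of y] by force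
    then have "A * norm (y - t) \<le> A * \<delta>" using A(1) by (rule mult_left_mono)
    then show "norm (?v y) \<le> norm (?v t) + A * \<delta>"
      using A(2)[of y t] norm_triangle_ineq2[of "?v y" "?v t"] by linarith
  qed (use v_meas in auto)
  have local: "norm (\<Delta> w) \<le> 2 * A * \<delta> * (LINT y|lborel. norm (w y))"
    if w: "integrable lborel w" and supp: "\<And>y. norm (y - t) > \<delta> \<Longrightarrow> w y = 0" and \<delta>: "\<delta> \<ge> 0" for w t \<delta>
  proof -
    have "norm ((LINT y|lborel. w y * ?v y) - integral\<^sup>L lborel w * ?v t) = norm (LINT y|lborel. w y * ?v y - w y * ?v t)"
      using int_v[OF w supp] w by simp
    also have "\<dots> \<le> (LINT y|lborel. norm (w y) * (A * \<delta>))"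
    proof (rule Bochner_Integration.integral_norm_bound_integral)
      fix y
      show "norm (w y * ?v y - w y * ?v t) \<le> norm (w y) * (A * \<delta>)"
      proof (cases "w y = 0")
        case False
        then have "norm (y - t) \<le> \<delta>" using supp[of y] by force
        then have "A * norm (y - t) \<le> A * \<delta>" using A(1) by (rule mult_left_mono)
        then have "norm (?v y - ?v t) \<le> A * \<delta>" using A(2)[of y t] by simp
        then show ?thesis by (simp add: norm_mult mult_left_mono flip: right_diff_distrib)
      qed simp
    qed (use int_v[OF w supp] w in auto)
    also have "\<dots> = A * \<delta> * (LINT y|lborel. norm (w y))" by (simp add: mult_ac)
    finally have "norm ((LINT y|lborel. w y * ?v y) - integral\<^sup>L lborel w * ?v t) \<le> A * \<delta> * (LINT y|lborel. norm (w y))" .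
    moreover have "norm (u (\<lambda>z. \<rho> z * conv w \<eta> z) - integral\<^sup>L lborel w * ?v t) \<le> A * \<delta> * (LINT y|lborel. norm (w y))"
      by (rule A(3)[OF w supp \<delta>])
    ultimately show ?thesis
      unfolding \<Delta>_def using norm_triangle_ineq4[of "u (\<lambda>z. \<rho> z * conv w \<eta> z) - integral\<^sup>L lborel w * ?v t"
          "(LINT y|lborel. w y * ?v y) - integral\<^sup>L lborel w * ?v t"] by simp
  qed
  have cover: "norm (\<Delta> w) \<le> 2 * A * \<delta> * (LINT y|lborel. norm (w y))"
    if "finite T" "integrable lborel w" "\<And>y. y \<notin> (\<Union>t\<in>T. ball t \<delta>) \<Longrightarrow> w y = 0" "\<And>y. norm y > R \<Longrightarrow> w y = 0" "\<delta> > 0" for T w \<delta>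
    using that
  proof (induction T arbitrary: w rule: finite_induct)
    case empty
    then have "w = (\<lambda>y. 0)" by auto
    then show ?case by (simp add: \<Delta>_def conv_def distributions_zero[OF u])
  next
    case (insert t T)
    let ?w1 = "\<lambda>y. indicator (ball t \<delta>) y * w y" and ?w2 = "\<lambda>y. indicator (- ball t \<delta>) y * w y"
    have w_eq: "w y = ?w1 y + ?w2 y" for y by (auto simp: indicator_def)
    have i1: "integrable lborel ?w1"
      using integrable_mult_indicator[OF _ insert.prems(1), of "ball t \<delta>"] by (simp add: scaleR_conv_of_real of_real_indicator)
    have i2: "integrable lborel ?w2"
      using integrable_mult_indicator[OF _ insert.prems(1), of "- ball t \<delta>"] by (simp add: scaleR_conv_of_real of_real_indicator)
    have iv: "integrable lborel (\<lambda>y. ?w1 y * ?v y)" "integrable lborel (\<lambda>y. ?w2 y * ?v y)"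
      by (rule int_v[where t=0 and \<delta>=R], use i1 i2 insert.prems(3) in auto)+
    have conv_eq: "conv w \<eta> z = conv ?w1 \<eta> z + conv ?w2 \<eta> z" for z
    proof -
      have "conv w \<eta> z = (LINT y|lborel. ?w1 y * \<eta> (z - y) + ?w2 y * \<eta> (z - y))"
        unfolding conv_def by (subst w_eq) (simp add: distrib_right)
      then show ?thesis unfolding conv_def
        using conv_integrable[OF i1 \<eta>] conv_integrable[OF i2 \<eta>] by simp
    qed
    have "u (\<lambda>z. \<rho> z * conv w \<eta> z) = u (\<lambda>z. \<rho> z * conv ?w1 \<eta> z) + u (\<lambda>z. \<rho> z * conv ?w2 \<eta> z)"
      unfolding conv_eq distrib_left
      by (intro distributions_add[OF u] test_mult[OF \<rho>] conv_smooth[OF _ \<eta>] i1 i2)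
    moreover have "(LINT y|lborel. w y * ?v y) = (LINT y|lborel. ?w1 y * ?v y) + (LINT y|lborel. ?w2 y * ?v y)"
      by (subst Bochner_Integration.integral_add[OF iv, symmetric], subst w_eq) (simp add: distrib_right)
    ultimately have D: "\<Delta> w = \<Delta> ?w1 + \<Delta> ?w2" by (simp add: \<Delta>_def)
    have n1: "norm (\<Delta> ?w1) \<le> 2 * A * \<delta> * (LINT y|lborel. norm (?w1 y))"
      by (rule local[OF i1, of \<delta> t]) (use insert.prems in \<open>auto simp: indicator_def dist_norm norm_minus_commute\<close>)
    have n2: "norm (\<Delta> ?w2) \<le> 2 * A * \<delta> * (LINT y|lborel. norm (?w2 y))"
      by (rule insert.IH[OF i2]) (use insert.prems in \<open>auto simp: indicator_def\<close>)
    have "(LINT y|lborel. norm (w y)) = (LINT y|lborel. norm (?w1 y) + norm (?w2 y))"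
      by (intro Bochner_Integration.integral_cong refl) (auto simp: indicator_def)
    also have "\<dots> = (LINT y|lborel. norm (?w1 y)) + (LINT y|lborel. norm (?w2 y))"
      using i1 i2 by (intro Bochner_Integration.integral_add integrable_norm)
    finally show ?case using n1 n2 norm_triangle_ineq[of "\<Delta> ?w1" "\<Delta> ?w2"] unfolding D by (simp add: distrib_left)
  qed
  define I where "I = (LINT y|lborel. norm (w y))"
  have I: "I \<ge> 0" by (simp add: I_def)
  have "norm (\<Delta> w) \<le> 0"
  proof (rule field_le_epsilon)
    fix e :: real assume e: "e > 0"
    define \<delta> where "\<delta> = e / (2 * A * I + 1)"
    have pos: "2 * A * I + 1 > 0" using A(1) I by (intro add_nonneg_pos) auto
    then have \<delta>: "\<delta> > 0" using e by (simp add: \<delta>_def)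
    obtain T where T: "finite T" "cball (0::real^'n) R \<subseteq> (\<Union>t\<in>T. ball t \<delta>)"
      using compact_cball[of "0::real^'n" R] \<delta> unfolding compact_eq_totally_bounded by blast
    have "norm (\<Delta> w) \<le> 2 * A * \<delta> * I"
      unfolding I_def
    proof (rule cover[OF T(1) w])
      fix y assume "y \<notin> (\<Union>t\<in>T. ball t \<delta>)"
      then have "y \<notin> cball 0 R" using T(2) by blast
      then show "w y = 0" by (intro supp) simp
    qed (use supp \<delta> in auto)
    also have "\<dots> = e * ((2 * A * I) / (2 * A * I + 1))" by (simp add: \<delta>_def)
    also have "\<dots> \<le> e * 1" using e pos by (intro mult_left_mono) auto
    finally show "norm (\<Delta> w) \<le> 0 + e" by simp
  qed
  then show ?thesis by (simp add: \<Delta>_def)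
qed

section \<open>Supports and cutoffs\<close>

text \<open>In place of a partition of unity, one ball at a time is removed from the support: \<open>\<phi> = \<phi>\<rho> + \<phi>(1 - \<rho>)\<close>, where
\<open>\<rho>\<close> is a cutoff equal to 1 on the ball and supported in the ball of twice the radius.\<close>

lemma vanishes_on_finite_cover:
  fixes u :: "('n::finite) functional"
  assumes u: "u \<in> distributions" and "finite T"
    and r: "\<And>x. x \<in> T \<Longrightarrow> r x > 0 \<and> vanishes_on (ball x (2 * r x)) u"
  shows "\<phi> \<in> test_functions \<Longrightarrow> fun_support \<phi> \<subseteq> (\<Union>x\<in>T. ball x (r x)) \<Longrightarrow> u \<phi> = 0"
  using assms(2) r
proof (induction T arbitrary: \<phi> rule: finite_induct)
  case empty
  then have "\<phi> = (\<lambda>x. 0)" using not_in_fun_support[of _ \<phi>] by auto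
  then show ?case using distributions_zero[OF u] by simp
next
  case (insert a T)
  have a: "r a > 0" "vanishes_on (ball a (2 * r a)) u" using insert.prems(3)[of a] by auto
  obtain \<rho> where \<rho>: "\<rho> \<in> test_functions" "\<And>z. norm (z - a) \<le> r a \<Longrightarrow> \<rho> z = 1"
      "\<And>z. norm (z - a) \<ge> 3 / 2 * r a \<Longrightarrow> \<rho> z = 0"
    using cutoff_ball[of "r a" "3 / 2 * r a" a] a by auto
  have s: "\<rho> \<in> smooth_functions" "(\<lambda>z. 1 - \<rho> z) \<in> smooth_functions"
    using test_smooth[OF \<rho>(1)] smooth_diff[OF smooth_const] by auto
  have t: "(\<lambda>z. \<phi> z * \<rho> z) \<in> test_functions" "(\<lambda>z. \<phi> z * (1 - \<rho> z)) \<in> test_functions"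
    by (intro test_mult[OF insert.prems(1)] s)+
  have "u \<phi> = u (\<lambda>z. \<phi> z * \<rho> z + \<phi> z * (1 - \<rho> z))" by (simp add: algebra_simps)
  also have "\<dots> = u (\<lambda>z. \<phi> z * \<rho> z) + u (\<lambda>z. \<phi> z * (1 - \<rho> z))"
    by (rule distributions_add[OF u t])
  also have "u (\<lambda>z. \<phi> z * \<rho> z) = 0"
  proof -
    have "fun_support (\<lambda>z. \<phi> z * \<rho> z) \<subseteq> cball a (3 / 2 * r a)"
      by (intro fun_support_subset) (auto simp: dist_norm norm_minus_commute not_le intro!: \<rho>(3))
    also have "\<dots> \<subseteq> ball a (2 * r a)" using a by auto
    finally show ?thesis using a(2) t(1) by (simp add: vanishes_on_def)
  qed
  also have "u (\<lambda>z. \<phi> z * (1 - \<rho> z)) = 0"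
  proof (rule insert.IH[OF t(2)])
    have "fun_support (\<lambda>z. \<phi> z * (1 - \<rho> z)) \<subseteq> fun_support \<phi> - ball a (r a)"
    proof (rule fun_support_subset)
      show "closed (fun_support \<phi> - ball a (r a))" by (intro closed_Diff closed_fun_support) auto
      fix z assume "z \<notin> fun_support \<phi> - ball a (r a)"
      then consider "z \<notin> fun_support \<phi>" | "norm (z - a) \<le> r a" by (auto simp: dist_norm norm_minus_commute)
      then show "\<phi> z * (1 - \<rho> z) = 0"
      proof cases
        case 1 then show ?thesis by (simp add: not_in_fun_support)
      next
        case 2 then show ?thesis using \<rho>(2)[of z] by simp
      qed
    qed
    then show "fun_support (\<lambda>z. \<phi> z * (1 - \<rho> z)) \<subseteq> (\<Union>x\<in>T. ball x (r x))"
      using insert.prems(2) by blast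
  qed (use insert.prems in auto)
  finally show ?case by simp
qed

lemma vanishes_off_support:
  fixes u :: "('n::finite) functional"
  assumes u: "u \<in> distributions" and \<phi>: "\<phi> \<in> test_functions" and disj: "fun_support \<phi> \<inter> distr_support u = {}"
  shows "u \<phi> = 0"
proof -
  have "\<exists>r>0. vanishes_on (ball x (2 * r)) u" if x: "x \<in> fun_support \<phi>" for x
  proof -
    obtain W where W: "open W" "vanishes_on W u" "x \<in> W"
      using x disj by (auto simp: distr_support_def)
    then obtain e where "e > 0" "ball x e \<subseteq> W" by (meson open_contains_ball)
    then have "vanishes_on (ball x (2 * (e / 2))) u" using W(2) unfolding vanishes_on_def by auto
    then show ?thesis using \<open>e > 0\<close> by (intro exI[of _ "e / 2"]) auto
  qed
  then obtain r where r: "\<And>x. x \<in> fun_support \<phi> \<Longrightarrow> r x > 0 \<and> vanishes_on (ball x (2 * r x)) u" by metis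
  obtain T where T: "T \<subseteq> fun_support \<phi>" "finite T" "fun_support \<phi> \<subseteq> (\<Union>x\<in>T. ball x (r x))"
  proof (rule compactE_image[OF test_compact[OF \<phi>], of "fun_support \<phi>" "\<lambda>x. ball x (r x)"])
    show "fun_support \<phi> \<subseteq> (\<Union>x\<in>fun_support \<phi>. ball x (r x))" using r by force
  qed auto
  show ?thesis
    by (rule vanishes_on_finite_cover[OF u T(2) _ \<phi> T(3)]) (use r T(1) in auto)
qed

text \<open>The cutoff chosen in the definition of the pairing is only known through its defining property.  The third claim
holds because \<open>(1 - \<rho>)\<phi>\<close> is supported away from the support of \<open>u\<close>.\<close>

lemma pairing_cutoff:
  fixes u :: "('n::finite) functional"
  assumes u: "u \<in> compact_distributions"
  obtains \<rho> where "\<rho> \<in> test_functions" "\<And>\<psi>. pairing u \<psi> = u (\<lambda>x. \<rho> x * \<psi> x)"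
    "\<And>\<phi>. \<phi> \<in> test_functions \<Longrightarrow> u (\<lambda>x. \<rho> x * \<phi> x) = u \<phi>"
proof -
  have d: "u \<in> distributions" and K: "compact (distr_support u)" using u by (auto simp: compact_distributions_def)
  let ?P = "\<lambda>\<rho>. \<rho> \<in> test_functions \<and> (\<exists>W. open W \<and> distr_support u \<subseteq> W \<and> (\<forall>x\<in>W. \<rho> x = 1))"
  obtain r where r: "r > 0" "distr_support u \<subseteq> ball 0 r"
    using bounded_subset_ballD[OF compact_imp_bounded[OF K], of 0] by auto
  obtain \<rho>0 where "\<rho>0 \<in> test_functions" "\<And>z. norm (z - (0::real^'n)) \<le> r \<Longrightarrow> \<rho>0 z = 1"
      "\<And>z. norm (z - 0) \<ge> r + 1 \<Longrightarrow> \<rho>0 z = 0"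
    by (fact cutoff_ball[OF r(1) less_add_one])
  then have "?P \<rho>0" using r by (intro conjI exI[of _ "ball 0 r"]) auto
  then have P: "?P (SOME \<rho>. ?P \<rho>)" by (rule someI[of ?P])
  define \<rho> where "\<rho> = (SOME \<rho>. ?P \<rho>)"
  obtain W where W: "\<rho> \<in> test_functions" "open W" "distr_support u \<subseteq> W" "\<And>x. x \<in> W \<Longrightarrow> \<rho> x = 1"
    using P unfolding \<rho>_def[symmetric] by blast
  show ?thesis
  proof (rule that[OF W(1)])
    show "pairing u \<psi> = u (\<lambda>x. \<rho> x * \<psi> x)" for \<psi>
      by (simp add: pairing_def \<rho>_def Let_def)
    fix \<phi> :: "'n cfun" assume \<phi>: "\<phi> \<in> test_functions"
    have t: "(\<lambda>x. \<rho> x * \<phi> x) \<in> test_functions" by (rule test_mult[OF W(1) test_smooth[OF \<phi>]])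
    have "u (\<lambda>x. \<phi> x - \<rho> x * \<phi> x) = 0"
    proof (rule vanishes_off_support[OF d test_diff[OF \<phi> t]])
      have "fun_support (\<lambda>x. \<phi> x - \<rho> x * \<phi> x) \<subseteq> - W"
        using W(2,4) by (intro fun_support_subset) auto
      then show "fun_support (\<lambda>x. \<phi> x - \<rho> x * \<phi> x) \<inter> distr_support u = {}" using W(3) by blast
    qed
    then show "u (\<lambda>x. \<rho> x * \<phi> x) = u \<phi>" using distributions_diff[OF d \<phi> t] by simp
  qed
qed

section \<open>The transposed operator\<close>

text \<open>The operator \<open>P(-D)\<close>, the formal transpose of \<open>P(D)\<close>.  The derivatives are composed in reverse order because
each transposition reverses a composition.\<close>

definition poly_op :: "(('n::finite \<Rightarrow>\<^sub>0 nat) \<Rightarrow>\<^sub>0 complex) \<Rightarrow> 'n cfun \<Rightarrow> 'n cfun" where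
  "poly_op P \<phi> = (\<lambda>x. \<Sum>\<alpha>\<in>Poly_Mapping.keys P. (Poly_Mapping.lookup P \<alpha> * (-1) ^ multi_degree \<alpha>)
      * foldr D_fun (rev (word \<alpha>)) \<phi> x)"

lemma foldr_D_distr: "foldr D_distr js u \<phi> = (-1) ^ length js * u (foldr D_fun (rev js) \<phi>)"
  by (induction js arbitrary: \<phi>) (simp_all add: D_distr_def)

lemma poly_op_term_test: "\<phi> \<in> test_functions \<Longrightarrow> (\<lambda>x. c * foldr D_fun js \<phi> x) \<in> test_functions"
  by (intro test_cmult test_foldr_D_fun)

lemma poly_op_test: "\<phi> \<in> test_functions \<Longrightarrow> poly_op P \<phi> \<in> test_functions"
  unfolding poly_op_def by (intro test_sum poly_op_term_test) auto

lemma clinear_sum: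
  assumes u: "clinear_on test_functions u" and "finite A"
    and "\<And>a. a \<in> A \<Longrightarrow> f a \<in> test_functions"
  shows "u (\<lambda>x. \<Sum>a\<in>A. c a * f a x) = (\<Sum>a\<in>A. c a * u (f a))"
  using assms(2,3)
proof (induction A rule: finite_induct)
  case empty
  have "\<forall>\<phi>\<in>test_functions. \<forall>c. u (\<lambda>x. c * \<phi> x) = c * u \<phi>" using u unfolding clinear_on_def by blast
  from this[THEN bspec, OF test_zero, THEN spec, of 0] show ?case by simp
next
  case (insert a A)
  have "u (\<lambda>x. \<Sum>b\<in>insert a A. c b * f b x) = u (\<lambda>x. c a * f a x + (\<Sum>b\<in>A. c b * f b x))"
    using insert.hyps by simp
  also have "\<dots> = u (\<lambda>x. c a * f a x) + u (\<lambda>x. \<Sum>b\<in>A. c b * f b x)"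
  proof -
    have add: "\<forall>\<phi>\<in>test_functions. \<forall>\<psi>\<in>test_functions. u (\<lambda>x. \<phi> x + \<psi> x) = u \<phi> + u \<psi>"
      using u unfolding clinear_on_def by blast
    have t: "(\<lambda>x. c a * f a x) \<in> test_functions" "(\<lambda>x. \<Sum>b\<in>A. c b * f b x) \<in> test_functions"
      using insert by (auto intro!: test_cmult test_sum)
    show ?thesis by (rule add[THEN bspec, OF t(1), THEN bspec, OF t(2)])
  qed
  also have "u (\<lambda>x. c a * f a x) = c a * u (f a)"
  proof -
    have "\<forall>\<phi>\<in>test_functions. \<forall>c. u (\<lambda>x. c * \<phi> x) = c * u \<phi>" using u unfolding clinear_on_def by blast
    from this[THEN bspec, OF insert.prems, OF insertI1, THEN spec, of "c a"] show ?thesis .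
  qed
  finally show ?case using insert by simp
qed

lemma poly_D_eq:
  assumes u: "clinear_on test_functions u" and \<phi>: "\<phi> \<in> test_functions"
  shows "poly_D P u \<phi> = u (poly_op P \<phi>)"
  unfolding poly_op_def
  by (subst clinear_sum[OF u]) (auto simp: poly_D_def multi_power_word foldr_D_distr length_word mult.assoc
      intro: test_foldr_D_fun[OF \<phi>])

lemma poly_op_translate:
  "\<phi> \<in> test_functions \<Longrightarrow> poly_op P (\<lambda>z. \<phi> (z - x)) = (\<lambda>z. poly_op P \<phi> (z - x))"
  by (simp add: poly_op_def foldr_D_fun_translate[OF test_smooth])

lemma poly_op_support: "fun_support (poly_op P \<phi>) \<subseteq> fun_support \<phi>"
proof (rule fun_support_subset[OF closed_fun_support])
  fix x assume "x \<notin> fun_support \<phi>"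
  then have "foldr D_fun js \<phi> x = 0" for js
    using foldr_D_fun_support[of js \<phi>] by (intro not_in_fun_support) blast
  then show "poly_op P \<phi> x = 0" by (simp add: poly_op_def)
qed

section \<open>Fourier transforms of test functions\<close>

lemma cis_borel: "cis \<in> borel_measurable borel"
  by (intro borel_measurable_continuous_onI continuous_intros)

lemma integrable_cis:
  fixes F :: "'a::euclidean_space \<Rightarrow> complex"
  assumes "integrable lborel F"
  shows "integrable lborel (\<lambda>z. F z * cis (z \<bullet> \<xi>))"
  using cis_borel by (intro integrable_mult_bounded[OF assms, where B=1]) auto

lemma fourier_translate:
  fixes F :: "'a::euclidean_space \<Rightarrow> complex"
  assumes "integrable lborel F"
  shows "(LINT z|lborel. F (z - x) * cis (z \<bullet> \<xi>)) = cis (x \<bullet> \<xi>) * (LINT z|lborel. F z * cis (z \<bullet> \<xi>))"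
proof -
  have [measurable]: "F \<in> borel_measurable borel" "cis \<in> borel_measurable borel" using assms cis_borel by auto
  have "(LINT z|lborel. F (z - x) * cis (z \<bullet> \<xi>)) = (LINT z|lborel. F ((x + z) - x) * cis ((x + z) \<bullet> \<xi>))"
    by (rule lborel_integral_translate[symmetric]) measurable
  also have "\<dots> = (LINT z|lborel. cis (x \<bullet> \<xi>) * (F z * cis (z \<bullet> \<xi>)))"
    by (simp add: inner_add_left flip: cis_mult mult.assoc) (simp add: mult_ac)
  finally show ?thesis by simp
qed

text \<open>Convolution of \<open>\<phi>\<close> with a truncated character \<open>w\<close> is, near the origin, a multiple of the character, the
multiple being the Fourier integral.  Differentiating the convolution at the origin once through the character
and once through \<open>\<phi>\<close> gives the identity.\<close>

lemma fourier_D_fun: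
  fixes \<phi> :: "('n::finite) cfun"
  assumes \<phi>: "\<phi> \<in> test_functions"
  shows "(LINT z|lborel. D_fun j \<phi> z * cis (z \<bullet> \<xi>)) = - of_real (\<xi> $ j) * (LINT z|lborel. \<phi> z * cis (z \<bullet> \<xi>))"
proof -
  let ?I = "LINT z|lborel. \<phi> z * cis (z \<bullet> \<xi>)"
  have D\<phi>: "D_fun j \<phi> \<in> test_functions" by (rule D_fun_test[OF \<phi>])
  obtain R1 where R1: "R1 > 0" "\<And>x. norm x \<ge> R1 \<Longrightarrow> \<phi> x = 0" by (fact test_support_ball[OF \<phi>])
  obtain R2 where R2: "R2 > 0" "\<And>x. norm x \<ge> R2 \<Longrightarrow> D_fun j \<phi> x = 0" by (fact test_support_ball[OF D\<phi>])
  define R where "R = max R1 R2"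
  define w where "w = (\<lambda>y::real^'n. complex_of_real (indicator (ball 0 (R + 1)) y) * cis (y \<bullet> (-\<xi>)))"
  have w: "integrable lborel w"
    unfolding w_def using emeasure_lborel_ball_finite[of "0::real^'n" "R + 1"]
    by (intro integrable_cis integrable_of_real integrable_real_indicator) auto
  have conv: "conv w g x = cis (x \<bullet> (-\<xi>)) * (LINT z|lborel. g z * cis (z \<bullet> \<xi>))"
    if g: "g \<in> test_functions" "\<And>x. norm x \<ge> R \<Longrightarrow> g x = 0" and x: "norm x < 1" for g x
  proof -
    have [measurable]: "g \<in> borel_measurable borel" "w \<in> borel_measurable borel"
      using test_measurable[OF g(1)] w by auto
    have "conv w g x = (LINT z|lborel. w (x + (-1) *\<^sub>R z) * g (x - (x + (-1) *\<^sub>R z)))"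
      unfolding conv_def by (subst integral_lborel_affine[where c="-1" and t=x]) simp_all
    also have "\<dots> = (LINT z|lborel. cis (x \<bullet> (-\<xi>)) * (g z * cis (z \<bullet> \<xi>)))"
    proof (rule Bochner_Integration.integral_cong[OF refl])
      fix z
      show "w (x + (-1) *\<^sub>R z) * g (x - (x + (-1) *\<^sub>R z)) = cis (x \<bullet> (-\<xi>)) * (g z * cis (z \<bullet> \<xi>))"
      proof (cases "norm z < R")
        case True
        then have "norm (x - z) < R + 1" using x norm_triangle_ineq4[of x z] by linarith
        moreover have "cis ((x - z) \<bullet> (-\<xi>)) = cis (x \<bullet> (-\<xi>)) * cis (z \<bullet> \<xi>)"
          unfolding cis_mult by (simp add: inner_diff_left)
        ultimately show ?thesis by (simp add: w_def)
      qed (use g(2) in simp)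
    qed
    also have "\<dots> = cis (x \<bullet> (-\<xi>)) * (LINT z|lborel. g z * cis (z \<bullet> \<xi>))" by (rule integral_mult_right_zero)
    finally show ?thesis .
  qed
  have "((\<lambda>x::real^'n. cis (x \<bullet> (-\<xi>)) * ?I) has_derivative (\<lambda>v. (v \<bullet> (-\<xi>)) *\<^sub>R (\<i> * ?I))) (at 0)"
  proof -
    have 1: "((\<lambda>x::real^'n. x \<bullet> (-\<xi>)) has_derivative (\<lambda>v. v \<bullet> (-\<xi>))) (at 0)"
      by (auto intro!: derivative_eq_intros)
    have 2: "((\<lambda>t. cis t * ?I) has_vector_derivative \<i> * ?I) (at ((0::real^'n) \<bullet> (-\<xi>)))"
      unfolding cis_conv_exp by (auto intro!: derivative_eq_intros)
    from has_derivative_compose[OF 1 2[unfolded has_vector_derivative_def]] show ?thesis .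
  qed
  then have "(conv w \<phi> has_derivative (\<lambda>v. (v \<bullet> (-\<xi>)) *\<^sub>R (\<i> * ?I))) (at 0)"
  proof (rule has_derivative_transform_within_open[of _ _ _ _ "ball 0 1"])
    fix x :: "real^'n" assume "x \<in> ball 0 1"
    then show "cis (x \<bullet> (-\<xi>)) * ?I = conv w \<phi> x" using conv[OF \<phi>] R1(2) by (simp add: R_def)
  qed auto
  from D_fun_eq[OF this, of j] have "D_fun j (conv w \<phi>) 0 = \<i> * (of_real (\<xi> $ j) * (\<i> * ?I))"
    by (simp add: inner_axis' scaleR_conv_of_real)
  also have "\<dots> = (\<i> * \<i>) * (of_real (\<xi> $ j) * ?I)" by (simp only: mult_ac)
  finally have "D_fun j (conv w \<phi>) 0 = - of_real (\<xi> $ j) * ?I" by simp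
  moreover have "D_fun j (conv w \<phi>) 0 = (LINT z|lborel. D_fun j \<phi> z * cis (z \<bullet> \<xi>))"
    unfolding D_fun_conv[OF w \<phi>] using conv[OF D\<phi>, of 0] R2(2) by (simp add: R_def)
  ultimately show ?thesis by simp
qed

section \<open>Injectivity of constant coefficient operators\<close>

definition symbol :: "(('n::finite \<Rightarrow>\<^sub>0 nat) \<Rightarrow>\<^sub>0 complex) \<Rightarrow> real^'n \<Rightarrow> complex" where
  "symbol P \<xi> = (\<Sum>\<alpha>\<in>Poly_Mapping.keys P. Poly_Mapping.lookup P \<alpha> * (\<Prod>j\<in>UNIV. of_real (\<xi> $ j) ^ Poly_Mapping.lookup \<alpha> j))"

lemma fourier_foldr_D_fun:
  assumes \<phi>: "\<phi> \<in> test_functions"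
  shows "(LINT z|lborel. foldr D_fun js \<phi> z * cis (z \<bullet> \<xi>)) =
    (-1) ^ length js * (\<Prod>j\<leftarrow>js. of_real (\<xi> $ j)) * (LINT z|lborel. \<phi> z * cis (z \<bullet> \<xi>))"
  by (induction js) (simp_all add: fourier_D_fun[OF test_foldr_D_fun[OF \<phi>]])

lemma prod_list_word:
  "(\<Prod>j\<leftarrow>rev (word \<alpha>). f j) = (\<Prod>j\<in>UNIV. f j ^ Poly_Mapping.lookup \<alpha> (j::'n::finite) :: complex)"
proof -
  have "(\<Prod>j\<leftarrow>concat (map (\<lambda>j. replicate (Poly_Mapping.lookup \<alpha> j) j) js). f j) = (\<Prod>j\<leftarrow>js. f j ^ Poly_Mapping.lookup \<alpha> j)" for js
    by (induction js) simp_all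
  then have "(\<Prod>j\<leftarrow>word \<alpha>. f j) = (\<Prod>j\<leftarrow>coords. f j ^ Poly_Mapping.lookup \<alpha> j)"
    by (simp add: word_def)
  also have "\<dots> = (\<Prod>j\<in>UNIV. f j ^ Poly_Mapping.lookup \<alpha> j)"
    using prod.distinct_set_conv_list[OF coords(1), of "\<lambda>j. f j ^ Poly_Mapping.lookup \<alpha> j"] by (simp add: coords)
  finally have "(\<Prod>j\<leftarrow>word \<alpha>. f j) = (\<Prod>j\<in>UNIV. f j ^ Poly_Mapping.lookup \<alpha> j)" .
  moreover have "(\<Prod>j\<leftarrow>rev js. f j) = (\<Prod>j\<leftarrow>js. f j)" for js
    by (induction js) (simp_all add: mult.commute)
  ultimately show ?thesis by simp
qed

lemma fourier_poly_op:
  assumes \<phi>: "\<phi> \<in> test_functions"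
  shows "(LINT z|lborel. poly_op P \<phi> z * cis (z \<bullet> \<xi>)) = symbol P \<xi> * (LINT z|lborel. \<phi> z * cis (z \<bullet> \<xi>))"
proof -
  let ?I = "LINT z|lborel. \<phi> z * cis (z \<bullet> \<xi>)"
  have summand: "(LINT z|lborel. (a * (-1) ^ multi_degree \<alpha>) * (foldr D_fun (rev (word \<alpha>)) \<phi> z * cis (z \<bullet> \<xi>))) =
      a * (\<Prod>j\<in>UNIV. of_real (\<xi> $ j) ^ Poly_Mapping.lookup \<alpha> j) * ?I" for a \<alpha>
  proof -
    let ?s = "(-1) ^ multi_degree \<alpha> :: complex"
    have "?s * ?s = 1" by (simp flip: power_mult_distrib)
    moreover have "(a * ?s) * (?s * p * q) = a * (?s * ?s) * p * q" for p q
      by (simp only: mult_ac)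
    ultimately have "(a * ?s) * (?s * p * q) = a * p * q" for p q by simp
    then show ?thesis
      unfolding integral_mult_right_zero fourier_foldr_D_fun[OF \<phi>] prod_list_word length_rev length_word .
  qed
  have "(LINT z|lborel. poly_op P \<phi> z * cis (z \<bullet> \<xi>)) =
     (LINT z|lborel. (\<Sum>\<alpha>\<in>Poly_Mapping.keys P. (Poly_Mapping.lookup P \<alpha> * (-1) ^ multi_degree \<alpha>)
      * (foldr D_fun (rev (word \<alpha>)) \<phi> z * cis (z \<bullet> \<xi>))))"
    by (simp add: poly_op_def sum_distrib_right mult.assoc)
  also have "\<dots> = (\<Sum>\<alpha>\<in>Poly_Mapping.keys P. (LINT z|lborel. (Poly_Mapping.lookup P \<alpha> * (-1) ^ multi_degree \<alpha>)
      * (foldr D_fun (rev (word \<alpha>)) \<phi> z * cis (z \<bullet> \<xi>))))"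
    by (intro Bochner_Integration.integral_sum integrable_mult_right integrable_cis test_integrable test_foldr_D_fun \<phi>)
  also have "\<dots> = symbol P \<xi> * ?I"
    unfolding summand by (simp add: symbol_def sum_distrib_right)
  finally show ?thesis .
qed

text \<open>The induction removes one variable: for fixed values of the others, the polynomial in that variable has infinitely many zeros, so the sums
over the exponents with a given entry \<open>k\<close> vanish separately.  The injectivity hypothesis says that the
exponents in \<open>A\<close> are determined by their entries in \<open>J\<close>.\<close>

lemma polynomial_vanishing_on_product:
  fixes c :: "('n \<Rightarrow>\<^sub>0 nat) \<Rightarrow> complex" and S :: "'n \<Rightarrow> real set"
  assumes "finite J" "finite A"
    and "\<And>\<alpha> \<beta>. \<alpha> \<in> A \<Longrightarrow> \<beta> \<in> A \<Longrightarrow> (\<And>j. j \<in> J \<Longrightarrow> Poly_Mapping.lookup \<alpha> j = Poly_Mapping.lookup \<beta> j) \<Longrightarrow> \<alpha> = \<beta>"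
    and S: "\<And>j. infinite (S j)"
    and "\<And>x. (\<And>j. x j \<in> S j) \<Longrightarrow> (\<Sum>\<alpha>\<in>A. c \<alpha> * (\<Prod>j\<in>J. of_real (x j) ^ Poly_Mapping.lookup \<alpha> j)) = 0"
    and "\<alpha> \<in> A"
  shows "c \<alpha> = 0"
  using assms(1,2,3,5,6)
proof (induction J arbitrary: A \<alpha> rule: finite_induct)
  case empty
  then have "A = {\<alpha>}" by auto
  moreover have "(SOME s. s \<in> S j) \<in> S j" for j
    using S[of j] by (auto simp: some_in_eq)
  ultimately show ?case using empty(3)[of "\<lambda>j. SOME s. s \<in> S j"] by simp
next
  case (insert i J)
  let ?m = "\<lambda>x \<alpha>. c \<alpha> * (\<Prod>j\<in>J. of_real (x j) ^ Poly_Mapping.lookup \<alpha> j)"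
  let ?A = "\<lambda>k. {\<beta>\<in>A. Poly_Mapping.lookup \<beta> i = k}"
  define N where "N = Max ((\<lambda>\<beta>. Poly_Mapping.lookup \<beta> i) ` A)"
  have N: "Poly_Mapping.lookup \<beta> i \<le> N" if "\<beta> \<in> A" for \<beta>
    unfolding N_def using insert.prems(1) that by (intro Max_ge) auto
  have zero: "(\<Sum>\<beta>\<in>?A k. ?m x \<beta>) = 0" if x: "\<And>j. x j \<in> S j" for x k
  proof (rule ccontr)
    assume nz: "(\<Sum>\<beta>\<in>?A k. ?m x \<beta>) \<noteq> 0"
    then have "?A k \<noteq> {}" by (metis sum.empty)
    then have "k \<le> N" using N by auto
    have "finite {z. (\<Sum>k\<le>N. (\<Sum>\<beta>\<in>?A k. ?m x \<beta>) * z ^ k) = 0}"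
      using nz \<open>k \<le> N\<close> polyfun_finite_roots[of "\<lambda>k. \<Sum>\<beta>\<in>?A k. ?m x \<beta>" N] by auto
    moreover have "of_real ` S i \<subseteq> {z. (\<Sum>k\<le>N. (\<Sum>\<beta>\<in>?A k. ?m x \<beta>) * z ^ k) = 0}"
    proof clarify
      fix t assume t: "t \<in> S i"
      let ?y = "x(i := t)"
      have "(\<Sum>k\<le>N. (\<Sum>\<beta>\<in>?A k. ?m x \<beta>) * of_real t ^ k) = (\<Sum>k\<le>N. \<Sum>\<beta>\<in>?A k. ?m x \<beta> * of_real t ^ Poly_Mapping.lookup \<beta> i)"
        by (intro sum.cong refl) (simp add: sum_distrib_right)
      also have "\<dots> = (\<Sum>\<beta>\<in>A. ?m x \<beta> * of_real t ^ Poly_Mapping.lookup \<beta> i)"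
        using N insert.prems(1) by (intro sum.group) auto
      also have "\<dots> = (\<Sum>\<beta>\<in>A. c \<beta> * (\<Prod>j\<in>insert i J. of_real (?y j) ^ Poly_Mapping.lookup \<beta> j))"
      proof (intro sum.cong refl)
        fix \<beta>
        have "(\<Prod>j\<in>J. of_real (?y j) ^ Poly_Mapping.lookup \<beta> j) = (\<Prod>j\<in>J. of_real (x j) ^ Poly_Mapping.lookup \<beta> j :: complex)"
          using insert.hyps(2) by (intro prod.cong refl) auto
        then show "?m x \<beta> * of_real t ^ Poly_Mapping.lookup \<beta> i = c \<beta> * (\<Prod>j\<in>insert i J. of_real (?y j) ^ Poly_Mapping.lookup \<beta> j)"
          using insert.hyps by (simp add: mult_ac)
      qed
      also have "\<dots> = 0" using x t by (intro insert.prems(3)) auto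
      finally show "(\<Sum>k\<le>N. (\<Sum>\<beta>\<in>?A k. ?m x \<beta>) * of_real t ^ k) = 0" .
    qed
    ultimately have "finite (complex_of_real ` S i)" by (rule rev_finite_subset)
    then show False using S[of i] by (simp add: finite_image_iff inj_on_def)
  qed
  show ?case
  proof (rule insert.IH[of "?A (Poly_Mapping.lookup \<alpha> i)"])
    fix \<beta> \<gamma> assume "\<beta> \<in> ?A (Poly_Mapping.lookup \<alpha> i)" "\<gamma> \<in> ?A (Poly_Mapping.lookup \<alpha> i)"
      "\<And>j. j \<in> J \<Longrightarrow> Poly_Mapping.lookup \<beta> j = Poly_Mapping.lookup \<gamma> j"
    then show "\<beta> = \<gamma>" by (intro insert.prems(2)) auto
  qed (use insert.prems zero in auto)
qed

text \<open>Every ball contains a product of intervals.\<close>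

lemma symbol_nonzero_dense:
  fixes P :: "('n::finite \<Rightarrow>\<^sub>0 nat) \<Rightarrow>\<^sub>0 complex"
  assumes P: "P \<noteq> 0" and e: "e > 0"
  obtains \<zeta> where "norm (\<zeta> - \<xi>) < e" "symbol P \<zeta> \<noteq> 0"
proof (rule ccontr)
  note witness = that
  assume neg: "\<not> thesis"
  have all: "symbol P \<zeta> = 0" if near: "norm (\<zeta> - \<xi>) < e" for \<zeta>
    using neg witness[OF near] by blast
  define \<delta> where "\<delta> = e / CARD('n)"
  have \<delta>: "\<delta> > 0" using e by (simp add: \<delta>_def)
  obtain \<alpha> where \<alpha>: "\<alpha> \<in> Poly_Mapping.keys P" using P by (metis ex_in_conv keys_eq_empty)
  have "Poly_Mapping.lookup P \<alpha> = 0"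
  proof (rule polynomial_vanishing_on_product[of UNIV "Poly_Mapping.keys P" "\<lambda>j. {\<xi> $ j<..<\<xi> $ j + \<delta>}"])
    show "\<And>j. infinite {\<xi> $ j<..<\<xi> $ j + \<delta>}" using \<delta> by (simp add: infinite_Ioo)
    show "\<alpha>' = \<beta>" if "\<And>j. j \<in> UNIV \<Longrightarrow> Poly_Mapping.lookup \<alpha>' j = Poly_Mapping.lookup \<beta> j" for \<alpha>' \<beta> :: "'n \<Rightarrow>\<^sub>0 nat"
      using that by (intro poly_mapping_eqI) auto
    fix x :: "'n \<Rightarrow> real" assume x: "\<And>j. x j \<in> {\<xi> $ j<..<\<xi> $ j + \<delta>}"
    have "norm ((\<chi> j. x j) - \<xi>) \<le> (\<Sum>j\<in>UNIV. \<bar>((\<chi> j. x j) - \<xi>) $ j\<bar>)" by (rule norm_le_l1_cart)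
    also have "\<dots> < (\<Sum>j\<in>(UNIV::'n set). \<delta>)"
    proof (intro sum_strict_mono)
      fix j show "\<bar>((\<chi> j. x j) - \<xi>) $ j\<bar> < \<delta>" using x[of j] by auto
    qed auto
    also have "\<dots> = e" by (simp add: \<delta>_def)
    finally have "symbol P (\<chi> j. x j) = 0" by (rule all)
    then show "(\<Sum>\<alpha>\<in>Poly_Mapping.keys P. Poly_Mapping.lookup P \<alpha> * (\<Prod>j\<in>UNIV. of_real (x j) ^ Poly_Mapping.lookup \<alpha> j)) = 0"
      by (simp add: symbol_def)
  qed (use \<alpha> in auto)
  then show False using \<alpha> by (simp add: in_keys_iff)
qed

text \<open>If the bump has radius \<open>d < 1/|\<xi>|\<close>, then \<open>cos(z\<cdot>\<xi>) > 0\<close> on its support and the real part of the integral is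
positive.\<close>

lemma test_function_fourier_nonzero:
  fixes v \<xi> :: "real^'n::finite"
  assumes r: "r > 0"
  obtains \<phi> where "\<phi> \<in> test_functions" "fun_support \<phi> \<subseteq> ball v r" "(LINT z|lborel. \<phi> z * cis (z \<bullet> \<xi>)) \<noteq> 0"
proof -
  define d where "d = min (r / 2) (1 / (norm \<xi> + 1))"
  have d: "d > 0" using r by (auto simp: d_def add_nonneg_pos)
  let ?\<chi> = "\<lambda>x::real^'n. complex_of_real (bump d x)"
  have [measurable]: "bump d \<in> borel_measurable (borel :: (real^'n) measure)"
    using borel_measurable_integrable[OF integrable_bump[OF d]] by simp
  have cos_pos: "cos (z \<bullet> \<xi>) > 0" if "norm z < d" for z
  proof -
    have "\<bar>z \<bullet> \<xi>\<bar> \<le> norm z * norm \<xi>" by (rule Cauchy_Schwarz_ineq2)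
    also have "\<dots> \<le> d * norm \<xi>" using that by (intro mult_right_mono) auto
    also have "\<dots> \<le> 1 / (norm \<xi> + 1) * norm \<xi>" by (intro mult_right_mono) (auto simp: d_def)
    also have "\<dots> < 1" by (simp add: divide_less_eq add_nonneg_pos)
    finally show ?thesis using pi_gt3 by (intro cos_gt_zero_pi) auto
  qed
  have int: "integrable lborel (\<lambda>z. bump d z * cos (z \<bullet> \<xi>))"
    using integrable_Re[OF integrable_cis[OF test_integrable[OF bump_test[OF d]], of \<xi>]] by simp
  have "(LINT z|lborel. bump d z * cos (z \<bullet> \<xi>)) > 0"
    by (rule integral_bump_weighted_pos[OF d _ cos_pos int]) (intro continuous_intros)
  moreover have "Re (LINT z|lborel. ?\<chi> z * cis (z \<bullet> \<xi>)) = (LINT z|lborel. bump d z * cos (z \<bullet> \<xi>))"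
    using integral_Re[OF integrable_cis[OF test_integrable[OF bump_test[OF d]], of \<xi>]] by simp
  ultimately have nz: "(LINT z|lborel. ?\<chi> z * cis (z \<bullet> \<xi>)) \<noteq> 0" by auto
  have "d < r" using r by (auto simp: d_def)
  have "fun_support (\<lambda>z. ?\<chi> (z - v)) \<subseteq> cball v d"
    by (intro fun_support_subset) (auto simp: dist_norm norm_minus_commute not_le intro!: bump_eq_0[OF d])
  also have "\<dots> \<subseteq> ball v r" using \<open>d < r\<close> by auto
  finally show ?thesis
    using nz fourier_translate[OF test_integrable[OF bump_test[OF d]], of v \<xi>]
    by (intro that[of "\<lambda>z. ?\<chi> (z - v)"] test_translate[OF bump_test[OF d]]) (auto simp del: of_real_eq_0_iff)
qed

lemma correlation_fourier:
  fixes f \<psi> :: "real^'n::finite \<Rightarrow> complex"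
  assumes f: "integrable lborel f" and \<psi>: "integrable lborel \<psi>"
  shows "integrable lborel (\<lambda>x. LINT y|lborel. f y * \<psi> (y - x))"
    and "(LINT x|lborel. (LINT y|lborel. f y * \<psi> (y - x)) * cis (x \<bullet> \<xi>)) =
      (LINT y|lborel. f y * cis (y \<bullet> \<xi>)) * (LINT z|lborel. \<psi> z * cis (z \<bullet> (-\<xi>)))"
proof -
  have [measurable]: "f \<in> borel_measurable borel" "\<psi> \<in> borel_measurable borel" "cis \<in> borel_measurable borel"
    using f \<psi> cis_borel by auto
  have reflect: "(LINT x|lborel. g (y - x)) = (LINT x|lborel. g x)" if "g \<in> borel_measurable borel" for g :: "real^'n \<Rightarrow> complex" and y
    using integral_lborel_affine[OF that, of "-1" y] by simp
  have int_reflect: "integrable lborel (\<lambda>x. \<psi> (y - x))" for y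
  proof -
    have "integrable (distr lborel borel (\<lambda>x. y + (-1) *\<^sub>R x)) \<psi>"
      using \<psi> lborel_affine[of "-1" y] by (simp add: density_1)
    then show ?thesis by (subst (asm) integrable_distr_eq) auto
  qed
  have int: "integrable (lborel \<Otimes>\<^sub>M lborel) (\<lambda>(y, x). f y * \<psi> (y - x))"
  proof (rule lborel_pair.Fubini_integrable)
    have "(LINT x|lborel. norm (f y * \<psi> (y - x))) = norm (f y) * (LINT x|lborel. norm (\<psi> x))" for y
    proof -
      have "complex_of_real (LINT x|lborel. norm (\<psi> (y - x))) = complex_of_real (LINT x|lborel. norm (\<psi> x))"
        using reflect[of "\<lambda>x. of_real (norm (\<psi> x))" y] unfolding integral_complex_of_real by simp
      then show ?thesis by (simp add: norm_mult)
    qed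
    then show "integrable lborel (\<lambda>y. LINT x|lborel. norm (case (y, x) of (y, x) \<Rightarrow> f y * \<psi> (y - x)))"
      using f by simp
  qed (auto intro!: AE_I2 int_reflect)
  show "integrable lborel (\<lambda>x. LINT y|lborel. f y * \<psi> (y - x))"
    using lborel_pair.integrable_snd[OF int] .
  have int2: "integrable (lborel \<Otimes>\<^sub>M lborel) (\<lambda>(y, x). f y * \<psi> (y - x) * cis (x \<bullet> \<xi>))"
    by (rule Bochner_Integration.integrable_bound[OF int]) (auto simp: norm_mult)
  have "(LINT x|lborel. (LINT y|lborel. f y * \<psi> (y - x)) * cis (x \<bullet> \<xi>)) = (LINT x|lborel. LINT y|lborel. f y * \<psi> (y - x) * cis (x \<bullet> \<xi>))"
    by simp
  also have "\<dots> = (LINT y|lborel. LINT x|lborel. f y * \<psi> (y - x) * cis (x \<bullet> \<xi>))"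
    by (rule lborel_pair.Fubini_integral[OF int2])
  also have "\<dots> = (LINT y|lborel. (f y * cis (y \<bullet> \<xi>)) * (LINT z|lborel. \<psi> z * cis (z \<bullet> (-\<xi>))))"
  proof (rule Bochner_Integration.integral_cong[OF refl])
    fix y
    have "(LINT x|lborel. f y * \<psi> (y - x) * cis (x \<bullet> \<xi>)) = (LINT x|lborel. (f y * cis (y \<bullet> \<xi>)) * (\<psi> (y - x) * cis ((y - x) \<bullet> (-\<xi>))))"
    proof (rule Bochner_Integration.integral_cong[OF refl])
      fix x
      have "cis (x \<bullet> \<xi>) = cis (y \<bullet> \<xi>) * cis ((y - x) \<bullet> (-\<xi>))"
        unfolding cis_mult by (simp add: inner_diff_left)
      then show "f y * \<psi> (y - x) * cis (x \<bullet> \<xi>) = (f y * cis (y \<bullet> \<xi>)) * (\<psi> (y - x) * cis ((y - x) \<bullet> (-\<xi>)))"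
        by (simp add: mult_ac)
    qed
    also have "\<dots> = (f y * cis (y \<bullet> \<xi>)) * (LINT x|lborel. \<psi> (y - x) * cis ((y - x) \<bullet> (-\<xi>)))"
      by (rule integral_mult_right_zero)
    also have "(LINT x|lborel. \<psi> (y - x) * cis ((y - x) \<bullet> (-\<xi>))) = (LINT z|lborel. \<psi> z * cis (z \<bullet> (-\<xi>)))"
      by (rule reflect[of "\<lambda>z. \<psi> z * cis (z \<bullet> (-\<xi>))"]) measurable
    finally show "(LINT x|lborel. f y * \<psi> (y - x) * cis (x \<bullet> \<xi>)) = (f y * cis (y \<bullet> \<xi>)) * (LINT z|lborel. \<psi> z * cis (z \<bullet> (-\<xi>)))" .
  qed
  finally show "(LINT x|lborel. (LINT y|lborel. f y * \<psi> (y - x)) * cis (x \<bullet> \<xi>)) =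
      (LINT y|lborel. f y * cis (y \<bullet> \<xi>)) * (LINT z|lborel. \<psi> z * cis (z \<bullet> (-\<xi>)))"
    by simp
qed

text \<open>By the preceding formula, the Fourier transform of the hypothesis in \<open>x\<close> shows that the Fourier transform of \<open>f\<close>
vanishes where \<open>P\<close> does not.  That set is dense and the Fourier transform of \<open>f\<close> is continuous.\<close>

lemma constant_coefficient_injective:
  fixes f :: "real^'n::finite \<Rightarrow> complex"
  assumes f: "integrable lborel f" "continuous_on UNIV f" "\<And>y. norm (f y) \<le> B"
    and P: "P \<noteq> 0" and r: "r > 0"
    and zero: "\<And>\<phi> x. \<phi> \<in> test_functions \<Longrightarrow> fun_support \<phi> \<subseteq> ball v r \<Longrightarrow> (LINT y|lborel. f y * poly_op P \<phi> (y - x)) = 0"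
  shows "f x = 0"
proof (rule fourier_injective[OF f])
  fix \<xi> :: "real^'n"
  have [measurable]: "f \<in> borel_measurable borel" "cis \<in> borel_measurable borel"
    using f(1) cis_borel by auto
  have off_zeros: "(LINT y|lborel. f y * cis (y \<bullet> (-\<zeta>))) = 0" if nz: "symbol P \<zeta> \<noteq> 0" for \<zeta>
  proof -
    obtain \<phi> where \<phi>: "\<phi> \<in> test_functions" "fun_support \<phi> \<subseteq> ball v r" "(LINT z|lborel. \<phi> z * cis (z \<bullet> \<zeta>)) \<noteq> 0"
      using test_function_fourier_nonzero[OF r] by blast
    have "0 = (LINT x|lborel. (LINT y|lborel. f y * poly_op P \<phi> (y - x)) * cis (x \<bullet> (-\<zeta>)))"
      unfolding zero[OF \<phi>(1,2)] by simp
    also have "\<dots> = (LINT y|lborel. f y * cis (y \<bullet> (-\<zeta>))) * (LINT z|lborel. poly_op P \<phi> z * cis (z \<bullet> (- (-\<zeta>))))"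
      by (rule correlation_fourier(2)[OF f(1) test_integrable[OF poly_op_test[OF \<phi>(1)]]])
    also have "(LINT z|lborel. poly_op P \<phi> z * cis (z \<bullet> (- (-\<zeta>)))) = symbol P \<zeta> * (LINT z|lborel. \<phi> z * cis (z \<bullet> \<zeta>))"
      using fourier_poly_op[OF \<phi>(1), of P \<zeta>] by simp
    finally show ?thesis using nz \<phi>(3) by auto
  qed
  have "\<exists>\<zeta>. norm (\<zeta> - (-\<xi>)) < 1 / real (Suc m) \<and> symbol P \<zeta> \<noteq> 0" for m
  proof -
    have "1 / real (Suc m) > 0" by simp
    from symbol_nonzero_dense[OF P this, of "-\<xi>"] show ?thesis by metis
  qed
  then obtain \<zeta> where \<zeta>: "\<And>m. norm (\<zeta> m - (-\<xi>)) < 1 / real (Suc m)" "\<And>m. symbol P (\<zeta> m) \<noteq> 0" by metis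
  have lim: "\<zeta> \<longlonglongrightarrow> - \<xi>"
  proof -
    have lim0: "(\<lambda>m. 1 / real (Suc m)) \<longlonglongrightarrow> 0" by real_asymp
    have "(\<lambda>m. norm (\<zeta> m - (-\<xi>))) \<longlonglongrightarrow> 0"
      by (rule tendsto_sandwich[OF _ _ tendsto_const lim0]) (use \<zeta>(1) in \<open>auto intro!: always_eventually less_imp_le simp del: diff_minus_eq_add\<close>)
    then have "(\<lambda>m. \<zeta> m - (-\<xi>)) \<longlonglongrightarrow> 0" by (rule tendsto_norm_zero_cancel)
    then show ?thesis by (rule LIM_zero_cancel)
  qed
  have "(\<lambda>m. LINT y|lborel. f y * cis (y \<bullet> (- \<zeta> m))) \<longlonglongrightarrow> (LINT y|lborel. f y * cis (y \<bullet> \<xi>))"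
  proof (rule integral_dominated_convergence[where w="\<lambda>y. norm (f y)"])
    show "AE y in lborel. (\<lambda>m. f y * cis (y \<bullet> (- \<zeta> m))) \<longlonglongrightarrow> f y * cis (y \<bullet> \<xi>)"
    proof (intro AE_I2 tendsto_mult tendsto_const)
      fix y
      have "(\<lambda>m. y \<bullet> (- \<zeta> m)) \<longlonglongrightarrow> y \<bullet> \<xi>"
        using tendsto_inner[OF tendsto_const tendsto_minus[OF lim], of y] by simp
      then show "(\<lambda>m. cis (y \<bullet> (- \<zeta> m))) \<longlonglongrightarrow> cis (y \<bullet> \<xi>)" by (rule tendsto_cis)
    qed
  qed (use f(1) in \<open>auto simp: norm_mult\<close>)
  then show "(LINT y|lborel. f y * cis (y \<bullet> \<xi>)) = 0"
    using off_zeros[OF \<zeta>(2)] by (simp add: LIMSEQ_const_iff)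
qed

section \<open>Unique continuation for the normal operator\<close>

lemma compact_support_bounded_integrable:
  fixes F :: "real^'n::finite \<Rightarrow> complex"
  assumes cont: "continuous_on UNIV F" and supp: "\<And>x. norm x > R \<Longrightarrow> F x = 0"
  obtains B where "\<And>x. norm (F x) \<le> B" "integrable lborel F"
proof -
  have "compact (F ` cball 0 R)"
    by (rule compact_continuous_image[OF continuous_on_subset[OF cont] compact_cball]) simp
  from compact_imp_bounded[OF this] obtain B where B: "B > 0" "\<forall>y\<in>F ` cball 0 R. norm y \<le> B"
    unfolding bounded_pos by blast
  have bound: "norm (F x) \<le> B * indicator (cball 0 R) x" for x
    using B supp[of x] by (cases "norm x \<le> R") auto
  have "norm (F x) \<le> B" for x
    using bound[of x] B(1) by (cases "x \<in> cball 0 R") auto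
  moreover have "integrable lborel F"
  proof (rule Bochner_Integration.integrable_bound)
    show "integrable lborel (\<lambda>x. B * indicator (cball (0::real^'n) R) x)"
      using emeasure_lborel_cball_finite[of "0::real^'n" R]
      by (intro integrable_mult_right integrable_real_indicator) auto
    show "F \<in> borel_measurable lborel" using borel_measurable_continuous_onI[OF cont] by simp
    show "AE x in lborel. norm (F x) \<le> norm (B * indicator (cball 0 R) x)"
      by (intro AE_I2 order_trans[OF bound]) simp
  qed
  ultimately show ?thesis using that by blast
qed

lemma translated_support:
  assumes "fun_support \<phi> \<subseteq> ball v r" "norm x < r"
  shows "fun_support (\<lambda>z. \<phi> (z - x)) \<subseteq> ball v (2 * r)"
proof -
  have "dist v (x + z) < 2 * r" if "z \<in> fun_support \<phi>" for z
  proof -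
    have "dist v z < r" using that assms(1) by auto
    then show ?thesis using dist_triangle[of v "x + z" z] assms(2) by (simp add: dist_norm)
  qed
  then show ?thesis by (auto simp: fun_support_translate)
qed

text \<open>Pairing \<open>u\<close> with translates turns it into the functions \<open>?F\<close> and \<open>?f\<close> to which the theorems on functions
apply: the first carries the local hypotheses, the second recovers \<open>u\<close>.\<close>

lemma distribution_case:
  fixes V :: "(real^'n) set"
  assumes n: "CARD('n) \<ge> 2" and V: "open V" "V \<noteq> {}"
    and u: "u \<in> compact_distributions" and P: "P \<noteq> 0" "vanishes_on V (poly_D P u)"
    and N: "vanishes_on V (normal_distr u)" and \<eta>: "\<eta> \<in> test_functions"
  shows "u \<eta> = 0"
proof -
  have d: "u \<in> distributions" using u by (simp add: compact_distributions_def)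
  then have lin: "clinear_on test_functions u" by (simp add: distributions_def)
  obtain v where "v \<in> V" using V by blast
  then obtain s where "s > 0" "ball v s \<subseteq> V" using V(1) by (meson open_contains_ball)
  define r where "r = s / 2"
  have r: "r > 0" "ball v (2 * r) \<subseteq> V" using \<open>s > 0\<close> \<open>ball v s \<subseteq> V\<close> by (auto simp: r_def)
  obtain \<rho> where \<rho>: "\<rho> \<in> test_functions" "\<And>\<psi>. pairing u \<psi> = u (\<lambda>x. \<rho> x * \<psi> x)"
    "\<And>\<phi>. \<phi> \<in> test_functions \<Longrightarrow> u (\<lambda>x. \<rho> x * \<phi> x) = u \<phi>"
    by (fact pairing_cutoff[OF u])
  obtain R1 where R1: "R1 > 0" "\<And>x. norm x \<ge> R1 \<Longrightarrow> \<rho> x = 0" by (fact test_support_ball[OF \<rho>(1)])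
  have translates: "\<exists>B R. continuous_on UNIV (\<lambda>x. u (\<lambda>z. \<phi> (z - x))) \<and> integrable lborel (\<lambda>x. u (\<lambda>z. \<phi> (z - x))) \<and>
      (\<forall>x. norm (u (\<lambda>z. \<phi> (z - x))) \<le> B) \<and> (\<forall>x. norm x > R \<longrightarrow> u (\<lambda>z. \<phi> (z - x)) = 0) \<and> (\<forall>x. norm x \<ge> R - R1 \<longrightarrow> \<phi> x = 0)"
    if \<phi>: "\<phi> \<in> test_functions" for \<phi>
  proof -
    let ?F = "\<lambda>x. u (\<lambda>z. \<phi> (z - x))"
    have F: "?F x = u (\<lambda>z. \<rho> z * \<phi> (z - x))" for x
      using \<rho>(3)[OF test_translate[OF \<phi>], of x] by simp
    obtain R2 where R2: "R2 > 0" "\<And>x. norm x \<ge> R2 \<Longrightarrow> \<phi> x = 0" by (fact test_support_ball[OF \<phi>])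
    obtain A where A: "A \<ge> 0" "\<And>x y. norm (u (\<lambda>z. \<rho> z * \<phi> (z - x)) - u (\<lambda>z. \<rho> z * \<phi> (z - y))) \<le> A * norm (x - y)"
      by (rule distribution_translates_lipschitz[OF d \<rho>(1) \<phi>]) blast
    have "A-lipschitz_on UNIV ?F" using A unfolding F by (intro lipschitz_onI) (auto simp: dist_norm)
    then have cont: "continuous_on UNIV ?F" by (rule lipschitz_on_continuous_on)
    have supp: "?F x = 0" if x: "norm x > R1 + R2" for x
    proof -
      have "\<rho> z * \<phi> (z - x) = 0" for z
      proof (cases "norm z \<ge> R1")
        case False
        then have "norm (z - x) \<ge> R2" using x norm_triangle_ineq2[of x z] by (simp add: norm_minus_commute)
        then show ?thesis using R2(2) by simp
      qed (use R1(2) in simp)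
      then show ?thesis unfolding F by (simp only: distributions_zero[OF d])
    qed
    have "\<exists>B. (\<forall>x. norm (?F x) \<le> B) \<and> integrable lborel ?F"
      by (rule compact_support_bounded_integrable[where R="R1 + R2", OF cont]) (erule supp, blast)
    then obtain B where "\<And>x. norm (?F x) \<le> B" "integrable lborel ?F" by blast
    then show ?thesis using cont supp R2(2) by (intro exI[of _ B] exI[of _ "R1 + R2"]) auto
  qed
  have vanish: "u (\<lambda>z. poly_op P \<phi> (z - x)) = 0" if \<phi>: "\<phi> \<in> test_functions" "fun_support \<phi> \<subseteq> ball v r" for \<phi> x
  proof -
    define \<psi> where "\<psi> = poly_op P \<phi>"
    have \<psi>: "\<psi> \<in> test_functions" "fun_support \<psi> \<subseteq> ball v r"
      using poly_op_test[OF \<phi>(1)] poly_op_support[of P \<phi>] \<phi>(2) by (auto simp: \<psi>_def)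
    let ?F = "\<lambda>x. u (\<lambda>z. \<psi> (z - x))"
    obtain B R where F: "continuous_on UNIV ?F" "integrable lborel ?F" "\<And>x. norm (?F x) \<le> B"
        "\<And>x. norm x > R \<Longrightarrow> ?F x = 0" "\<And>x. norm x \<ge> R - R1 \<Longrightarrow> \<psi> x = 0"
      using translates[OF \<psi>(1)] by blast
    have "?F x = 0"
    proof (rule riesz_unique_continuation[OF _ r(1) F(2,1,3)])
      show "DIM(real^'n) \<ge> 2" using n by simp
      fix x :: "real^'n" assume x: "norm x < r"
      have "u (poly_op P (\<lambda>z. \<phi> (z - x))) = poly_D P u (\<lambda>z. \<phi> (z - x))"
        by (rule poly_D_eq[OF lin test_translate[OF \<phi>(1)], symmetric])
      also have "\<dots> = 0"
        using P(2) test_translate[OF \<phi>(1), of x] translated_support[OF \<phi>(2) x] r(2)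
        unfolding vanishes_on_def by blast
      finally show "?F x = 0" by (simp add: poly_op_translate[OF \<phi>(1)] \<psi>_def)
      define k where "k = (\<lambda>w::real^'n. norm w powr (1 - real CARD('n)))"
      \<comment> \<open>For \<open>|x| < r\<close> the integrand vanishes unless \<open>|y| < S\<close>, so the kernel may be truncated to make it integrable.\<close>
      define S where "S = R + r"
      define w where "w = (\<lambda>y::real^'n. complex_of_real (indicator (ball 0 S) y * k y))"
      define \<psi>x where "\<psi>x = (\<lambda>z. \<psi> (z - x))"
      have \<psi>x: "\<psi>x \<in> test_functions" "fun_support \<psi>x \<subseteq> V"
        using test_translate[OF \<psi>(1), of x] translated_support[OF \<psi>(2) x] r(2) by (auto simp: \<psi>x_def)
      have w: "integrable lborel w"
        unfolding w_def k_def by (intro integrable_of_real integrable_riesz_kernel_ball)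
      have w0: "w y = 0" if "norm y > S" for y using that by (simp add: w_def)
      have [measurable]: "?F \<in> borel_measurable borel" "\<psi>x \<in> borel_measurable borel" "k \<in> borel_measurable borel"
        "w \<in> borel_measurable borel"
        using borel_measurable_continuous_onI[OF F(1)] test_measurable[OF \<psi>x(1)] w by (auto simp: k_def)
      have "(LINT y|lborel. ?F y * of_real (k (y - x))) = (LINT y|lborel. ?F (x + y) * of_real (k ((x + y) - x)))"
        by (rule lborel_integral_translate[symmetric]) measurable
      also have "\<dots> = (LINT y|lborel. w y * u (\<lambda>z. \<rho> z * \<psi>x (z - y)))"
      proof (rule Bochner_Integration.integral_cong[OF refl])
        fix y
        have 1: "u (\<lambda>z. \<rho> z * \<psi>x (z - y)) = ?F (x + y)"
          using \<rho>(3)[OF test_translate[OF \<psi>x(1)], of y] by (simp add: \<psi>x_def algebra_simps)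
        have 2: "?F (x + y) = 0" if "\<not> norm y < S"
        proof (rule F(4))
          show "norm (x + y) > R" using that x norm_triangle_ineq2[of y "-x"] by (simp add: S_def algebra_simps)
        qed
        show "?F (x + y) * of_real (k ((x + y) - x)) = w y * u (\<lambda>z. \<rho> z * \<psi>x (z - y))"
          unfolding 1 using 2 by (cases "norm y < S") (auto simp: w_def)
      qed
      also have "\<dots> = u (\<lambda>z. \<rho> z * conv w \<psi>x z)"
        by (rule distribution_conv[OF d \<rho>(1) \<psi>x(1) w w0, symmetric])
      also have "u (\<lambda>z. \<rho> z * conv w \<psi>x z) = 0"
      proof -
        have t: "(\<lambda>z. \<rho> z * conv w \<psi>x z) \<in> test_functions"
          by (rule test_mult[OF \<rho>(1) conv_smooth[OF w \<psi>x(1)]])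
        have eq: "\<rho> z * normal_fun \<psi>x z = 2 * (\<rho> z * conv w \<psi>x z)" for z
        proof (cases "norm z < R1")
          case True
          obtain M where M: "\<And>y. norm (\<psi>x y) \<le> M" using test_bounded[OF \<psi>x(1)] by metis
          have "conv w \<psi>x z = (LINT y|lborel. w (0 + (-1) *\<^sub>R y) * \<psi>x (z - (0 + (-1) *\<^sub>R y)))"
            unfolding conv_def by (subst integral_lborel_affine[where c="-1" and t=0]) simp_all
          also have "\<dots> = (LINT y|lborel. \<psi>x (z + y) * of_real (k y))"
          proof (rule Bochner_Integration.integral_cong[OF refl])
            fix y
            have zero: "\<psi>x (z + y) = 0" if y: "\<not> norm y < S"
              unfolding \<psi>x_def
            proof (rule F(5))
              have "norm y \<le> norm (z + y - x) + norm z + norm x"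
                using norm_triangle_ineq4[of "z + y - x" "z - x"] norm_triangle_ineq4[of z x] by (simp add: algebra_simps)
              then show "norm (z + y - x) \<ge> R - R1" using y x True by (simp add: S_def)
            qed
            show "w (0 + (-1) *\<^sub>R y) * \<psi>x (z - (0 + (-1) *\<^sub>R y)) = \<psi>x (z + y) * of_real (k y)"
              using zero by (cases "norm y < S") (auto simp: w_def k_def)
          qed
          also have "2 * \<dots> = normal_fun \<psi>x z"
            unfolding normal_fun_riesz[OF test_integrable[OF \<psi>x(1)] M n] k_def by simp
          finally show ?thesis by simp
        qed (use R1(2) in simp)
        have "2 * u (\<lambda>z. \<rho> z * conv w \<psi>x z) = u (\<lambda>z. \<rho> z * normal_fun \<psi>x z)"
          unfolding eq by (rule distributions_cmult[OF d t, symmetric])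
        also have "\<dots> = normal_distr u \<psi>x"
          by (simp add: normal_distr_def xray_adj_distr_def xray_distr_def \<rho>(2) normal_fun_def)
        also have "\<dots> = 0"
          using N \<psi>x unfolding vanishes_on_def by blast
        finally show ?thesis by simp
      qed
      finally show "(LINT y|lborel. ?F y * of_real (norm (y - x) powr (1 - real DIM(real^'n)))) = 0"
        by (simp add: k_def)
    qed
    then show ?thesis by (simp add: \<psi>_def)
  qed
  let ?f = "\<lambda>x. u (\<lambda>z. \<eta> (z - x))"
  obtain B where f: "continuous_on UNIV ?f" "integrable lborel ?f" "\<And>x. norm (?f x) \<le> B"
    using translates[OF \<eta>] by blast
  have "?f 0 = 0"
  proof (rule constant_coefficient_injective[OF f(2,1,3) P(1) r(1)])
    fix \<phi> and c :: "real^'n" assume \<phi>: "\<phi> \<in> test_functions" "fun_support \<phi> \<subseteq> ball v r"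
    define \<psi> where "\<psi> = poly_op P \<phi>"
    have \<psi>: "\<psi> \<in> test_functions" using poly_op_test[OF \<phi>(1)] by (simp add: \<psi>_def)
    define \<eta>c where "\<eta>c = (\<lambda>z. \<eta> (z - c))"
    have \<eta>c: "\<eta>c \<in> test_functions" unfolding \<eta>c_def by (rule test_translate[OF \<eta>])
    have [measurable]: "?f \<in> borel_measurable borel" "\<psi> \<in> borel_measurable borel" "\<eta>c \<in> borel_measurable borel"
      using f(2) test_measurable \<psi> \<eta>c by auto
    obtain R2 where R2: "\<And>x. norm x \<ge> R2 \<Longrightarrow> \<psi> x = 0" using test_support_ball[OF \<psi>] by blast
    obtain R3 where R3: "\<And>x. norm x \<ge> R3 \<Longrightarrow> \<eta>c x = 0" using test_support_ball[OF \<eta>c] by blast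
    have "(LINT y|lborel. ?f y * \<psi> (y - c)) = (LINT y|lborel. ?f (c + y) * \<psi> ((c + y) - c))"
      by (rule lborel_integral_translate[symmetric]) measurable
    also have "\<dots> = (LINT y|lborel. \<psi> y * u (\<lambda>z. \<rho> z * \<eta>c (z - y)))"
      using \<rho>(3)[OF test_translate[OF \<eta>c]] by (simp add: \<eta>c_def algebra_simps)
    also have "\<dots> = u (\<lambda>z. \<rho> z * conv \<psi> \<eta>c z)"
      by (rule distribution_conv[OF d \<rho>(1) \<eta>c test_integrable[OF \<psi>], symmetric, of R2]) (simp add: R2)
    \<comment> \<open>Commutativity moves the derivatives from \<open>\<eta>\<close> to \<open>\<psi>\<close>, where the pairing is known to vanish.\<close>
    also have "conv \<psi> \<eta>c = conv \<eta>c \<psi>"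
    proof
      fix z
      show "conv \<psi> \<eta>c z = conv \<eta>c \<psi> z"
        unfolding conv_def by (subst integral_lborel_affine[where c="-1" and t=z]) (simp_all add: mult.commute)
    qed
    also have "u (\<lambda>z. \<rho> z * conv \<eta>c \<psi> z) = (LINT y|lborel. \<eta>c y * u (\<lambda>z. \<rho> z * \<psi> (z - y)))"
      by (rule distribution_conv[OF d \<rho>(1) \<psi> test_integrable[OF \<eta>c], of R3]) (simp add: R3)
    also have "\<dots> = 0"
      using \<rho>(3)[OF test_translate[OF \<psi>]] vanish[OF \<phi>] by (simp add: \<psi>_def)
    finally show "(LINT y|lborel. ?f y * poly_op P \<phi> (y - c)) = 0" by (simp add: \<psi>_def)
  qed
  then show ?thesis by simp
qed


lemma rapidly_decaying_bounded_integrable: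
  assumes "f \<in> rapidly_decaying"
  obtains B where "continuous_on UNIV f" "integrable lborel f" "\<And>x. norm (f x) \<le> B"
proof -
  have cont: "continuous_on UNIV f" and bdd: "\<And>k::nat. bdd_above (range (\<lambda>x. (1 + norm x) ^ k * norm (f x)))"
    using assms by (auto simp: rapidly_decaying_def)
  have dec: "\<exists>C. \<forall>x. (1 + norm x) ^ k * norm (f x) \<le> C" for k
    using bdd[of k] by (auto simp: bdd_above_def)
  obtain B where B: "\<And>x. norm (f x) \<le> B" using dec[of 0] by auto
  obtain C where C: "\<And>x. (1 + norm x) ^ (2 * DIM(real^'a)) * norm (f x) \<le> C" using dec by blast
  have "integrable lborel f"
  proof (rule Bochner_Integration.integrable_bound)
    show "integrable lborel (\<lambda>x::real^'a. C * (1 / (1 + norm x) ^ (2 * DIM(real^'a))))"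
      by (rule integrable_mult_right[OF integrable_decay])
    show "f \<in> borel_measurable lborel" using borel_measurable_continuous_onI[OF cont] by simp
    show "AE x in lborel. norm (f x) \<le> norm (C * (1 / (1 + norm x) ^ (2 * DIM(real^'a))))"
    proof (intro AE_I2)
      fix x :: "real^'a"
      have pos: "(1 + norm x) ^ (2 * DIM(real^'a)) > 0" by (intro zero_less_power add_pos_nonneg) auto
      have "norm (f x) \<le> C * (1 / (1 + norm x) ^ (2 * DIM(real^'a)))"
        using C[of x] pos by (simp add: pos_le_divide_eq mult.commute)
      then show "norm (f x) \<le> norm (C * (1 / (1 + norm x) ^ (2 * DIM(real^'a))))"
        unfolding real_norm_def by (rule order_trans[OF _ abs_ge_self])
    qed
  qed
  then show ?thesis using that cont B by blast
qed

lemma distr_of_clinear: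
  assumes f: "integrable lborel f"
  shows "clinear_on test_functions (distr_of f)"
proof -
  have int: "integrable lborel (\<lambda>x. f x * \<phi> x)" if \<phi>: "\<phi> \<in> test_functions" for \<phi>
  proof -
    obtain B where "\<And>x. norm (\<phi> x) \<le> B" using test_bounded[OF \<phi>] by metis
    then show ?thesis using test_measurable[OF \<phi>] by (intro integrable_mult_bounded[OF f, where B=B]) auto
  qed
  have "(LINT x|lborel. f x * (\<phi> x + \<psi> x)) = (LINT x|lborel. f x * \<phi> x) + (LINT x|lborel. f x * \<psi> x)"
    if "\<phi> \<in> test_functions" "\<psi> \<in> test_functions" for \<phi> \<psi>
    unfolding distrib_left by (rule Bochner_Integration.integral_add[OF int int]) (use that in auto)
  moreover have "(LINT x|lborel. f x * (c * \<phi> x)) = c * (LINT x|lborel. f x * \<phi> x)" for c \<phi>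
    unfolding mult.left_commute[of _ c] by (rule integral_mult_right_zero)
  ultimately show ?thesis by (simp add: clinear_on_def distr_of_def)
qed

text \<open>Here \<open>F\<close> is a correlation integral, and its Riesz potential is that of \<open>f\<close> tested against a translate of \<open>\<psi>\<close>,
by Fubini's theorem.\<close>

lemma function_case:
  fixes V :: "(real^'n) set" and f :: "'n cfun"
  assumes n: "CARD('n) \<ge> 2" and V: "open V" "V \<noteq> {}"
    and f: "continuous_on UNIV f" "integrable lborel f" "\<And>x. norm (f x) \<le> B"
    and P: "P \<noteq> 0" "vanishes_on V (poly_D P (distr_of f))"
    and N: "vanishes_on V (distr_of (normal_fun f))"
  shows "f x = 0"
proof -
  have [measurable]: "f \<in> borel_measurable borel" using f(2) by auto
  have B: "B \<ge> 0" using order_trans[OF norm_ge_zero f(3)] .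
  obtain v where "v \<in> V" using V by blast
  then obtain s where "s > 0" "ball v s \<subseteq> V" using V(1) by (meson open_contains_ball)
  define r where "r = s / 2"
  have r: "r > 0" "ball v (2 * r) \<subseteq> V" using \<open>s > 0\<close> \<open>ball v s \<subseteq> V\<close> by (auto simp: r_def)
  have vanish: "(LINT y|lborel. f y * poly_op P \<phi> (y - x)) = 0" if \<phi>: "\<phi> \<in> test_functions" "fun_support \<phi> \<subseteq> ball v r" for \<phi> x
  proof -
    define \<psi> where "\<psi> = poly_op P \<phi>"
    have \<psi>: "\<psi> \<in> test_functions" "fun_support \<psi> \<subseteq> ball v r"
      using poly_op_test[OF \<phi>(1)] poly_op_support[of P \<phi>] \<phi>(2) by (auto simp: \<psi>_def)
    have [measurable]: "\<psi> \<in> borel_measurable borel" by (rule test_measurable[OF \<psi>(1)])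
    note \<psi>_int = test_integrable[OF \<psi>(1)]
    obtain M where M: "\<And>z. norm (\<psi> z) \<le> M" using test_bounded[OF \<psi>(1)] by metis
    obtain L where L: "L \<ge> 0" "\<And>x y. norm (\<psi> x - \<psi> y) \<le> L * norm (x - y)" by (fact test_lipschitz[OF \<psi>(1)])
    let ?F = "\<lambda>x. LINT y|lborel. f y * \<psi> (y - x)"
    let ?I = "LINT y|lborel. norm (f y)"
    have int: "integrable lborel (\<lambda>y. f y * \<psi> (y - x))" for x
      using M by (intro integrable_mult_bounded[OF f(2), where B=M]) auto
    have lip: "norm (?F x - ?F z) \<le> (?I * L) * norm (x - z)" for x z
    proof -
      have "?F x - ?F z = (LINT y|lborel. f y * \<psi> (y - x) - f y * \<psi> (y - z))"
        by (rule Bochner_Integration.integral_diff[OF int int, symmetric])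
      also have "norm \<dots> \<le> (LINT y|lborel. norm (f y) * (L * norm (x - z)))"
      proof (rule Bochner_Integration.integral_norm_bound_integral)
        fix y
        have "norm (\<psi> (y - x) - \<psi> (y - z)) \<le> L * norm (x - z)"
          using L(2)[of "y - x" "y - z"] by (simp add: norm_minus_commute)
        then show "norm (f y * \<psi> (y - x) - f y * \<psi> (y - z)) \<le> norm (f y) * (L * norm (x - z))"
          by (simp add: norm_mult mult_left_mono flip: right_diff_distrib)
      qed (use int f(2) in auto)
      finally show ?thesis by (simp add: mult.assoc)
    qed
    have F_cont: "continuous_on UNIV ?F"
      by (rule lipschitz_on_continuous_on[of "?I * L"], rule lipschitz_onI) (use lip L(1) in \<open>auto simp: dist_norm\<close>)
    have F_bound: "norm (?F x) \<le> ?I * M" for x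
    proof -
      have "norm (?F x) \<le> (LINT y|lborel. norm (f y) * M)"
        using int f(2) M by (intro Bochner_Integration.integral_norm_bound_integral) (auto simp: norm_mult intro: mult_left_mono)
      then show ?thesis by simp
    qed
    have F_int: "integrable lborel ?F" by (rule correlation_fourier(1)[OF f(2) \<psi>_int])
    have [measurable]: "?F \<in> borel_measurable borel" by (rule borel_measurable_continuous_onI[OF F_cont])
    have "?F x = 0"
    proof (rule riesz_unique_continuation[OF _ r(1) F_int F_cont F_bound])
      show "DIM(real^'n) \<ge> 2" using n by simp
      fix x :: "real^'n" assume x: "norm x < r"
      have "?F x = distr_of f (poly_op P (\<lambda>z. \<phi> (z - x)))"
        by (simp add: distr_of_def poly_op_translate[OF \<phi>(1)] \<psi>_def)
      also have "\<dots> = poly_D P (distr_of f) (\<lambda>z. \<phi> (z - x))"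
        by (rule poly_D_eq[OF distr_of_clinear[OF f(2)] test_translate[OF \<phi>(1)], symmetric])
      also have "\<dots> = 0"
        using P(2) test_translate[OF \<phi>(1), of x] translated_support[OF \<phi>(2) x] r(2)
        unfolding vanishes_on_def by blast
      finally show "?F x = 0" .
      define k where "k = (\<lambda>w::real^'n. norm w powr (1 - real CARD('n)))"
      have [measurable]: "k \<in> borel_measurable borel" by (simp add: k_def)
      define C where "C = B * (LINT w|lborel. indicator (ball 0 1) (w::real^'n) * k w) + ?I"
      have Riesz_int: "integrable lborel (\<lambda>w. f (z + w) * of_real (k w))"
        and Riesz_bound: "(LINT w|lborel. norm (f (z + w)) * k w) \<le> C" for z
        unfolding k_def C_def using riesz_potential_integrable[OF f(2,3) n] by auto
      have kpos: "k w \<ge> 0" for w by (simp add: k_def)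
      let ?g = "\<lambda>z w. \<psi> (z - x) * (f (z + w) * of_real (k w))"
      have \<psi>x_int: "integrable lborel (\<lambda>z. \<psi> (z - x))"
        by (rule test_integrable[OF test_translate[OF \<psi>(1)]])
      have g_int: "integrable (lborel \<Otimes>\<^sub>M lborel) (\<lambda>(z, w). ?g z w)"
      proof (rule lborel_pair.Fubini_integrable)
        show "integrable lborel (\<lambda>z. LINT w|lborel. norm (case (z, w) of (z, w) \<Rightarrow> ?g z w))"
        proof (rule Bochner_Integration.integrable_bound)
          show "integrable lborel (\<lambda>z. norm (\<psi> (z - x)) * C)"
            using \<psi>x_int by (intro integrable_mult_left integrable_norm)
          show "AE z in lborel. norm (LINT w|lborel. norm (case (z, w) of (z, w) \<Rightarrow> ?g z w)) \<le> norm (norm (\<psi> (z - x)) * C)"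
          proof (intro AE_I2)
            fix z
            have "(LINT w|lborel. norm (case (z, w) of (z, w) \<Rightarrow> ?g z w)) = norm (\<psi> (z - x)) * (LINT w|lborel. norm (f (z + w)) * k w)"
              using kpos by (simp add: norm_mult)
            also have "\<dots> \<le> norm (\<psi> (z - x)) * C" by (intro mult_left_mono Riesz_bound) simp
            finally show "norm (LINT w|lborel. norm (case (z, w) of (z, w) \<Rightarrow> ?g z w)) \<le> norm (norm (\<psi> (z - x)) * C)"
              by (simp add: integral_nonneg_AE)
          qed
        qed measurable
        show "AE z in lborel. integrable lborel (\<lambda>w. case (z, w) of (z, w) \<Rightarrow> ?g z w)"
          using Riesz_int by auto
      qed measurable
      have "(LINT y|lborel. ?F y * of_real (k (y - x))) = (LINT w|lborel. ?F (x + w) * of_real (k ((x + w) - x)))"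
        by (rule lborel_integral_translate[symmetric]) measurable
      also have "\<dots> = (LINT w|lborel. (LINT z|lborel. ?g z w))"
      proof (rule Bochner_Integration.integral_cong[OF refl])
        fix w
        have "?F (x + w) = (LINT z|lborel. f (w + z) * \<psi> ((w + z) - (x + w)))"
          by (rule lborel_integral_translate[symmetric]) measurable
        also have "\<dots> * of_real (k ((x + w) - x)) = (LINT z|lborel. ?g z w)"
          by (subst integral_mult_left_zero[symmetric]) (simp add: algebra_simps)
        finally show "?F (x + w) * of_real (k ((x + w) - x)) = (LINT z|lborel. ?g z w)" .
      qed
      also have "\<dots> = (LINT z|lborel. (LINT w|lborel. ?g z w))"
        by (rule lborel_pair.Fubini_integral[OF g_int])
      also have "\<dots> = (LINT z|lborel. (1/2) * (normal_fun f z * \<psi> (z - x)))"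
        unfolding normal_fun_riesz[OF f(2,3) n] by (simp add: k_def mult.commute)
      also have "\<dots> = (1/2) * distr_of (normal_fun f) (\<lambda>z. \<psi> (z - x))"
        unfolding distr_of_def by (rule integral_mult_right_zero)
      also have "distr_of (normal_fun f) (\<lambda>z. \<psi> (z - x)) = 0"
        using N test_translate[OF \<psi>(1), of x] translated_support[OF \<psi>(2) x] r(2)
        unfolding vanishes_on_def by blast
      finally show "(LINT y|lborel. ?F y * of_real (norm (y - x) powr (1 - real DIM(real^'n)))) = 0"
        by (simp add: k_def)
    qed
    then show ?thesis by (simp add: \<psi>_def)
  qed
  show ?thesis
    by (rule constant_coefficient_injective[OF f(2,1,3) P(1) r(1) vanish])
qed

theorem theorem1p3:
  fixes V :: "(real^'n) set"
  assumes "CARD('n) \<ge> 2" and "open V" and "V \<noteq> {}"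
  shows "(\<forall>f \<in> compact_distributions \<inter> admissible V.
            vanishes_on V (normal_distr f) \<longrightarrow> (\<forall>\<phi>\<in>test_functions. f \<phi> = 0)) \<and>
         (\<forall>f \<in> rapidly_decaying. distr_of f \<in> admissible V \<longrightarrow>
            vanishes_on V (distr_of (normal_fun f)) \<longrightarrow> f = (\<lambda>x. 0))"
proof (intro conjI ballI impI)
  fix u :: "'n functional" and \<phi> :: "'n cfun"
  assume "u \<in> compact_distributions \<inter> admissible V" "vanishes_on V (normal_distr u)" "\<phi> \<in> test_functions"
  then show "u \<phi> = 0"
    using distribution_case[OF assms] unfolding admissible_def by blast
next
  fix f :: "'n cfun"
  assume f: "f \<in> rapidly_decaying" "distr_of f \<in> admissible V" "vanishes_on V (distr_of (normal_fun f))"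
  obtain B where B: "continuous_on UNIV f" "integrable lborel f" "\<And>x. norm (f x) \<le> B"
    by (fact rapidly_decaying_bounded_integrable[OF f(1)])
  obtain P where P: "P \<noteq> 0" "vanishes_on V (poly_D P (distr_of f))"
    using f(2) unfolding admissible_def by blast
  show "f = (\<lambda>x. 0)"
    using function_case[OF assms B P f(3)] by blast
qed

end
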